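(* Let $F$ be an absolutely continuous function on $\mathbb{T}$, let $f=P[F]$ be its Poisson integral in $\mathbb{D}$, and suppose $\dot F\in L^p(\mathbb{T})$ for some $p\in[1,\infty]$. (1) If $p\in(1,\infty)$, then both $f_z$ and $\overline{f_{\bar z}}$ belong to the Hardy space $H^p(\mathbb{D})$, and there is a constant $A_p$ depending only on $p$ such that $$\max\big(\|f_z\|_p,\ \|\overline{f_{\bar z}}\|_p\big)\le A_p\,\|\dot F\|_{L^p}.$$ (2) If $p=1$ or $p=\infty$, then both $f_z$ and $\overline{f_{\bar z}}$ belong to $H^p(\mathbb{D})$ if and only if $H(\dot F)\in L^p(\mathbb{T})$. Moreover, in that case $$2iz f_z(z)=P\big[\dot F+iH(\dot F)\big](z),\qquad z\in\mathbb{D}.$$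
   Context: $\mathbb{D}$ is the open unit disk, $\mathbb{T}=\partial\mathbb{D}$. A function $F$ on $\mathbb{T}$ is absolutely continuous if $t\mapsto F(e^{it})$ is absolutely continuous, and $\dot F(e^{it})=\frac{d}{dt}F(e^{it})$. $f_z=\frac12(f_x-if_y)$, $f_{\bar z}=\frac12(f_x+if_y)$. The Poisson integral of $\phi\in L^1(\mathbb{T})$ is $P[\phi](z)=\frac1{2\pi}\int_0^{2\pi}\frac{1-|z|^2}{|1-ze^{-i\theta}|^2}\phi(e^{i\theta})\,d\theta$. $L^p(\mathbb{T})$ uses the normalized norm $\|F\|_{L^p}=(\frac1{2\pi}\int_0^{2\pi}|F(e^{i\theta})|^pd\theta)^{1/p}$ (ess sup for $p=\infty$). $H^p(\mathbb{D})$ is the space of analytic $g$ on $\mathbb{D}$ with $\|g\|_p=\sup_{0<r<1}(\frac1{2\pi}\int_0^{2\pi}|g(re^{i\theta})|^pd\theta)^{1/p}<\infty$ (for $p=\infty$, $\|g\|_\infty=\sup_{\mathbb{D}}|g|$). $H(\phi)$ denotes the Hilbert transform (conjugate function) of $\phi\in L^1(\mathbb{T})$: $H(\phi)(e^{i\theta})=\frac1{2\pi}\,\mathrm{p.v.}\int_{-\pi}^{\pi}\phi(e^{it})\cot\big(\tfrac{\theta-t}{2}\big)\,dt$, which exists a.e. *)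

theory Defs
  imports "HOL-Analysis.Analysis"
begin

definition abs_cont_on :: "real \<Rightarrow> real \<Rightarrow> (real \<Rightarrow> 'a::real_normed_vector) \<Rightarrow> bool" where
  "abs_cont_on a b g \<longleftrightarrow>
     (\<forall>e>0. \<exists>d>0. \<forall>(n::nat) (u::nat \<Rightarrow> real) (v::nat \<Rightarrow> real).
        (\<forall>k<n. a \<le> u k \<and> u k \<le> v k \<and> v k \<le> b) \<and>
        (\<forall>k<n. \<forall>j<n. k \<noteq> j \<longrightarrow> v k \<le> u j \<or> v j \<le> u k) \<and>
        (\<Sum>k<n. v k - u k) < d
        \<longrightarrow> (\<Sum>k<n. norm (g (v k) - g (u k))) < e)"

text \<open>F on the unit circle is absolutely continuous iff t \<mapsto> F(e^{it}) is
  (it is 2pi-periodic, so absolute continuity on [0,2pi] is the right notion).\<close>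
definition circle_abs_cont :: "(complex \<Rightarrow> complex) \<Rightarrow> bool" where
  "circle_abs_cont F \<longleftrightarrow> abs_cont_on 0 (2*pi) (\<lambda>t. F (cis t))"

definition dotF :: "(complex \<Rightarrow> complex) \<Rightarrow> real \<Rightarrow> complex" where
  "dotF F t = vector_derivative (\<lambda>s. F (cis s)) (at t)"

text \<open>Functions on the circle are represented by their values at e^{i theta}, theta in [0,2pi].
  Normalized L^p spaces, p in [1,\<infinity>].\<close>
definition circ_measure :: "real measure" where
  "circ_measure = lebesgue_on {0..2*pi}"

definition memLp :: "ereal \<Rightarrow> (real \<Rightarrow> complex) \<Rightarrow> bool" where
  "memLp p \<phi> \<longleftrightarrow> \<phi> \<in> borel_measurable circ_measure \<and>
     (if p = \<infinity> then (\<exists>M. AE \<theta> in circ_measure. norm (\<phi> \<theta>) \<le> M)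
      else integrable circ_measure (\<lambda>\<theta>. norm (\<phi> \<theta>) powr real_of_ereal p))"

definition Lp_norm :: "ereal \<Rightarrow> (real \<Rightarrow> complex) \<Rightarrow> real" where
  "Lp_norm p \<phi> =
     (if p = \<infinity> then Inf {M. AE \<theta> in circ_measure. norm (\<phi> \<theta>) \<le> M}
      else ((1 / (2*pi)) * integral\<^sup>L circ_measure (\<lambda>\<theta>. norm (\<phi> \<theta>) powr real_of_ereal p))
             powr (1 / real_of_ereal p))"

definition poisson :: "(real \<Rightarrow> complex) \<Rightarrow> complex \<Rightarrow> complex" where
  "poisson \<phi> z = (1 / (2*pi)) *
     integral\<^sup>L circ_measure
       (\<lambda>\<theta>. complex_of_real ((1 - (cmod z)\<^sup>2) / (cmod (1 - z * cis (-\<theta>)))\<^sup>2) * \<phi> \<theta>)"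

definition hardy_mean :: "ereal \<Rightarrow> (complex \<Rightarrow> complex) \<Rightarrow> real \<Rightarrow> real" where
  "hardy_mean p g r =
     ((1 / (2*pi)) * integral\<^sup>L circ_measure
        (\<lambda>\<theta>. norm (g (complex_of_real r * cis \<theta>)) powr real_of_ereal p))
       powr (1 / real_of_ereal p)"

definition in_Hardy :: "ereal \<Rightarrow> (complex \<Rightarrow> complex) \<Rightarrow> bool" where
  "in_Hardy p g \<longleftrightarrow> g holomorphic_on ball 0 1 \<and>
     (if p = \<infinity> then bounded (g ` ball 0 1)
      else bdd_above (hardy_mean p g ` {0<..<1}))"

definition hardy_norm :: "ereal \<Rightarrow> (complex \<Rightarrow> complex) \<Rightarrow> real" where
  "hardy_norm p g =
     (if p = \<infinity> then (SUP z\<in>ball 0 1. norm (g z))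
      else (SUP r\<in>{0<..<1}. hardy_mean p g r))"

definition wirt_z :: "(complex \<Rightarrow> complex) \<Rightarrow> complex \<Rightarrow> complex" where
  "wirt_z f z = (frechet_derivative f (at z) 1 - \<i> * frechet_derivative f (at z) \<i>) / 2"

definition wirt_zbar :: "(complex \<Rightarrow> complex) \<Rightarrow> complex \<Rightarrow> complex" where
  "wirt_zbar f z = (frechet_derivative f (at z) 1 + \<i> * frechet_derivative f (at z) \<i>) / 2"

text \<open>Conjugate function (Hilbert transform) of a 2pi-periodic phi, as a principal value:
  H(phi)(theta) = lim_{eps->0+} (1/2pi) int_{eps<=|s|<=pi} phi(theta - s) cot(s/2) ds.\<close>
definition hilbert :: "(real \<Rightarrow> complex) \<Rightarrow> real \<Rightarrow> complex" where
  "hilbert \<phi> \<theta> = Lim (at_right 0) (\<lambda>\<epsilon>::real. (1 / (2*pi)) *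
      integral\<^sup>L (lebesgue_on {s. \<epsilon> \<le> \<bar>s\<bar> \<and> \<bar>s\<bar> \<le> pi})
        (\<lambda>s. \<phi> (\<theta> - s) * complex_of_real (cot (s / 2))))"

end

theory Submission
  imports Defs "HOL-Complex_Analysis.Complex_Analysis"
begin

text \<open>
  Write \<open>\<phi>\<close> for the derivative of \<open>F\<close> along the circle and \<open>S[\<phi>]\<close> for its Herglotz transform, the integral of
  \<open>\<phi>\<close> against \<open>(e\<^sup>i\<^sup>t + z) / (e\<^sup>i\<^sup>t - z)\<close>. Differentiating \<open>f = P[F] = (S[F] + cnj S[cnj F]) / 2\<close> and integrating by
  parts, which absolute continuity permits, gives \<open>2 i z f\<^sub>z = S[\<phi>]\<close>; the function \<open>cnj f\<^sub>z\<^sub>b\<^sub>a\<^sub>r\<close> belongs to \<open>cnj \<phi>\<close> in the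
  same way, and \<open>cnj S[cnj \<phi>] = 2 P[\<phi>] - S[\<phi>]\<close> reduces everything to \<open>S[\<phi>]\<close>.

  For \<open>1 < p \<le> 2\<close> and \<open>\<phi> \<ge> 0\<close> the inequality \<open>|w|\<^sup>p \<le> A (Re w)\<^sup>p - B Re w\<^sup>p\<close> on the right half plane and the mean value
  property of \<open>S[\<phi>]\<^sup>p\<close> bound \<open>S[\<phi>]\<close> in \<open>H\<^sup>p\<close>; squaring passes from \<open>p\<close> to \<open>2p\<close>.

  At every point of differentiability of \<open>F\<close> the difference of \<open>S[\<phi>](r e\<^sup>i\<^sup>\<theta>)\<close> and \<open>\<phi>(\<theta>) + i H\<^sub>1\<^sub>-\<^sub>r \<phi>(\<theta>)\<close>, with the
  Hilbert integral truncated at \<open>1 - r\<close>, tends to 0. Radial limits of \<open>S[\<phi>]\<close> exist almost everywhere, because for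
  \<open>\<phi> \<ge> 0\<close> the function \<open>1 / (1 + S[\<phi>])\<close> is bounded and its limits vanish almost nowhere. Hence the
  principal value exists almost everywhere and \<open>\<phi> + i H \<phi>\<close> is the boundary function of \<open>S[\<phi>]\<close>. Fatou's lemma
  gives one implication for \<open>p = 1, \<infinity>\<close>. Conversely, if \<open>H \<phi>\<close> is integrable, then damping \<open>S[\<phi>]\<close> by
  bounded factors \<open>1 / (1 + \<epsilon> S[\<phi>\<^sub>j])\<close>, with \<open>\<phi>\<^sub>j\<close> the positive parts of \<open>\<phi>\<close>, and letting \<open>\<epsilon> \<rightarrow> 0\<close> yields
  \<open>S[\<phi>] = P[\<phi> + i H \<phi>]\<close>.
\<close>


section \<open>Absolutely continuous functions\<close>

text \<open>\<open>hilbert\<close> is a \<open>Lim\<close>, which says nothing where the principal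
  value fails to exist, and its existence for integrable \<phi> is a theorem in itself. It is drawn
  here from complex analysis: radial limits exist, and the truncated integral follows the radial
  approach at every point where the primitive is differentiable. Hence the need for Lebesgue's
  differentiation theorem and the fundamental theorem for absolutely continuous functions. The
  converse in (2) meets another obstacle: a holomorphic function with integrable boundary values
  need not be their Poisson integral, as exp((1+z)/(1-z)) shows, which is unbounded with boundary
  values of modulus 1. Herglotz transforms escape because they are combinations of functions with
  nonnegative real part, whose damping factors have modulus at most 1 and tend to 1. Finally,
  \<open>2 i z f_z\<close> loses control of f_z near the origin; the zero mean of \<phi> turns the
  quotient by z into a Cauchy-type integral, estimated directly for |z| <= 1/2. Stating everything
  for a pair of periodic functions on the line, in a setting closed under conjugation, lets one
  argument serve both Wirtinger derivatives.\<close>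

lemma mono_on_sum_nonoverlapping:
  fixes h u v :: "_ \<Rightarrow> real"
  assumes "finite C" and "mono_on {c..d} h" and "c \<le> d"
    and "\<And>i. i \<in> C \<Longrightarrow> c \<le> u i \<and> u i \<le> v i \<and> v i \<le> d"
    and "\<And>i j. i \<in> C \<Longrightarrow> j \<in> C \<Longrightarrow> i \<noteq> j \<Longrightarrow> v i \<le> u j \<or> v j \<le> u i"
  shows "(\<Sum>i\<in>C. h (v i) - h (u i)) \<le> h d - h c"
  using assms
\<comment> \<open>The interval with the largest midpoint lies to the right of all others, so the
  rest fits into \<open>{c..u x}\<close> and \<open>d\<close> shrinks to \<open>u x\<close>. Ties of
  \<open>u i + v i\<close> occur only between equal one-point intervals, which do no harm.\<close>
proof (induction C arbitrary: d rule: finite_ranking_induct[where f = "\<lambda>i. u i + v i"])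
  case empty
  then show ?case by (simp add: mono_on_def)
next
  case (insert x S)
  show ?case
  proof (cases "x \<in> S")
    case True
    with insert show ?thesis by (simp add: insert_absorb)
  next
    case False
    have ux: "c \<le> u x" "u x \<le> v x" "v x \<le> d" using insert.prems(3)[of x] by auto
    have *: "v j \<le> u x" if "j \<in> S" for j
    proof -
      have "v j \<le> u x \<or> v x \<le> u j" using insert.prems(4)[of j x] that False by auto
      moreover have "u j + v j \<le> u x + v x" using insert.hyps(2)[OF that] .
      moreover have "u j \<le> v j" using insert.prems(3)[of j] that by auto
      ultimately show ?thesis using ux by auto
    qed
    have "(\<Sum>i\<in>S. h (v i) - h (u i)) \<le> h (u x) - h c"
    proof (rule insert.IH)
      show "mono_on {c..u x} h" by (rule mono_on_subset[OF insert.prems(1)]) (use ux in auto)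
    qed (use * insert ux in auto)
    moreover have "h (v x) \<le> h d" by (rule mono_onD[OF insert.prems(1)]) (use ux in auto)
    ultimately show ?thesis using False insert.hyps(1) by simp
  qed
qed

text \<open>Vitali's theorem extracts disjoint intervals of slope at least \<open>q\<close> that
  cover \<open>S\<close> up to a null set; their lengths times \<open>q\<close> sum to at most the
  total growth of \<open>h\<close>. Used both for infinite derivates and inside the gap
  lemma.\<close>

lemma measure_le_of_large_derivates:
  fixes h :: "real \<Rightarrow> real"
  assumes h: "mono_on {c..d} h" "c \<le> d" and S: "S \<in> lmeasurable" and q: "0 \<le> q"
    and good: "\<And>x \<delta>. x \<in> S \<Longrightarrow> \<delta> > 0 \<Longrightarrow>
      \<exists>u v. u \<le> x \<and> x \<le> v \<and> u < v \<and> v - u < \<delta> \<and> c \<le> u \<and> v \<le> d \<and> q * (v - u) \<le> h v - h u"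
  shows "q * measure lebesgue S \<le> h d - h c"
proof (cases "q = 0")
  case True
  then show ?thesis using h by (simp add: mono_on_def)
next
  case False
  with q have q: "q > 0" by simp
  define K where "K = {(u, v). c \<le> u \<and> u < v \<and> v \<le> d \<and> q * (v - u) \<le> h v - h u}"
  \<comment> \<open>Vitali's theorem speaks of closed balls; in dimension one these are intervals,
    with the pair of endpoints recoded as centre and radius.\<close>
  have cb: "cball ((fst i + snd i)/2) ((snd i - fst i)/2) = {fst i..snd i}" for i :: "real \<times> real"
    by (auto simp: cball_eq_atLeastAtMost field_simps)
  obtain C where C: "countable C" "C \<subseteq> K"
     "pairwise (\<lambda>i j. disjnt {fst i..snd i} {fst j..snd j}) C"
     "negligible (S - (\<Union>i \<in> C. {fst i..snd i}))"
  proof (rule Vitali_covering_theorem_cballs[of K "\<lambda>i. (snd i - fst i)/2" S "\<lambda>i. (fst i + snd i)/2", unfolded cb])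
    show "0 < (snd i - fst i) / 2" if "i \<in> K" for i using that by (auto simp: K_def)
    show "\<exists>i. i \<in> K \<and> x \<in> {fst i..snd i} \<and> (snd i - fst i) / 2 < e" if xS: "x \<in> S" and e: "0 < e" for x e
    proof -
      obtain u v where "u \<le> x \<and> x \<le> v \<and> u < v \<and> v - u < 2 * e \<and> c \<le> u \<and> v \<le> d \<and> q * (v - u) \<le> h v - h u"
        using good[OF xS, of "2*e"] e by auto
      then show ?thesis by (intro exI[of _ "(u, v)"]) (auto simp: K_def)
    qed
  qed auto
  let ?T = "\<Union>i \<in> C. {fst i..snd i}"
  let ?B = "(h d - h c) / q"
  have fin: "measure lebesgue (\<Union>i \<in> C'. {fst i..snd i}) \<le> ?B" if C': "C' \<subseteq> C" "finite C'" for C'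
  proof -
    have K: "c \<le> fst i \<and> fst i < snd i \<and> snd i \<le> d \<and> q * (snd i - fst i) \<le> h (snd i) - h (fst i)" if "i \<in> C'" for i
      using that C C' by (auto simp: K_def)
    have "measure lebesgue (\<Union>i \<in> C'. {fst i..snd i}) \<le> (\<Sum>i\<in>C'. measure lebesgue {fst i..snd i})"
      by (rule measure_UNION_le[OF C'(2)]) auto
    also have "\<dots> = (\<Sum>i\<in>C'. snd i - fst i)"
      by (rule sum.cong) (use K in \<open>auto simp: less_imp_le\<close>)
    finally have "q * measure lebesgue (\<Union>i \<in> C'. {fst i..snd i}) \<le> (\<Sum>i\<in>C'. q * (snd i - fst i))"
      using q by (simp add: sum_distrib_left[symmetric])
    also have "\<dots> \<le> (\<Sum>i\<in>C'. h (snd i) - h (fst i))" by (rule sum_mono) (use K in auto)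
    also have "\<dots> \<le> h d - h c"
    proof (rule mono_on_sum_nonoverlapping[OF C'(2) h])
      show "snd i \<le> fst j \<or> snd j \<le> fst i" if "i \<in> C'" "j \<in> C'" "i \<noteq> j" for i j
      proof -
        have d: "disjnt {fst i..snd i} {fst j..snd j}" using C(3) that C' by (auto simp: pairwise_def)
        have "max (fst i) (fst j) \<in> {fst i..snd i} \<inter> {fst j..snd j}" if "\<not> ?thesis"
          using that K[OF \<open>i \<in> C'\<close>] K[OF \<open>j \<in> C'\<close>] by auto
        then show ?thesis using d unfolding disjnt_def by blast
      qed
    qed (use K in \<open>auto simp: less_imp_le\<close>)
    finally show ?thesis using q by (simp add: field_simps)
  qed
  have mT: "?T \<in> lmeasurable \<and> measure lebesgue ?T \<le> ?B"
  proof -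
    have ex: "\<exists>C'. C' \<subseteq> C \<and> finite C' \<and> E = (\<lambda>i. {fst i..snd i}) ` C'"
      if "E \<subseteq> (\<lambda>i. {fst i..snd i}) ` C" "finite E" for E
      using that by (meson finite_subset_image)
    have b: "measure lebesgue (\<Union>E) \<le> ?B" if "E \<subseteq> (\<lambda>i. {fst i..snd i}) ` C" "finite E" for E
      using ex[OF that] fin by auto
    have cnt: "countable ((\<lambda>i. {fst i..snd i}) ` C)" using C by auto
    have "\<Union>((\<lambda>i. {fst i..snd i}) ` C) \<in> lmeasurable"
      by (rule fmeasurable_Union_bound[OF cnt _ b]) auto
    moreover have "measure lebesgue (\<Union>((\<lambda>i. {fst i..snd i}) ` C)) \<le> ?B"
      by (rule measure_Union_bound[OF cnt _ b]) auto
    ultimately show ?thesis by simp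
  qed
  have neg: "S - ?T \<in> null_sets lebesgue" using C(4) by (simp add: negligible_iff_null_sets)
  have "measure lebesgue S \<le> measure lebesgue (?T \<union> (S - ?T))"
    by (rule measure_mono_fmeasurable) (use S mT neg in \<open>auto intro!: fmeasurable.Un simp: fmeasurableI_null_sets fmeasurableD\<close>)
  also have "\<dots> = measure lebesgue ?T" 
    by (rule measure_Un_null_set) (use neg mT in \<open>auto simp: fmeasurableD\<close>)
  finally have "q * measure lebesgue S \<le> q * measure lebesgue ?T" using q by simp
  also have "\<dots> \<le> h d - h c" using mT q by (simp add: field_simps)
  finally show ?thesis .
qed


text \<open>Cover \<open>S\<close> by disjoint intervals on which \<open>h\<close> grows with slope at most \<open>p\<close>; by the previous lemma each of
  them meets \<open>S\<close> in measure at most \<open>p / q\<close> times its length.\<close>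

lemma negligible_derivate_gap:
  fixes h :: "real \<Rightarrow> real"
  assumes h: "mono_on {c..d} h" "c \<le> d" and S: "S \<in> lmeasurable" "S \<subseteq> {c<..<d}" and pq: "0 \<le> p" "p < q"
    and up: "\<And>x \<delta>. x \<in> S \<Longrightarrow> \<delta> > 0 \<Longrightarrow>
      \<exists>u v. u < x \<and> x < v \<and> v - u < \<delta> \<and> q * (v - u) \<le> h v - h u"
    and lo: "\<And>x \<delta>. x \<in> S \<Longrightarrow> \<delta> > 0 \<Longrightarrow>
      \<exists>u v. u < x \<and> x < v \<and> v - u < \<delta> \<and> h v - h u \<le> p * (v - u)"
  shows "measure lebesgue S = 0"
proof -
  \<comment> \<open>\<open>S\<close> is enclosed in an open \<open>U\<close> of measure at most
    \<open>measure lebesgue S + e\<close>. The slow intervals are kept inside \<open>U\<close>,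
    which bounds their total length; \<open>e\<close> tends to 0 at the end.\<close>
  have main: "q * measure lebesgue S \<le> p * (measure lebesgue S + e)" if e: "e > 0" for e
  proof -
    obtain T where T: "open T" "S \<subseteq> T" "T - S \<in> lmeasurable" "emeasure lebesgue (T - S) < ennreal e"
      using sets_lebesgue_outer_open[OF fmeasurableD[OF S(1)] e] by blast
    define U where "U = T \<inter> {c<..<d}"
    have U: "open U" "S \<subseteq> U" "U \<subseteq> {c<..<d}" using T S unfolding U_def by (auto intro: open_Int)
    have UL: "U \<in> lmeasurable" using U(1) by (intro bounded_set_imp_lmeasurable) (auto simp: U_def bounded_Int)
    have mU: "measure lebesgue U \<le> measure lebesgue S + e"
    proof -
      have "measure lebesgue U \<le> measure lebesgue (S \<union> (T - S))"
        by (rule measure_mono_fmeasurable[OF _ fmeasurableD[OF UL] fmeasurable.Un[OF S(1) T(3)]]) (auto simp: U_def)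
      also have "\<dots> \<le> measure lebesgue S + measure lebesgue (T - S)"
        by (rule measure_Un_le) (use S T in auto)
      also have "measure lebesgue (T - S) \<le> e"
        using T(4) T(3) e by (simp add: emeasure_eq_measure2 ennreal_less_iff)
      finally show ?thesis by simp
    qed
    define K where "K = {(u, v). u < v \<and> {u..v} \<subseteq> U \<and> h v - h u \<le> p * (v - u)}"
    have cb: "cball ((fst i + snd i)/2) ((snd i - fst i)/2) = {fst i..snd i}" for i :: "real \<times> real"
      by (auto simp: cball_eq_atLeastAtMost field_simps)
    obtain C where C: "countable C" "C \<subseteq> K"
       "pairwise (\<lambda>i j. disjnt {fst i..snd i} {fst j..snd j}) C"
       "negligible (S - (\<Union>i \<in> C. {fst i..snd i}))"
    proof (rule Vitali_covering_theorem_cballs[of K "\<lambda>i. (snd i - fst i)/2" S "\<lambda>i. (fst i + snd i)/2", unfolded cb])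
      show "0 < (snd i - fst i) / 2" if "i \<in> K" for i using that by (auto simp: K_def)
      show "\<exists>i. i \<in> K \<and> x \<in> {fst i..snd i} \<and> (snd i - fst i) / 2 < e" if xS: "x \<in> S" and e: "0 < e" for x e
      proof -
        obtain r where r: "r > 0" "ball x r \<subseteq> U" using U xS by (meson openE subsetD)
        obtain u v where uv: "u < x \<and> x < v \<and> v - u < min (2 * e) r \<and> h v - h u \<le> p * (v - u)"
          using lo[OF xS, of "min (2*e) r"] e r by auto
        have "{u..v} \<subseteq> ball x r" using uv by (auto simp: dist_real_def)
        with uv r show ?thesis by (intro exI[of _ "(u, v)"]) (auto simp: K_def)
      qed
    qed auto
    define S' where "S' = S \<inter> (\<Union>i \<in> C. {fst i..snd i})"
    have mS': "measure lebesgue S = measure lebesgue S'"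
    proof -
      have "S = S' \<union> (S - (\<Union>i \<in> C. {fst i..snd i}))" by (auto simp: S'_def)
      moreover have "measure lebesgue (S' \<union> (S - (\<Union>i \<in> C. {fst i..snd i}))) = measure lebesgue S'"
      proof (rule measure_Un_null_set)
        have "(\<Union>i \<in> C. {fst i..snd i}) \<in> sets lebesgue" using C(1) by (intro sets.countable_UN'') auto
        then show "S' \<in> sets lebesgue" unfolding S'_def using S(1) by (intro sets.Int) (auto intro: fmeasurableD)
      qed (use C(4) in \<open>simp add: negligible_iff_null_sets\<close>)
      ultimately show ?thesis by simp
    qed
    have Ci: "fst i < snd i \<and> {fst i..snd i} \<subseteq> U \<and> h (snd i) - h (fst i) \<le> p * (snd i - fst i)" if "i \<in> C" for i
      using subsetD[OF C(2) that] by (auto simp: K_def simp del: atLeastatMost_subset_iff)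
    have piece: "q * measure lebesgue (S \<inter> {fst i..snd i}) \<le> p * (snd i - fst i)" if i: "i \<in> C" for i
    proof -
      have "fst i \<in> {fst i..snd i}" "snd i \<in> {fst i..snd i}" using Ci[OF i] by auto
      then have "fst i \<in> {c<..<d}" "snd i \<in> {c<..<d}" using Ci[OF i] U(3) by blast+
      then have ci: "c \<le> fst i" "fst i < snd i" "snd i \<le> d"
        using Ci[OF i] by auto
      \<comment> \<open>The endpoints are dropped because only around an interior point can the
        short intervals of slope at least \<open>q\<close> be kept inside
        \<open>{fst i..snd i}\<close>, as the previous lemma demands.\<close>
      have "measure lebesgue (S \<inter> {fst i..snd i}) = measure lebesgue (S \<inter> {fst i<..<snd i})"
      proof -
        have eq: "S \<inter> {fst i..snd i} = (S \<inter> {fst i<..<snd i}) \<union> (S \<inter> {fst i, snd i})" using ci by auto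
        have "S \<inter> {fst i, snd i} \<in> null_sets lebesgue"
          using negligible_finite[of "S \<inter> {fst i, snd i}"] by (simp add: negligible_iff_null_sets)
        then show ?thesis unfolding eq using S by (intro measure_Un_null_set) auto
      qed
      also have "q * \<dots> \<le> h (snd i) - h (fst i)"
      proof (rule measure_le_of_large_derivates[where h = h and c = "fst i" and d = "snd i"])
        show "mono_on {fst i..snd i} h" by (rule mono_on_subset[OF h(1)]) (use ci in auto)
        show "S \<inter> {fst i<..<snd i} \<in> lmeasurable" using S by (intro fmeasurable_Int_fmeasurable) auto
        show "\<exists>u v. u \<le> x \<and> x \<le> v \<and> u < v \<and> v - u < \<delta> \<and> fst i \<le> u \<and> v \<le> snd i \<and> q * (v - u) \<le> h v - h u"
          if x: "x \<in> S \<inter> {fst i<..<snd i}" and d: "0 < \<delta>" for x \<delta>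
        proof -
          obtain u v where "u < x \<and> x < v \<and> v - u < min \<delta> (min (x - fst i) (snd i - x)) \<and> q * (v - u) \<le> h v - h u"
            using up[of x "min \<delta> (min (x - fst i) (snd i - x))"] x d by auto
          then show ?thesis by (intro exI[of _ u] exI[of _ v]) auto
        qed
      qed (use ci pq in auto)
      also have "\<dots> \<le> p * (snd i - fst i)" using Ci[OF i] by auto
      finally show ?thesis .
    qed
    have fin: "q * measure lebesgue (S \<inter> (\<Union>i \<in> C'. {fst i..snd i})) \<le> p * (measure lebesgue S + e)"
      if C': "C' \<subseteq> C" "finite C'" for C'
    proof -
      have "measure lebesgue (S \<inter> (\<Union>i \<in> C'. {fst i..snd i})) = measure lebesgue (\<Union>i \<in> C'. S \<inter> {fst i..snd i})"
        by (simp only: Int_UN_distrib)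
      also have "\<dots> \<le> (\<Sum>i\<in>C'. measure lebesgue (S \<inter> {fst i..snd i}))"
        by (rule measure_UNION_le[OF C'(2)]) (use S in \<open>auto intro: fmeasurableD\<close>)
      finally have "q * measure lebesgue (S \<inter> (\<Union>i \<in> C'. {fst i..snd i})) \<le> (\<Sum>i\<in>C'. q * measure lebesgue (S \<inter> {fst i..snd i}))"
        using pq by (simp add: sum_distrib_left[symmetric])
      also have "\<dots> \<le> (\<Sum>i\<in>C'. p * (snd i - fst i))" by (rule sum_mono) (use piece C' in auto)
      also have "\<dots> = p * (\<Sum>i\<in>C'. measure lebesgue {fst i..snd i})"
        unfolding sum_distrib_left by (rule sum.cong) (use Ci C' in \<open>auto simp: less_imp_le subset_iff\<close>)
      also have "(\<Sum>i\<in>C'. measure lebesgue {fst i..snd i}) = measure lebesgue (\<Union>i\<in>C'. {fst i..snd i})"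
      proof (rule measure_UNION'[symmetric])
        show "pairwise (\<lambda>i j. disjnt {fst i..snd i} {fst j..snd j}) C'"
          using C(3) C'(1) by (rule pairwise_subset)
      qed (use C' in auto)
      also have "p * measure lebesgue (\<Union>i\<in>C'. {fst i..snd i}) \<le> p * measure lebesgue U"
        by (intro mult_left_mono measure_mono_fmeasurable) (use pq UL C' Ci in \<open>auto intro!: sets.finite_UN\<close>)
      also have "\<dots> \<le> p * (measure lebesgue S + e)" using mU pq by (intro mult_left_mono) auto
      finally show ?thesis .
    qed
    have "measure lebesgue (\<Union>((\<lambda>i. S \<inter> {fst i..snd i}) ` C)) \<le> p * (measure lebesgue S + e) / q"
    proof (rule measure_Union_bound)
      show "countable ((\<lambda>i. S \<inter> {fst i..snd i}) ` C)" using C by auto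
      show "D \<in> lmeasurable" if "D \<in> (\<lambda>i. S \<inter> {fst i..snd i}) ` C" for D
        using that S by (auto intro!: fmeasurable_Int_fmeasurable)
      fix E assume "E \<subseteq> (\<lambda>i. S \<inter> {fst i..snd i}) ` C" "finite E"
      then obtain C' where C': "C' \<subseteq> C" "finite C'" "E = (\<lambda>i. S \<inter> {fst i..snd i}) ` C'"
        by (meson finite_subset_image)
      then have "\<Union>E = S \<inter> (\<Union>i \<in> C'. {fst i..snd i})" by auto
      with fin[OF C'(1,2)] pq show "measure lebesgue (\<Union>E) \<le> p * (measure lebesgue S + e) / q"
        by (simp add: field_simps)
    qed
    moreover have "\<Union>((\<lambda>i. S \<inter> {fst i..snd i}) ` C) = S'" by (auto simp: S'_def)
    ultimately show ?thesis using pq mS' by (simp add: field_simps)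
  qed
  have "q * measure lebesgue S \<le> p * measure lebesgue S + e" if "e > 0" for e
  \<comment> \<open>For \<open>p > 0\<close> the slack is taken to be \<open>e / p\<close>, since
    \<open>main\<close> multiplies it by \<open>p\<close>.\<close>
  proof (cases "p = 0")
    case True
    then show ?thesis using main[of 1] that by simp
  next
    case False
    then show ?thesis using main[of "e/p"] that pq by (simp add: algebra_simps)
  qed
  then have "q * measure lebesgue S \<le> p * measure lebesgue S" by (rule field_le_epsilon)
  then show ?thesis using pq
    by (metis measure_nonneg mult_le_cancel_right not_le order_antisym)
qed


text \<open>Derivates are taken over short open intervals around the point. The sets of large or
  small derivates are then countable intersections of open sets, hence measurable without further
  argument. Monotonicity recovers the usual difference quotients, where the point is an
  endpoint.\<close>

lemma mono_on_negligible_not_differentiable: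
  fixes h :: "real \<Rightarrow> real"
  assumes h: "mono_on {c..d} h" "c \<le> d"
  shows "negligible {x \<in> {c<..<d}. \<not> h differentiable (at x)}"
proof -
  \<comment> \<open>\<open>P\<close> receives the length and the increment, so that one construction
    yields both large slopes (\<open>Up\<close>) and small slopes (\<open>Lo\<close>); each of the
    unions is open whatever \<open>h\<close> and \<open>P\<close> are.\<close>
  define G where "G = (\<lambda>P. {c<..<d} \<inter> (\<Inter>n::nat. \<Union>{{u<..<v} |u v. c < u \<and> v < d \<and> v - u < 1 / real (Suc n) \<and> P (v - u) (h v - h u)}))"
  have G_lm: "G P \<in> lmeasurable" for P
  proof -
    have "(\<Inter>n::nat. \<Union>{{u<..<v} |u v. c < u \<and> v < d \<and> v - u < 1 / real (Suc n) \<and> P (v - u) (h v - h u)}) \<in> sets borel"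
      by (intro sets.countable_INT'' borel_open open_Union) auto
    then have "G P \<in> sets lebesgue" unfolding G_def by (intro sets.Int) (auto intro: sets_completionI_sets)
    then show ?thesis by (rule bounded_set_imp_lmeasurable[rotated]) (auto simp: G_def bounded_Int)
  qed
  have G_iff: "x \<in> G P \<longleftrightarrow> x \<in> {c<..<d} \<and> (\<forall>\<delta>>0. \<exists>u v. c < u \<and> u < x \<and> x < v \<and> v < d \<and> v - u < \<delta> \<and> P (v - u) (h v - h u))" for x P
  proof
    assume x: "x \<in> G P"
    show "x \<in> {c<..<d} \<and> (\<forall>\<delta>>0. \<exists>u v. c < u \<and> u < x \<and> x < v \<and> v < d \<and> v - u < \<delta> \<and> P (v - u) (h v - h u))"
    proof (intro conjI allI impI)
      show "x \<in> {c<..<d}" using x by (simp add: G_def)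
      fix \<delta> :: real assume "\<delta> > 0"
      then obtain n where n: "1 / real (Suc n) < \<delta>" using reals_Archimedean[of \<delta>] by (auto simp: inverse_eq_divide)
      have "x \<in> \<Union>{{u<..<v} |u v. c < u \<and> v < d \<and> v - u < 1 / real (Suc n) \<and> P (v - u) (h v - h u)}"
        using x by (auto simp: G_def)
      then obtain u v where "x \<in> {u<..<v}" "c < u \<and> v < d \<and> v - u < 1 / real (Suc n) \<and> P (v - u) (h v - h u)"
        by blast
      then show "\<exists>u v. c < u \<and> u < x \<and> x < v \<and> v < d \<and> v - u < \<delta> \<and> P (v - u) (h v - h u)"
        using n by (intro exI[of _ u] exI[of _ v]) auto
    qed
  next
    assume x: "x \<in> {c<..<d} \<and> (\<forall>\<delta>>0. \<exists>u v. c < u \<and> u < x \<and> x < v \<and> v < d \<and> v - u < \<delta> \<and> P (v - u) (h v - h u))"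
    have "x \<in> \<Union>{{u<..<v} |u v. c < u \<and> v < d \<and> v - u < 1 / real (Suc n) \<and> P (v - u) (h v - h u)}" for n
    proof -
      obtain u v where "c < u \<and> u < x \<and> x < v \<and> v < d \<and> v - u < 1 / real (Suc n) \<and> P (v - u) (h v - h u)"
        using conjunct2[OF x, THEN spec, of "1 / real (Suc n)"] by (elim impE exE) simp_all
      then have "x \<in> {u<..<v}" "{u<..<v} \<in> {{u<..<v} |u v. c < u \<and> v < d \<and> v - u < 1 / real (Suc n) \<and> P (v - u) (h v - h u)}"
        by auto
      then show ?thesis by blast
    qed
    then show "x \<in> G P" using x by (auto simp: G_def)
  qed
  have G_D: "\<exists>u v. c < u \<and> u < x \<and> x < v \<and> v < d \<and> v - u < \<delta> \<and> P (v - u) (h v - h u)" if "x \<in> G P" "\<delta> > 0" for x P \<delta>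
    using that unfolding G_iff by blast
  have G_not: "\<exists>\<delta>>0. \<forall>u v. c < u \<longrightarrow> u < x \<longrightarrow> x < v \<longrightarrow> v < d \<longrightarrow> v - u < \<delta> \<longrightarrow> \<not> P (v - u) (h v - h u)"
    if "x \<in> {c<..<d}" "x \<notin> G P" for x P
    using that unfolding G_iff by blast
  define Up where "Up = (\<lambda>q::real. G (\<lambda>l e. q * l < e))"
  define Lo where "Lo = (\<lambda>p::real. G (\<lambda>l e. e < p * l))"
  have gap: "Up q \<inter> Lo p \<in> null_sets lebesgue" if "0 \<le> p" "p < q" for p q
  proof -
    have lm: "Up q \<inter> Lo p \<in> lmeasurable" unfolding Up_def Lo_def by (intro fmeasurable_Int_fmeasurable G_lm fmeasurableD)
    have "measure lebesgue (Up q \<inter> Lo p) = 0"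
    proof (rule negligible_derivate_gap[OF h lm _ that])
      show "Up q \<inter> Lo p \<subseteq> {c<..<d}" by (auto simp: Up_def G_def)
      show "\<exists>u v. u < x \<and> x < v \<and> v - u < \<delta> \<and> q * (v - u) \<le> h v - h u" if "x \<in> Up q \<inter> Lo p" "0 < \<delta>" for x \<delta>
      proof -
        note xd = that
        obtain u v where "u < x \<and> x < v \<and> v - u < \<delta> \<and> q * (v - u) < h v - h u"
          using G_D[OF IntD1[OF xd(1), unfolded Up_def] xd(2)] by blast
        then show ?thesis by (intro exI[of _ u] exI[of _ v]) simp
      qed
      show "\<exists>u v. u < x \<and> x < v \<and> v - u < \<delta> \<and> h v - h u \<le> p * (v - u)" if "x \<in> Up q \<inter> Lo p" "0 < \<delta>" for x \<delta>
      proof -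
        note xd = that
        obtain u v where "u < x \<and> x < v \<and> v - u < \<delta> \<and> h v - h u < p * (v - u)"
          using G_D[OF IntD2[OF xd(1), unfolded Lo_def] xd(2)] by blast
        then show ?thesis by (intro exI[of _ u] exI[of _ v]) simp
      qed
    qed
    with lm show ?thesis using negligible_iff_measure0 negligible_iff_null_sets by blast
  qed
  \<comment> \<open>At points of infinite derivate the growth estimate holds with every slope
    \<open>N\<close>, so \<open>N\<close> times the measure stays below a fixed number.\<close>
  have inf: "(\<Inter>N::nat. Up (real N)) \<in> null_sets lebesgue"
  proof -
    let ?S = "\<Inter>N::nat. Up (real N)"
    have lm: "?S \<in> lmeasurable"
    proof (rule bounded_set_imp_lmeasurable)
      show "bounded ?S" by (rule bounded_subset[of "{c<..<d}"]) (auto simp: Up_def G_def)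
      show "?S \<in> sets lebesgue" using G_lm by (intro sets.countable_INT'') (auto simp: Up_def intro: fmeasurableD)
    qed
    have "real N * measure lebesgue ?S \<le> h d - h c" for N :: nat
    proof (rule measure_le_of_large_derivates[OF h lm])
      fix x and \<delta> :: real assume x: "x \<in> ?S" and "\<delta> > 0"
      have "x \<in> Up (real N)" using x by simp
      then obtain u v where "c < u \<and> u < x \<and> x < v \<and> v < d \<and> v - u < \<delta> \<and> real N * (v - u) < h v - h u"
        using G_D[OF _ \<open>\<delta> > 0\<close>] unfolding Up_def by blast
      then show "\<exists>u v. u \<le> x \<and> x \<le> v \<and> u < v \<and> v - u < \<delta> \<and> c \<le> u \<and> v \<le> d \<and> real N * (v - u) \<le> h v - h u"
        by (intro exI[of _ u] exI[of _ v]) simp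
    qed simp
    then have "measure lebesgue ?S = 0"
      by (metis measure_nonneg not_le order_antisym_conv reals_Archimedean3)
    with lm show ?thesis using negligible_iff_measure0 negligible_iff_null_sets by blast
  qed
  \<comment> \<open>Rational slopes make the union countable; two rationals always fit between the
    lower derivate and a larger upper derivate.\<close>
  define Bad where "Bad = (\<Union>(p, q) \<in> {(p, q). p \<in> \<rat> \<and> q \<in> \<rat> \<and> 0 \<le> p \<and> p < q}. Up q \<inter> Lo p) \<union> (\<Inter>N::nat. Up (real N))"
  have "Bad \<in> null_sets lebesgue"
  proof -
    have "countable {(p::real, q::real). p \<in> \<rat> \<and> q \<in> \<rat> \<and> 0 \<le> p \<and> p < q}"
      by (rule countable_subset[of _ "\<rat> \<times> \<rat>"]) (auto intro: countable_rat)
    then show ?thesis unfolding Bad_def by (intro null_sets.Un null_sets_UN' inf) (auto intro: gap)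
  qed
  moreover have "h differentiable (at x)" if x: "x \<in> {c<..<d}" "x \<notin> Bad" for x
  proof -
    \<comment> \<open>\<open>Q\<close> collects the slopes that sufficiently short intervals around
      \<open>x\<close> do not exceed. Its infimum \<open>L\<close> is the upper derivate and will be
      the derivative.\<close>
    define Q where "Q = {q. 0 \<le> q \<and> x \<notin> Up q}"
    obtain N :: nat where "x \<notin> Up (real N)" using x by (auto simp: Bad_def)
    then have N: "real N \<in> Q" by (simp add: Q_def)
    have bdd: "bdd_below Q" by (rule bdd_belowI[of _ 0]) (auto simp: Q_def)
    define L where "L = Inf Q"
    have "Q \<noteq> {}" using N by blast
    then have L0: "L \<ge> 0" unfolding L_def by (rule cInf_greatest) (simp add: Q_def)
    \<comment> \<open>\<open>Up\<close> only knows intervals with \<open>x\<close> in the interior.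
      An interval ending at \<open>x\<close> is pushed past \<open>x\<close> by a small \<eta>:
      monotonicity lets the increment only grow, and the cost \<open>q * \<eta>\<close> is
      arbitrarily small.\<close>
    have upper: "\<exists>\<delta>>0. \<forall>u v. c < u \<and> u \<le> x \<and> x \<le> v \<and> v < d \<and> v - u < \<delta> \<and> (u = x \<or> v = x) \<longrightarrow> h v - h u \<le> q * (v - u)"
      if q: "q \<in> Q" for q
    proof -
      from q obtain \<delta> where d: "\<delta> > 0" "\<And>u v. c < u \<Longrightarrow> u < x \<Longrightarrow> x < v \<Longrightarrow> v < d \<Longrightarrow> v - u < \<delta> \<Longrightarrow> h v - h u \<le> q * (v - u)"
        using G_not[OF x(1), of "\<lambda>l e. q * l < e"] unfolding Q_def Up_def mem_Collect_eq not_less by blast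
      have q0: "q \<ge> 0" using q by (auto simp: Q_def)
      have "h v - h u \<le> q * (v - u)" if uv: "c < u" "u \<le> x" "x \<le> v" "v < d" "v - u < \<delta>" "u = x \<or> v = x" for u v
      proof (cases "u = v")
        case True then show ?thesis by simp
      next
        case False
        show ?thesis
        proof (rule field_le_epsilon)
          fix e :: real assume e: "e > 0"
          define m where "m = min (e / (q + 1)) (min (\<delta> - (v - u)) (min (x - c) (d - x)))"
          define \<eta> where "\<eta> = m / 2"
          have \<eta>: "\<eta> > 0" using e q0 uv x by (auto simp: \<eta>_def m_def)
          have "\<eta> < m" using \<eta> by (simp add: \<eta>_def)
          then have \<eta>2: "\<eta> < e / (q + 1)" "\<eta> < \<delta> - (v - u)" "\<eta> < x - c" "\<eta> < d - x"
            unfolding m_def by auto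
          have qe: "q * \<eta> \<le> e"
          proof -
            have "q * \<eta> \<le> (q + 1) * \<eta>" using \<eta> by (simp add: algebra_simps)
            also have "\<dots> \<le> e" using \<eta>2(1) q0 by (simp add: field_simps)
            finally show ?thesis .
          qed
          from uv(6) show "h v - h u \<le> q * (v - u) + e"
          proof
            assume ux: "u = x"
            have "h v - h (x - \<eta>) \<le> q * (v - (x - \<eta>))" using uv False ux \<eta> \<eta>2 x by (intro d(2)) auto
            moreover have "h (x - \<eta>) \<le> h x" by (rule mono_onD[OF h(1)]) (use \<eta> \<eta>2 x in auto)
            ultimately show ?thesis using qe ux by (simp add: algebra_simps)
          next
            assume vx: "v = x"
            have "h (x + \<eta>) - h u \<le> q * (x + \<eta> - u)" using uv False vx \<eta> \<eta>2 x by (intro d(2)) auto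
            moreover have "h x \<le> h (x + \<eta>)" by (rule mono_onD[OF h(1)]) (use \<eta> \<eta>2 x in auto)
            ultimately show ?thesis using qe vx by (simp add: algebra_simps)
          qed
        qed
      qed
      then show ?thesis using d(1) by blast
    qed
    \<comment> \<open>Here enlarging the interval adds an increment of \<open>h\<close> on the wrong
      side of the inequality. It is at most \<open>real N * \<eta>\<close> by \<open>upper\<close>
      for the slope \<open>real N\<close> in \<open>Q\<close>, so finiteness of the derivate is used
      as continuity at \<open>x\<close>.\<close>
    have lower: "\<exists>\<delta>>0. \<forall>u v. c < u \<and> u \<le> x \<and> x \<le> v \<and> v < d \<and> v - u < \<delta> \<and> (u = x \<or> v = x) \<longrightarrow> p * (v - u) \<le> h v - h u"
      if p: "p < L" for p
    proof (cases "p \<le> 0")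
      case True
      have "p * (v - u) \<le> h v - h u" if "c < u" "u \<le> x" "x \<le> v" "v < d" for u v
      proof -
        have "p * (v - u) \<le> 0" using True that by (simp add: mult_nonpos_nonneg)
        moreover have "h u \<le> h v" by (rule mono_onD[OF h(1)]) (use that in auto)
        ultimately show ?thesis by simp
      qed
      then show ?thesis by (intro exI[of _ 1]) auto
    next
      case False
      obtain p' where p': "p' \<in> \<rat>" "p < p'" "p' < L" using Rats_dense_in_real[OF p] by blast
      obtain q' where q': "q' \<in> \<rat>" "p' < q'" "q' < L" using Rats_dense_in_real[OF p'(3)] by blast
      have "q' \<notin> Q" using cInf_lower[OF _ bdd, of q'] q' by (auto simp: L_def)
      then have "x \<in> Up q'" using q' p' False by (auto simp: Q_def)
      then have "x \<notin> Lo p'" using x(2) p' q' False by (force simp: Bad_def)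
      then obtain \<delta> where d: "\<delta> > 0" "\<And>u v. c < u \<Longrightarrow> u < x \<Longrightarrow> x < v \<Longrightarrow> v < d \<Longrightarrow> v - u < \<delta> \<Longrightarrow> p' * (v - u) \<le> h v - h u"
        using G_not[OF x(1), of "\<lambda>l e. e < p' * l"] unfolding Lo_def not_less by blast
      obtain \<delta>' where d': "\<delta>' > 0" "\<And>u v. c < u \<Longrightarrow> u \<le> x \<Longrightarrow> x \<le> v \<Longrightarrow> v < d \<Longrightarrow> v - u < \<delta>' \<Longrightarrow> u = x \<or> v = x \<Longrightarrow> h v - h u \<le> real N * (v - u)"
        using upper[OF N] by blast
      have "p * (v - u) \<le> h v - h u" if uv: "c < u" "u \<le> x" "x \<le> v" "v < d" "v - u < min \<delta> \<delta>'" "u = x \<or> v = x" for u v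
      proof (cases "u = v")
        case True then show ?thesis by simp
      next
        case False2: False
        have "p * (v - u) \<le> p' * (v - u)" using p' uv by (intro mult_right_mono) auto
        moreover have "p' * (v - u) \<le> h v - h u"
        proof (rule field_le_epsilon)
          fix e :: real assume e: "e > 0"
          define m where "m = min (e / (real N + 1)) (min (min \<delta> \<delta>' - (v - u)) (min (x - c) (d - x)))"
          define \<eta> where "\<eta> = m / 2"
          have \<eta>: "\<eta> > 0" using e uv x by (auto simp: \<eta>_def m_def)
          have "\<eta> < m" using \<eta> by (simp add: \<eta>_def)
          then have \<eta>2: "\<eta> < e / (real N + 1)" "\<eta> < \<delta> - (v - u)" "\<eta> < \<delta>' - (v - u)" "\<eta> < x - c" "\<eta> < d - x"
            unfolding m_def by auto
          have qe: "real N * \<eta> \<le> e"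
          proof -
            have "real N * \<eta> \<le> (real N + 1) * \<eta>" using \<eta> by (simp add: algebra_simps)
            also have "\<dots> \<le> e" using \<eta>2(1) by (simp add: field_simps)
            finally show ?thesis .
          qed
          have p'\<eta>: "p' * \<eta> \<ge> 0" using \<eta> False p' by auto
          from uv(6) show "p' * (v - u) \<le> h v - h u + e"
          proof
            assume ux: "u = x"
            have "p' * (v - (x - \<eta>)) \<le> h v - h (x - \<eta>)" using uv False2 ux \<eta> \<eta>2 x by (intro d(2)) auto
            moreover have "h x - h (x - \<eta>) \<le> real N * (x - (x - \<eta>))" using uv ux \<eta> \<eta>2 x by (intro d'(2)) auto
            ultimately show ?thesis using qe ux p'\<eta> by (simp add: algebra_simps)
          next
            assume vx: "v = x"
            have "p' * (x + \<eta> - u) \<le> h (x + \<eta>) - h u" using uv False2 vx \<eta> \<eta>2 x by (intro d(2)) auto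
            moreover have "h (x + \<eta>) - h x \<le> real N * (x + \<eta> - x)" using uv vx \<eta> \<eta>2 x by (intro d'(2)) auto
            ultimately show ?thesis using qe vx p'\<eta> by (simp add: algebra_simps)
          qed
        qed
        ultimately show ?thesis by simp
      qed
      then show ?thesis using d d' by (intro exI[of _ "min \<delta> \<delta>'"]) auto
    qed
    have "(h has_real_derivative L) (at x)"
      unfolding has_field_derivative_iff LIM_eq
    proof (intro allI impI)
      fix e :: real assume e: "e > 0"
      obtain q where q: "q \<in> Q" "q < L + e / 2"
        using cInf_lessD[of Q "L + e/2"] N e unfolding L_def by auto
      obtain \<delta>1 where d1: "\<delta>1 > 0" "\<And>u v. c < u \<Longrightarrow> u \<le> x \<Longrightarrow> x \<le> v \<Longrightarrow> v < d \<Longrightarrow> v - u < \<delta>1 \<Longrightarrow> u = x \<or> v = x \<Longrightarrow> h v - h u \<le> q * (v - u)"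
        using upper[OF q(1)] by blast
      obtain \<delta>2 where d2: "\<delta>2 > 0" "\<And>u v. c < u \<Longrightarrow> u \<le> x \<Longrightarrow> x \<le> v \<Longrightarrow> v < d \<Longrightarrow> v - u < \<delta>2 \<Longrightarrow> u = x \<or> v = x \<Longrightarrow> (L - e/2) * (v - u) \<le> h v - h u"
        using lower[of "L - e/2"] e by auto
      define s where "s = min (min \<delta>1 \<delta>2) (min (x - c) (d - x))"
      have s: "s > 0" using d1 d2 x by (auto simp: s_def)
      have "norm ((h y - h x) / (y - x) - L) < e" if y: "y \<noteq> x" "norm (y - x) < s" for y
      proof (cases "x < y")
        case True
        have "h y - h x \<le> q * (y - x)" using y True x by (intro d1(2)) (auto simp: s_def)
        moreover have "(L - e/2) * (y - x) \<le> h y - h x" using y True x by (intro d2(2)) (auto simp: s_def)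
        ultimately have "(h y - h x) / (y - x) \<le> q" "L - e/2 \<le> (h y - h x) / (y - x)"
          using True by (auto simp: pos_divide_le_eq pos_le_divide_eq)
        then show ?thesis using q e by auto
      next
        case False
        have "h x - h y \<le> q * (x - y)" using y False x by (intro d1(2)) (auto simp: s_def)
        moreover have "(L - e/2) * (x - y) \<le> h x - h y" using y False x by (intro d2(2)) (auto simp: s_def)
        ultimately have "(h x - h y) / (x - y) \<le> q" "L - e/2 \<le> (h x - h y) / (x - y)"
          using False y by (auto simp: pos_divide_le_eq pos_le_divide_eq)
        moreover have "(h y - h x) / (y - x) = (h x - h y) / (x - y)"
          by (metis minus_diff_eq minus_divide_divide)
        ultimately show ?thesis using q e by auto
      qed
      with s show "\<exists>s>0. \<forall>y. y \<noteq> x \<and> norm (y - x) < s \<longrightarrow> norm ((h y - h x) / (y - x) - L) < e"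
        by blast
    qed
    then show ?thesis using real_differentiable_def by blast
  qed
  ultimately show ?thesis
    unfolding negligible_iff_null_sets[symmetric] by (elim negligible_subset) auto
qed


section \<open>Absolute continuity on an interval: stability, differentiability, fundamental
  theorem\<close>

text \<open>The body of \<open>abs_cont_on\<close> for one fixed delta and epsilon. Naming it keeps
  the quantifiers over families of intervals out of later proofs, which reach it through
  \<open>var_ltI\<close> and \<open>var_ltD\<close>.\<close>

definition var_lt :: "real \<Rightarrow> real \<Rightarrow> (real \<Rightarrow> 'a::real_normed_vector) \<Rightarrow> real \<Rightarrow> real \<Rightarrow> bool" where
  "var_lt a b g d e \<longleftrightarrow>
     (\<forall>(n::nat) (u::nat \<Rightarrow> real) (v::nat \<Rightarrow> real).
        (\<forall>k<n. a \<le> u k \<and> u k \<le> v k \<and> v k \<le> b) \<and>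
        (\<forall>k<n. \<forall>j<n. k \<noteq> j \<longrightarrow> v k \<le> u j \<or> v j \<le> u k) \<and>
        (\<Sum>k<n. v k - u k) < d
        \<longrightarrow> (\<Sum>k<n. norm (g (v k) - g (u k))) < e)"

lemma abs_cont_on_iff_var_lt: "abs_cont_on a b g \<longleftrightarrow> (\<forall>e>0. \<exists>d>0. var_lt a b g d e)"
  by (simp only: abs_cont_on_def var_lt_def)

lemma var_ltI:
  assumes "\<And>n u v. (\<And>k. k < n \<Longrightarrow> a \<le> u k) \<Longrightarrow> (\<And>k. k < n \<Longrightarrow> u k \<le> v k) \<Longrightarrow> (\<And>k. k < n \<Longrightarrow> v k \<le> b) \<Longrightarrow>
        (\<And>k j. k < n \<Longrightarrow> j < n \<Longrightarrow> k \<noteq> j \<Longrightarrow> v k \<le> u j \<or> v j \<le> u k) \<Longrightarrow>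
        (\<Sum>k<(n::nat). v k - u k) < d \<Longrightarrow> (\<Sum>k<n. norm (g (v k) - g (u k))) < e"
  shows "var_lt a b g d e"
  unfolding var_lt_def
proof (intro allI impI, elim conjE)
  fix n :: nat and u v :: "nat \<Rightarrow> real"
  assume 1: "\<forall>k<n. a \<le> u k \<and> u k \<le> v k \<and> v k \<le> b"
    and 2: "\<forall>k<n. \<forall>j<n. k \<noteq> j \<longrightarrow> v k \<le> u j \<or> v j \<le> u k"
    and 3: "(\<Sum>k<n. v k - u k) < d"
  show "(\<Sum>k<n. norm (g (v k) - g (u k))) < e"
    by (rule assms) (use 1 2 3 in \<open>simp_all\<close>)
qed

text \<open>Reindexing by a bijection with an initial segment of the naturals. This admits families
  indexed by any finite set, such as the members of a tagged division.\<close>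

lemma var_ltD:
  assumes "var_lt a b g d e" and C: "finite C" "\<And>i. i \<in> C \<Longrightarrow> a \<le> u i" "\<And>i. i \<in> C \<Longrightarrow> u i \<le> v i" "\<And>i. i \<in> C \<Longrightarrow> v i \<le> b"
      "\<And>i j. i \<in> C \<Longrightarrow> j \<in> C \<Longrightarrow> i \<noteq> j \<Longrightarrow> v i \<le> u j \<or> v j \<le> u i" "(\<Sum>i\<in>C. v i - u i) < d"
  shows "(\<Sum>i\<in>C. norm (g (v i) - g (u i))) < e"
proof -
  obtain f where f: "bij_betw f {..<card C} C"
    using ex_bij_betw_nat_finite[OF C(1)] by (auto simp: atLeast0LessThan)
  have fC: "f k \<in> C" if "k < card C" for k using f that by (auto simp: bij_betw_def)
  have fi: "f k \<noteq> f j" if "k < card C" "j < card C" "k \<noteq> j" for k j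
    using f that by (auto simp: bij_betw_def inj_on_def)
  have s: "(\<Sum>k<card C. v (f k) - u (f k)) = (\<Sum>i\<in>C. v i - u i)"
    by (rule sum.reindex_bij_betw[OF f])
  have "(\<Sum>k<card C. norm (g (v (f k)) - g (u (f k)))) < e"
  proof (rule assms(1)[unfolded var_lt_def, THEN spec, THEN spec, THEN spec, THEN mp], intro conjI allI impI)
    show "v (f k) \<le> u (f j) \<or> v (f j) \<le> u (f k)" if "k < card C" "j < card C" "k \<noteq> j" for k j
      by (rule C(5)[OF fC fC fi]) (use that in auto)
  qed (use s C fC in simp_all)
  moreover have "(\<Sum>k<card C. norm (g (v (f k)) - g (u (f k)))) = (\<Sum>i\<in>C. norm (g (v i) - g (u i)))"
    by (rule sum.reindex_bij_betw[OF f])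
  ultimately show ?thesis by simp
qed

lemma abs_cont_on_sub:
  assumes "abs_cont_on a b g" "a \<le> c" "d \<le> b"
  shows "abs_cont_on c d g"
proof -
  have "var_lt c d g \<delta> e" if "var_lt a b g \<delta> e" for \<delta> e
    by (rule var_ltI, rule var_ltD[OF that]) (use assms(2,3) in \<open>auto intro: order_trans\<close>)
  then show ?thesis using assms(1) unfolding abs_cont_on_iff_var_lt by blast
qed

text \<open>The main source of absolutely continuous functions: components and conjugates
  (\<open>B = 1\<close>, \<open>L = 0\<close>), products with a continuously differentiable factor,
  perturbations by a smooth term, and Lipschitz functions (\<open>g\<close> the zero
  function).\<close>

lemma abs_cont_on_dominated:
  fixes g :: "real \<Rightarrow> 'a::real_normed_vector" and h :: "real \<Rightarrow> 'b::real_normed_vector"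
  assumes g: "abs_cont_on a b g" and B: "B \<ge> 0" and L: "L \<ge> 0"
    and le: "\<And>x y. a \<le> x \<Longrightarrow> x \<le> y \<Longrightarrow> y \<le> b \<Longrightarrow> norm (h y - h x) \<le> B * norm (g y - g x) + L * (y - x)"
  shows "abs_cont_on a b h"
  unfolding abs_cont_on_iff_var_lt
proof (intro allI impI)
  fix e :: real assume e: "e > 0"
  \<comment> \<open>Each of the two terms gets half of \<open>e\<close>; the added 1, here and in
    the bound for \<open>L\<close>, keeps the denominators positive when \<open>B\<close> or
    \<open>L\<close> is 0.\<close>
  define e' where "e' = e / (2 * (B + 1))"
  have e': "e' > 0" using e B by (simp add: e'_def)
  with g obtain \<delta> where d: "\<delta> > 0" and D: "var_lt a b g \<delta> e'"
    unfolding abs_cont_on_iff_var_lt by blast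
  define \<delta>' where "\<delta>' = min \<delta> (e / (2 * (L + 1)))"
  have d': "\<delta>' > 0" using d e L by (simp add: \<delta>'_def)
  have "var_lt a b h \<delta>' e"
  proof (rule var_ltI)
    fix n :: nat and u v :: "nat \<Rightarrow> real"
    assume uv: "\<And>k. k < n \<Longrightarrow> a \<le> u k" "\<And>k. k < n \<Longrightarrow> u k \<le> v k" "\<And>k. k < n \<Longrightarrow> v k \<le> b"
      and dj: "\<And>k j. k < n \<Longrightarrow> j < n \<Longrightarrow> k \<noteq> j \<Longrightarrow> v k \<le> u j \<or> v j \<le> u k"
      and s: "(\<Sum>k<n. v k - u k) < \<delta>'"
    have 2: "(\<Sum>k<n. v k - u k) < e / (2 * (L + 1))" "(\<Sum>k<n. v k - u k) < \<delta>" using s by (simp_all add: \<delta>'_def)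
    have 1: "(\<Sum>k<n. norm (g (v k) - g (u k))) < e'"
      by (rule var_ltD[OF D]) (use uv dj 2 in simp_all)
    have 3: "0 \<le> (\<Sum>k<n. v k - u k)" using uv by (intro sum_nonneg) simp
    have "(\<Sum>k<n. norm (h (v k) - h (u k))) \<le> (\<Sum>k<n. B * norm (g (v k) - g (u k)) + L * (v k - u k))"
      by (rule sum_mono) (use uv le in simp)
    also have "\<dots> = B * (\<Sum>k<n. norm (g (v k) - g (u k))) + L * (\<Sum>k<n. v k - u k)"
      by (simp add: sum.distrib sum_distrib_left)
    also have "\<dots> \<le> B * e' + (L + 1) * (\<Sum>k<n. v k - u k)"
      using 1 3 B by (intro add_mono mult_left_mono mult_right_mono) auto
    also have "\<dots> < (B + 1) * e' + (L + 1) * (e / (2 * (L + 1)))"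
      using e' 2 L by (intro add_strict_mono mult_strict_left_mono) (auto simp: algebra_simps)
    also have "\<dots> = e / 2 + e / 2"
    proof (rule arg_cong2[where f = "(+)"])
      show "(B + 1) * e' = e / 2" using B by (simp add: e'_def field_simps)
      show "(L + 1) * (e / (2 * (L + 1))) = e / 2" using L by (simp add: field_simps)
    qed
    also have "\<dots> = e" by simp
    finally show "(\<Sum>k<n. norm (h (v k) - h (u k))) < e" .
  qed
  with d' show "\<exists>d>0. var_lt a b h d e" by blast
qed

lemma abs_cont_on_continuous_on:
  fixes g :: "real \<Rightarrow> 'a::real_normed_vector"
  assumes g: "abs_cont_on a b g"
  shows "continuous_on {a..b} g"
  unfolding continuous_on_iff
proof (intro ballI allI impI)
  fix x and e :: real assume x: "x \<in> {a..b}" and e: "e > 0"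
  obtain d where d: "d > 0" and D: "var_lt a b g d e"
    using g e unfolding abs_cont_on_iff_var_lt by blast
  have "dist (g y) (g x) < e" if "y \<in> {a..b}" "dist y x < d" for y
  proof -
    have "(\<Sum>k\<in>{()}. norm (g (max x y) - g (min x y))) < e"
      by (rule var_ltD[OF D]) (use that x in \<open>auto simp: dist_real_def min_def max_def\<close>)
    then show ?thesis by (auto simp: dist_norm min_def max_def norm_minus_commute split: if_splits)
  qed
  with d show "\<exists>d>0. \<forall>x'\<in>{a..b}. dist x' x < d \<longrightarrow> dist (g x') (g x) < e" by blast
qed

text \<open>Clipping every interval of a family at \<open>b\<close> with \<open>min\<close> and
  \<open>max\<close> gives one family on each side. Clipping is monotone and does not increase
  lengths, so non-overlap and smallness survive.\<close>

lemma abs_cont_on_combine: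
  fixes g :: "real \<Rightarrow> 'a::real_normed_vector"
  assumes g: "abs_cont_on a b g" "abs_cont_on b c g" and "a \<le> b" "b \<le> c"
  shows "abs_cont_on a c g"
  unfolding abs_cont_on_iff_var_lt
proof (intro allI impI)
  fix e :: real assume "e > 0"
  then have e: "e / 2 > 0" by simp
  obtain d1 where d1: "d1 > 0" and D1: "var_lt a b g d1 (e/2)"
    using g(1) e unfolding abs_cont_on_iff_var_lt by blast
  obtain d2 where d2: "d2 > 0" and D2: "var_lt b c g d2 (e/2)"
    using g(2) e unfolding abs_cont_on_iff_var_lt by blast
  have "var_lt a c g (min d1 d2) e"
  proof (rule var_ltI)
    fix n :: nat and u v :: "nat \<Rightarrow> real"
    assume uv: "\<And>k. k < n \<Longrightarrow> a \<le> u k" "\<And>k. k < n \<Longrightarrow> u k \<le> v k" "\<And>k. k < n \<Longrightarrow> v k \<le> c"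
      and dj: "\<And>k j. k < n \<Longrightarrow> j < n \<Longrightarrow> k \<noteq> j \<Longrightarrow> v k \<le> u j \<or> v j \<le> u k"
      and s: "(\<Sum>k<n. v k - u k) < min d1 d2"
    have s1: "(\<Sum>k<n. min (v k) b - min (u k) b) \<le> (\<Sum>k<n. v k - u k)"
    proof (rule sum_mono)
      show "min (v k) b - min (u k) b \<le> v k - u k" if "k \<in> {..<n}" for k using uv(2)[of k] that by (auto simp: min_def)
    qed
    have s2: "(\<Sum>k<n. max (v k) b - max (u k) b) \<le> (\<Sum>k<n. v k - u k)"
    proof (rule sum_mono)
      show "max (v k) b - max (u k) b \<le> v k - u k" if "k \<in> {..<n}" for k using uv(2)[of k] that by (auto simp: max_def)
    qed
    have 1: "(\<Sum>k<n. norm (g (min (v k) b) - g (min (u k) b))) < e/2"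
    proof (rule var_ltD[OF D1])
      show "min (v k) b \<le> min (u j) b \<or> min (v j) b \<le> min (u k) b" if "k \<in> {..<n}" "j \<in> {..<n}" "k \<noteq> j" for k j
        using dj[of k j] that by (auto simp: max_def min_def)
      show "a \<le> min (u k) b" "min (u k) b \<le> min (v k) b" if "k \<in> {..<n}" for k
        using that uv(1)[of k] uv(2)[of k] assms by auto
    qed (use s s1 in simp_all)
    have 2: "(\<Sum>k<n. norm (g (max (v k) b) - g (max (u k) b))) < e/2"
    proof (rule var_ltD[OF D2])
      show "max (v k) b \<le> max (u j) b \<or> max (v j) b \<le> max (u k) b" if "k \<in> {..<n}" "j \<in> {..<n}" "k \<noteq> j" for k j
        using dj[of k j] that by (auto simp: max_def min_def)
      show "max (u k) b \<le> max (v k) b" "max (v k) b \<le> c" if "k \<in> {..<n}" for k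
        using that uv(2)[of k] uv(3)[of k] assms by auto
    qed (use s s2 in simp_all)
    have "norm (g (v k) - g (u k)) \<le> norm (g (min (v k) b) - g (min (u k) b)) + norm (g (max (v k) b) - g (max (u k) b))" for k
    proof -
      have "g (v k) - g (u k) = (g (min (v k) b) - g (min (u k) b)) + (g (max (v k) b) - g (max (u k) b))"
        by (simp add: min_def max_def)
      then show ?thesis by (metis norm_triangle_ineq)
    qed
    then have "(\<Sum>k<n. norm (g (v k) - g (u k))) \<le> (\<Sum>k<n. norm (g (min (v k) b) - g (min (u k) b)) + norm (g (max (v k) b) - g (max (u k) b)))"
      by (intro sum_mono) auto
    also have "\<dots> < e" using 1 2 by (simp add: sum.distrib)
    finally show "(\<Sum>k<n. norm (g (v k) - g (u k))) < e" .
  qed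
  then show "\<exists>d>0. var_lt a c g d e" using d1 d2 by (intro exI[of _ "min d1 d2"]) simp
qed

lemma abs_cont_on_shift:
  assumes "abs_cont_on a b (\<lambda>t. g (t + c))"
  shows "abs_cont_on (a + c) (b + c) g"
proof -
  have "var_lt (a + c) (b + c) g d e" if "var_lt a b (\<lambda>t. g (t + c)) d e" for d e
  proof (rule var_ltI)
    fix n :: nat and u v :: "nat \<Rightarrow> real"
    assume uv: "\<And>k. k < n \<Longrightarrow> a + c \<le> u k" "\<And>k. k < n \<Longrightarrow> u k \<le> v k" "\<And>k. k < n \<Longrightarrow> v k \<le> b + c"
      and dj: "\<And>k j. k < n \<Longrightarrow> j < n \<Longrightarrow> k \<noteq> j \<Longrightarrow> v k \<le> u j \<or> v j \<le> u k"
      and s: "(\<Sum>k<n. v k - u k) < d"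
    have "(\<Sum>k<n. norm (g ((v k - c) + c) - g ((u k - c) + c))) < e"
      by (rule var_ltD[OF that, where u = "\<lambda>k. u k - c" and v = "\<lambda>k. v k - c"])
         (use uv dj s in \<open>simp_all add: le_diff_eq diff_le_eq\<close>)
    then show "(\<Sum>k<n. norm (g (v k) - g (u k))) < e" by simp
  qed
  then show ?thesis using assms unfolding abs_cont_on_iff_var_lt by blast
qed


text \<open>On an interval so short that all variation sums are at most 1 the variation \<open>V\<close> of \<open>g\<close> is finite, and
  \<open>g = V - (V - g)\<close> is a difference of monotone functions.\<close>

lemma abs_cont_on_negligible_not_differentiable:
  fixes g :: "real \<Rightarrow> real"
  assumes g: "abs_cont_on a b g"
  shows "negligible {x \<in> {a<..<b}. \<not> g differentiable (at x)}"
proof -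
  obtain \<delta> where d: "\<delta> > 0" and D: "var_lt a b g \<delta> 1"
    using g unfolding abs_cont_on_iff_var_lt by (meson zero_less_one)
  have local: "negligible {x \<in> {c<..<d}. \<not> g differentiable (at x)}"
    if cd: "a \<le> c" "c \<le> d" "d \<le> b" "d - c < \<delta>" for c d
  proof -
    \<comment> \<open>The variation is a supremum over families of non-overlapping intervals instead
      of partitions, so that a family on \<open>{c..x}\<close> is extended to one on
      \<open>{c..y}\<close> by merely appending the interval from \<open>x\<close> to
      \<open>y\<close>.\<close>
    define fam where "fam = (\<lambda>x (n::nat) u v. (\<forall>k<n. c \<le> u k \<and> u k \<le> v k \<and> v k \<le> x) \<and>
        (\<forall>k<n. \<forall>j<n. k \<noteq> j \<longrightarrow> v k \<le> u j \<or> v j \<le> u k))"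
    define S where "S = (\<lambda>x. {\<Sum>k<n. \<bar>g (v k) - g (u k)\<bar> |n u v. fam x n u v})"
    define V where "V = (\<lambda>x. Sup (S x))"
    have le1: "(\<Sum>k<n. \<bar>g (v k) - g (u k)\<bar>) \<le> 1" if "fam x n u v" "x \<le> d" for x n u v
    proof -
      have f: "c \<le> u k \<and> u k \<le> v k \<and> v k \<le> x" if "k < n" for k using \<open>fam x n u v\<close> that by (simp add: fam_def)
      have dj: "v k \<le> u j \<or> v j \<le> u k" if "k < n" "j < n" "k \<noteq> j" for k j using \<open>fam x n u v\<close> that by (simp add: fam_def)
      have "(\<Sum>k<n. id (v k) - id (u k)) \<le> id d - id c"
      proof (rule mono_on_sum_nonoverlapping[where h = id and c = c and d = d])
        show "mono_on {c..d} (id :: real \<Rightarrow> real)" by (simp add: mono_on_def)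
      qed (use f dj cd \<open>x \<le> d\<close> in \<open>force+\<close>)
      then have "(\<Sum>k<n. v k - u k) < \<delta>" using cd by simp
      then have "(\<Sum>k<n. norm (g (v k) - g (u k))) < 1"
        using f dj cd \<open>x \<le> d\<close> by (intro var_ltD[OF D]) force+
      then show ?thesis by simp
    qed
    have bdd: "bdd_above (S x)" if "x \<le> d" for x
      using le1[OF _ that] by (intro bdd_aboveI[of _ 1]) (auto simp: S_def)
    have "fam x 0 u u" for x and u :: "nat \<Rightarrow> real" by (simp add: fam_def)
    then have ne: "S x \<noteq> {}" for x unfolding S_def by blast
    have step: "V x + \<bar>g y - g x\<bar> \<le> V y" if xy: "c \<le> x" "x \<le> y" "y \<le> d" for x y
    proof -
      have "s \<le> V y - \<bar>g y - g x\<bar>" if sS: "s \<in> S x" for s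
      proof -
        obtain n u v where s: "s = (\<Sum>k<n. \<bar>g (v k) - g (u k)\<bar>)" and f: "fam x n u v"
          using sS unfolding S_def by blast
        define u' where "u' = u(n := x)"
        define v' where "v' = v(n := y)"
        have "fam y (Suc n) u' v'"
          unfolding fam_def
        proof (intro conjI allI impI)
          fix k assume k: "k < Suc n"
          have *: "c \<le> u k \<and> u k \<le> v k \<and> v k \<le> x" if "k < n" using f that by (simp add: fam_def)
          show "c \<le> u' k" "u' k \<le> v' k" "v' k \<le> y"
            using * k xy by (cases "k < n"; simp add: u'_def v'_def less_Suc_eq)+
        next
          fix k j assume k: "k < Suc n" "j < Suc n" "k \<noteq> j"
          have *: "v i \<le> x" if "i < n" for i using f that by (simp add: fam_def)
          have **: "v k \<le> u j \<or> v j \<le> u k" if "k < n" "j < n" using f that k by (simp add: fam_def)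
          show "v' k \<le> u' j \<or> v' j \<le> u' k"
            using * ** k by (cases "k < n"; cases "j < n"; simp add: u'_def v'_def less_Suc_eq)
        qed
        then have "(\<Sum>k<Suc n. \<bar>g (v' k) - g (u' k)\<bar>) \<in> S y" unfolding S_def by blast
        then have "(\<Sum>k<Suc n. \<bar>g (v' k) - g (u' k)\<bar>) \<le> V y"
          unfolding V_def by (rule cSup_upper) (rule bdd[OF xy(3)])
        moreover have "(\<Sum>k<Suc n. \<bar>g (v' k) - g (u' k)\<bar>) = s + \<bar>g y - g x\<bar>"
          by (simp add: s u'_def v'_def)
        ultimately show ?thesis by simp
      qed
      then have "V x \<le> V y - \<bar>g y - g x\<bar>" unfolding V_def by (intro cSup_least ne) (simp add: V_def)
      then show ?thesis by simp
    qed
    have m1: "mono_on {c..d} V"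
    proof (rule mono_onI)
      fix r s assume "r \<in> {c..d}" "s \<in> {c..d}" "r \<le> s"
      then show "V r \<le> V s" using step[of r s] by auto
    qed
    have m2: "mono_on {c..d} (\<lambda>x. V x - g x)"
    proof (rule mono_onI)
      fix r s assume "r \<in> {c..d}" "s \<in> {c..d}" "r \<le> s"
      then show "V r - g r \<le> V s - g s" using step[of r s] by auto
    qed
    have "{x \<in> {c<..<d}. \<not> g differentiable (at x)} \<subseteq> {x \<in> {c<..<d}. \<not> V differentiable (at x)} \<union> {x \<in> {c<..<d}. \<not> (\<lambda>x. V x - g x) differentiable (at x)}"
    proof -
      have "g differentiable (at x)" if "V differentiable (at x)" "(\<lambda>x. V x - g x) differentiable (at x)" for x
        using differentiable_diff[OF that] by simp
      then show ?thesis by blast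
    qed
    then show ?thesis
      using mono_on_negligible_not_differentiable[OF m1 cd(2)] mono_on_negligible_not_differentiable[OF m2 cd(2)]
      by (meson negligible_Un negligible_subset)
  qed
  \<comment> \<open>Differentiability is local, so countably many short subintervals with rational
    endpoints reach every interior point.\<close>
  define I where "I = {(c, d). c \<in> \<rat> \<and> d \<in> \<rat> \<and> a \<le> c \<and> c \<le> d \<and> d \<le> b \<and> d - c < \<delta>}"
  have "countable I" by (rule countable_subset[of _ "\<rat> \<times> \<rat>"]) (auto simp: I_def intro: countable_rat)
  then have "negligible (\<Union>(c, d)\<in>I. {x \<in> {c<..<d}. \<not> g differentiable (at x)})"
    unfolding negligible_iff_null_sets
    by (intro null_sets_UN') (use local in \<open>auto simp: I_def negligible_iff_null_sets\<close>)
  moreover have "{x \<in> {a<..<b}. \<not> g differentiable (at x)} \<subseteq> (\<Union>(c, d)\<in>I. {x \<in> {c<..<d}. \<not> g differentiable (at x)})"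
  proof
    fix x assume x: "x \<in> {x \<in> {a<..<b}. \<not> g differentiable (at x)}"
    have "max a (x - \<delta>/2) < x" using x d by simp
    then obtain c where c: "c \<in> \<rat>" "max a (x - \<delta>/2) < c" "c < x" using Rats_dense_in_real by blast
    have "x < min b (x + \<delta>/2)" using x d by simp
    then obtain e where e: "e \<in> \<rat>" "x < e" "e < min b (x + \<delta>/2)" using Rats_dense_in_real by blast
    have "(c, e) \<in> I" using c e by (auto simp: I_def)
    then show "x \<in> (\<Union>(c, d)\<in>I. {x \<in> {c<..<d}. \<not> g differentiable (at x)})" using x c e by auto
  qed
  ultimately show ?thesis by (rule negligible_subset)
qed

lemma abs_cont_on_complex_ae_derivative:
  fixes g :: "real \<Rightarrow> complex"
  assumes g: "abs_cont_on a b g"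
  shows "negligible {x \<in> {a<..<b}. \<not> g differentiable (at x)}"
proof -
  have re: "abs_cont_on a b (\<lambda>x. Re (g x))"
    by (rule abs_cont_on_dominated[OF g, of 1 0]) (auto simp: abs_Re_le_cmod simp flip: minus_complex.sel)
  have im: "abs_cont_on a b (\<lambda>x. Im (g x))"
    by (rule abs_cont_on_dominated[OF g, of 1 0]) (auto simp: abs_Im_le_cmod simp flip: minus_complex.sel)
  have "g differentiable (at x)" if "(\<lambda>x. Re (g x)) differentiable (at x)" "(\<lambda>x. Im (g x)) differentiable (at x)" for x
  proof -
    have "((\<lambda>x. Re (g x)) has_vector_derivative vector_derivative (\<lambda>x. Re (g x)) (at x)) (at x)"
      "((\<lambda>x. Im (g x)) has_vector_derivative vector_derivative (\<lambda>x. Im (g x)) (at x)) (at x)"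
      using that by (simp_all add: vector_derivative_works)
    then have "(g has_vector_derivative Complex (vector_derivative (\<lambda>x. Re (g x)) (at x)) (vector_derivative (\<lambda>x. Im (g x)) (at x))) (at x)"
      by (simp add: has_vector_derivative_complex_iff has_real_derivative_iff_has_vector_derivative)
    then show ?thesis by (rule differentiableI_vector)
  qed
  then have "{x \<in> {a<..<b}. \<not> g differentiable (at x)} \<subseteq>
     {x \<in> {a<..<b}. \<not> (\<lambda>x. Re (g x)) differentiable (at x)} \<union> {x \<in> {a<..<b}. \<not> (\<lambda>x. Im (g x)) differentiable (at x)}"
    by blast
  then show ?thesis
    using abs_cont_on_negligible_not_differentiable[OF re] abs_cont_on_negligible_not_differentiable[OF im]
    by (meson negligible_Un negligible_subset)
qed

text \<open>In the gauge integral, tags in the null set and all other tags are treated apart. The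
  former sit in intervals inside an open set of measure below \<delta>, where absolute continuity
  makes the increments of \<open>g\<close> small; at the latter differentiability compares the
  increment with \<open>\<phi>\<close>. Gauge integrability of \<open>\<phi>\<close> is part of the
  conclusion.\<close>

lemma abs_cont_on_fundamental_theorem:
  fixes g :: "real \<Rightarrow> 'a::euclidean_space"
  assumes g: "abs_cont_on a b g" and ab: "a \<le> b" and N: "negligible N"
    and deriv: "\<And>t. t \<in> {a<..<b} - N \<Longrightarrow> (g has_vector_derivative \<phi> t) (at t)"
  shows "(\<phi> has_integral (g b - g a)) {a..b}"
proof -
  define M where "M = N \<union> {a, b}"
  have M: "negligible M" unfolding M_def using N by simp
  define \<psi> where "\<psi> = (\<lambda>t. if t \<in> M then 0 else \<phi> t)"
  have "(\<psi> has_integral (g b - g a)) {a..b}"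
    unfolding has_integral_real
  proof (intro allI impI)
    fix e :: real assume e: "e > 0"
    define e' where "e' = e / (2 * (b - a + 1))"
    have e': "e' > 0" using e ab by (simp add: e'_def)
    obtain \<delta> where \<delta>: "\<delta> > 0" and D: "var_lt a b g \<delta> (e/2)"
      using g half_gt_zero[OF e] unfolding abs_cont_on_iff_var_lt by blast
    obtain U where U: "open U" "M \<subseteq> U" "U - M \<in> lmeasurable" "emeasure lebesgue (U - M) < ennreal \<delta>"
      using sets_lebesgue_outer_open[of M \<delta>] \<delta> M by (auto simp: negligible_iff_null_sets null_setsD2)
    have UL: "U \<in> lmeasurable" "measure lebesgue U < \<delta>"
    proof -
      have eq: "U = (U - M) \<union> M" using U by auto
      show "U \<in> lmeasurable"
        by (subst eq, rule fmeasurable.Un[OF U(3)]) (use M in \<open>simp add: negligible_iff_measure\<close>)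
      have "measure lebesgue U = measure lebesgue (U - M)"
        by (subst eq, rule measure_Un_null_set) (use M U(3) in \<open>auto simp: negligible_iff_null_sets fmeasurableD\<close>)
      then show "measure lebesgue U < \<delta>" using U(3,4) by (simp add: emeasure_eq_measure2 ennreal_less_iff)
    qed
    have "\<exists>r>0. (t \<in> M \<longrightarrow> ball t r \<subseteq> U) \<and>
        (t \<in> {a..b} - M \<longrightarrow> (\<forall>y. \<bar>y - t\<bar> < r \<longrightarrow> norm (g y - g t - (y - t) *\<^sub>R \<phi> t) \<le> e' * \<bar>y - t\<bar>))" for t
    proof (cases "t \<in> M")
      case True
      with U show ?thesis using open_contains_ball by (metis DiffD2 subsetD)
    next
      case tM: False
      show ?thesis
      proof (cases "t \<in> {a..b}")
        case True
        then have "(g has_derivative (\<lambda>h. h *\<^sub>R \<phi> t)) (at t)"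
          using deriv[of t] tM by (auto simp: M_def has_vector_derivative_def)
        then have "\<exists>d>0. \<forall>y. norm (y - t) < d \<longrightarrow> norm (g y - g t - (y - t) *\<^sub>R \<phi> t) \<le> e' * norm (y - t)"
          using e' unfolding has_derivative_at_alt by blast
        then show ?thesis using tM by auto
      next
        case False
        then show ?thesis using tM by (intro exI[of _ 1]) auto
      qed
    qed
    then obtain r where r: "\<And>t. r t > 0" "\<And>t. t \<in> M \<Longrightarrow> ball t (r t) \<subseteq> U"
      "\<And>t y. t \<in> {a..b} - M \<Longrightarrow> \<bar>y - t\<bar> < r t \<Longrightarrow> norm (g y - g t - (y - t) *\<^sub>R \<phi> t) \<le> e' * \<bar>y - t\<bar>"
      by metis
    define \<gamma> where "\<gamma> = (\<lambda>t. ball t (r t))"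
    show "\<exists>\<gamma>. gauge \<gamma> \<and> (\<forall>\<D>. \<D> tagged_division_of {a..b} \<and> \<gamma> fine \<D> \<longrightarrow>
        norm ((\<Sum>(x, k)\<in>\<D>. measure lborel k *\<^sub>R \<psi> x) - (g b - g a)) < e)"
    proof (intro exI[of _ \<gamma>] conjI allI impI)
      show "gauge \<gamma>" using r(1) by (auto simp: gauge_def \<gamma>_def)
      fix \<D> assume "\<D> tagged_division_of {a..b} \<and> \<gamma> fine \<D>"
      then have div: "\<D> tagged_division_of {a..b}" and fine: "\<gamma> fine \<D>" by auto
      have fin: "finite \<D>" using div by blast
      have K: "Inf K \<le> Sup K \<and> K = {Inf K..Sup K} \<and> x \<in> K \<and> a \<le> Inf K \<and> Sup K \<le> b \<and> measure lborel K = Sup K - Inf K \<and> K \<subseteq> ball x (r x)"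
        if xK: "(x, K) \<in> \<D>" for x K
      proof -
        obtain u v where uv: "K = cbox u v" using tagged_division_ofD(4)[OF div xK] by blast
        have x: "x \<in> K" "K \<subseteq> {a..b}" using tagged_division_ofD(2,3)[OF div xK] by auto
        then have "u \<le> v" using uv by auto
        then show ?thesis using x uv fine xK by (auto simp: fine_def \<gamma>_def)
      qed
      \<comment> \<open>Members of a division have disjoint interiors only, so a one-point member
        may lie inside another one. Such members carry no increment and are left out, since
        \<open>var_ltD\<close> wants intervals that are ordered.\<close>
      define \<D>' where "\<D>' = {p \<in> \<D>. fst p \<in> M \<and> Inf (snd p) < Sup (snd p)}"
      have finD': "finite \<D>'" using fin by (simp add: \<D>'_def)
      define err where "err = (\<lambda>(x, K). measure lborel K *\<^sub>R \<psi> x - (g (Sup K) - g (Inf K)))"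
      have split: "norm (err p) \<le> (if p \<in> \<D>' then norm (g (Sup (snd p)) - g (Inf (snd p))) else 0) + e' * measure lborel (snd p)"
        if p: "p \<in> \<D>" for p
      proof -
        obtain x K where pxK: "p = (x, K)" by (cases p)
        have k: "Inf K \<le> Sup K" "K = {Inf K..Sup K}" "x \<in> K" "a \<le> Inf K" "Sup K \<le> b" "measure lborel K = Sup K - Inf K" "K \<subseteq> ball x (r x)"
          using K p pxK by auto
        have c0: "0 \<le> e' * measure lborel K" using e' by simp
        show ?thesis
        proof (cases "x \<in> M")
          case True
          then show ?thesis
          proof (cases "Inf K < Sup K")
            case True
            with \<open>x \<in> M\<close> p pxK c0 show ?thesis by (simp add: err_def \<D>'_def \<psi>_def norm_minus_commute)
          next
            case False
            with k have "Inf K = Sup K" by simp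
            with \<open>x \<in> M\<close> p pxK c0 show ?thesis by (simp add: err_def \<D>'_def \<psi>_def)
          qed
        next
          case False
          have bnd: "\<bar>Sup K - x\<bar> < r x" "\<bar>Inf K - x\<bar> < r x"
          proof -
            have "Sup K \<in> K" "Inf K \<in> K" using k(1,2) by (metis atLeastAtMost_iff order_refl)+
            then show "\<bar>Sup K - x\<bar> < r x" "\<bar>Inf K - x\<bar> < r x" using k(7) by (auto simp: subset_iff dist_real_def abs_minus_commute)
          qed
          have xi: "Inf K \<le> x" "x \<le> Sup K" using k(2,3) by (metis atLeastAtMost_iff)+
          have x: "x \<in> {a..b} - M" using False k(4,5) xi by auto
          \<comment> \<open>The straddle estimate: the tag lies in the interval, so its distances to
            the two endpoints add up to the length.\<close>
          have "err p = - ((g (Sup K) - g x - (Sup K - x) *\<^sub>R \<phi> x) - (g (Inf K) - g x - (Inf K - x) *\<^sub>R \<phi> x))"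
            using False pxK by (simp add: err_def \<psi>_def k(6) algebra_simps)
          also have "norm \<dots> \<le> norm (g (Sup K) - g x - (Sup K - x) *\<^sub>R \<phi> x) + norm (g (Inf K) - g x - (Inf K - x) *\<^sub>R \<phi> x)"
            unfolding norm_minus_cancel by (rule norm_triangle_ineq4)
          also have "\<dots> \<le> e' * \<bar>Sup K - x\<bar> + e' * \<bar>Inf K - x\<bar>"
            by (intro add_mono r(3) x bnd)
          also have "\<dots> = e' * measure lborel K" using xi by (simp add: k(6) algebra_simps)
          finally show ?thesis using False pxK by (simp add: \<D>'_def)
        qed
      qed
      have "(\<Sum>(x, k)\<in>\<D>. measure lborel k *\<^sub>R \<psi> x) - (g b - g a) = (\<Sum>p\<in>\<D>. err p)"
        unfolding additive_tagged_division_1[OF ab div, of g, symmetric] err_def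
        by (simp add: sum_subtractf case_prod_beta)
      also have "norm \<dots> \<le> (\<Sum>p\<in>\<D>. norm (err p))" by (rule norm_sum)
      also have "\<dots> \<le> (\<Sum>p\<in>\<D>. (if p \<in> \<D>' then norm (g (Sup (snd p)) - g (Inf (snd p))) else 0) + e' * measure lborel (snd p))"
        by (rule sum_mono) (rule split)
      also have "\<dots> = (\<Sum>p\<in>\<D>'. norm (g (Sup (snd p)) - g (Inf (snd p)))) + e' * (\<Sum>p\<in>\<D>. measure lborel (snd p))"
      proof -
        have "(\<Sum>p\<in>\<D>. if p \<in> \<D>' then norm (g (Sup (snd p)) - g (Inf (snd p))) else 0) = (\<Sum>p\<in>\<D>'. norm (g (Sup (snd p)) - g (Inf (snd p))))"
          unfolding sum.inter_restrict[OF fin, symmetric] by (rule sum.cong) (auto simp: \<D>'_def)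
        then show ?thesis by (simp add: sum.distrib sum_distrib_left)
      qed
      also have "(\<Sum>p\<in>\<D>. measure lborel (snd p)) = b - a"
        using additive_content_tagged_division[of \<D> a b] div ab by (simp add: case_prod_beta)
      also have "(\<Sum>p\<in>\<D>'. norm (g (Sup (snd p)) - g (Inf (snd p)))) < e / 2"
      proof (rule var_ltD[OF D finD'])
        show nonov: "Sup (snd i) \<le> Inf (snd j) \<or> Sup (snd j) \<le> Inf (snd i)" if ij: "i \<in> \<D>'" "j \<in> \<D>'" "i \<noteq> j" for i j
        proof (rule ccontr)
          assume *: "\<not> ?thesis"
          have i: "(fst i, snd i) \<in> \<D>" "(fst j, snd j) \<in> \<D>" "(fst i, snd i) \<noteq> (fst j, snd j)" using ij by (auto simp: \<D>'_def)
          have "interior (snd i) \<inter> interior (snd j) = {}"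
            by (rule tagged_division_ofD(5)[OF div i])
          moreover have "interior (snd i) = {Inf (snd i)<..<Sup (snd i)}"
            using K[OF i(1)] by (metis interior_atLeastAtMost_real)
          moreover have "interior (snd j) = {Inf (snd j)<..<Sup (snd j)}"
            using K[OF i(2)] by (metis interior_atLeastAtMost_real)
          moreover have "(max (Inf (snd i)) (Inf (snd j)) + min (Sup (snd i)) (Sup (snd j))) / 2 \<in> {Inf (snd i)<..<Sup (snd i)} \<inter> {Inf (snd j)<..<Sup (snd j)}"
            using * ij by (auto simp: \<D>'_def max_def min_def field_simps)
          ultimately show False by blast
        qed
        have "(\<Sum>p\<in>\<D>'. Sup (snd p) - Inf (snd p)) = (\<Sum>p\<in>\<D>'. measure lebesgue {Inf (snd p)<..<Sup (snd p)})"
          by (rule sum.cong) (auto simp: \<D>'_def)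
        also have "\<dots> = measure lebesgue (\<Union>p\<in>\<D>'. {Inf (snd p)<..<Sup (snd p)})"
        proof (rule measure_UNION'[symmetric, OF finD'])
          show "pairwise (\<lambda>i j. disjnt {Inf (snd i)<..<Sup (snd i)} {Inf (snd j)<..<Sup (snd j)}) \<D>'"
            using nonov by (fastforce simp: pairwise_def disjnt_def)
        qed auto
        also have "\<dots> \<le> measure lebesgue U"
        proof (rule measure_mono_fmeasurable[OF _ _ UL(1)])
          show "(\<Union>p\<in>\<D>'. {Inf (snd p)<..<Sup (snd p)}) \<subseteq> U"
          proof (rule UN_least)
            fix p assume p: "p \<in> \<D>'"
            then have pD: "(fst p, snd p) \<in> \<D>" "fst p \<in> M" by (auto simp: \<D>'_def)
            have "{Inf (snd p)<..<Sup (snd p)} \<subseteq> snd p" using K[OF pD(1)] by (metis greaterThanLessThan_subseteq_atLeastAtMost_iff order_refl)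
            also have "\<dots> \<subseteq> U" using K[OF pD(1)] r(2)[OF pD(2)] by blast
            finally show "{Inf (snd p)<..<Sup (snd p)} \<subseteq> U" .
          qed
        qed (use finD' in \<open>auto intro!: sets.finite_UN\<close>)
        finally show "(\<Sum>p\<in>\<D>'. Sup (snd p) - Inf (snd p)) < \<delta>" using UL(2) by simp
        show "a \<le> Inf (snd i)" "Inf (snd i) \<le> Sup (snd i)" "Sup (snd i) \<le> b" if "i \<in> \<D>'" for i
          using K[of "fst i" "snd i"] that by (auto simp: \<D>'_def)
      qed
      also have "e / 2 + e' * (b - a) < e"
      proof -
        have "e' * (b - a) < e' * (b - a + 1)" using e' by simp
        also have "\<dots> = e / 2" using ab by (simp add: e'_def field_simps)
        finally show ?thesis by simp
      qed
      finally show "norm ((\<Sum>(x, k)\<in>\<D>. measure lborel k *\<^sub>R \<psi> x) - (g b - g a)) < e" by simp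
    qed
  qed
  then show ?thesis
    by (rule has_integral_spike[OF M, rotated]) (simp add: \<psi>_def)
qed



section \<open>Herglotz transforms and Poisson integrals\<close>

lemma space_circ_measure [simp]: "space circ_measure = {0..2*pi}"
  by (simp add: circ_measure_def)

lemma finite_measure_circ: "finite_measure circ_measure"
  unfolding circ_measure_def by (rule finite_measure_lebesgue_on) simp

lemma emeasure_circ_space: "emeasure circ_measure {0..2*pi} = ennreal (2*pi)"
  unfolding circ_measure_def by (subst emeasure_restrict_space) auto

lemma integral_circ_const [simp]: "(LINT t|circ_measure. (c :: 'a :: euclidean_space)) = (2 * pi) *\<^sub>R c"
  by (simp add: measure_def emeasure_circ_space)

lemma integrable_circ_const [simp]: "integrable circ_measure (\<lambda>t. (c :: 'a :: {banach, second_countable_topology}))"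
  by (rule finite_measure.integrable_const[OF finite_measure_circ])

lemma measurable_circ_continuous:
  fixes k :: "real \<Rightarrow> 'a::euclidean_space"
  shows "continuous_on {0..2*pi} k \<Longrightarrow> k \<in> borel_measurable circ_measure"
  unfolding circ_measure_def by (rule continuous_imp_measurable_on_sets_lebesgue) auto

lemma integrable_circ_continuous:
  fixes k :: "real \<Rightarrow> 'a::euclidean_space"
  shows "continuous_on {0..2*pi} k \<Longrightarrow> integrable circ_measure k"
  unfolding circ_measure_def by (rule continuous_imp_integrable_real)

lemma integrable_circ_mult_bounded:
  fixes \<phi> k :: "real \<Rightarrow> 'a::{euclidean_space, real_normed_algebra}"
  assumes phi: "integrable circ_measure \<phi>" and k: "k \<in> borel_measurable circ_measure"
    and B: "\<And>t. t \<in> {0..2*pi} \<Longrightarrow> norm (k t) \<le> B"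
  shows "integrable circ_measure (\<lambda>t. k t * \<phi> t)"
proof (rule Bochner_Integration.integrable_bound[where f = "\<lambda>t. B * norm (\<phi> t)"])
  show "integrable circ_measure (\<lambda>t. B * norm (\<phi> t))" using phi by auto
  show "(\<lambda>t. k t * \<phi> t) \<in> borel_measurable circ_measure"
    using k borel_measurable_integrable[OF phi] by measurable
  show "AE t in circ_measure. norm (k t * \<phi> t) \<le> norm (B * norm (\<phi> t))"
  proof (rule AE_I2)
    fix t assume "t \<in> space circ_measure"
    then have "norm (k t) \<le> B" using B by simp
    then have "norm (k t) * norm (\<phi> t) \<le> B * norm (\<phi> t)" by (rule mult_right_mono) simp
    then show "norm (k t * \<phi> t) \<le> norm (B * norm (\<phi> t))"
      using norm_mult_ineq[of "k t" "\<phi> t"] by simp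
  qed
qed

lemma integrable_circ_mult:
  fixes \<phi> k :: "real \<Rightarrow> 'a::{euclidean_space, real_normed_algebra}"
  assumes phi: "integrable circ_measure \<phi>" and k: "continuous_on {0..2*pi} k"
  shows "integrable circ_measure (\<lambda>t. k t * \<phi> t)"
proof -
  have "compact (k ` {0..2*pi})" by (rule compact_continuous_image[OF k]) simp
  then obtain B where "\<And>t. t \<in> {0..2*pi} \<Longrightarrow> norm (k t) \<le> B"
    using compact_imp_bounded bounded_iff by (metis imageI)
  then show ?thesis using integrable_circ_mult_bounded phi measurable_circ_continuous[OF k] by blast
qed

lemma integral_circ_bound:
  fixes \<phi> k :: "real \<Rightarrow> 'a::{euclidean_space, real_normed_algebra}"
  assumes phi: "integrable circ_measure \<phi>" and k: "k \<in> borel_measurable circ_measure"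
    and B: "\<And>t. t \<in> {0..2*pi} \<Longrightarrow> norm (k t) \<le> B"
  shows "norm (LINT t|circ_measure. k t * \<phi> t) \<le> B * (LINT t|circ_measure. norm (\<phi> t))"
proof -
  have "norm (LINT t|circ_measure. k t * \<phi> t) \<le> (LINT t|circ_measure. B * norm (\<phi> t))"
  proof (rule Bochner_Integration.integral_norm_bound_integral)
    fix t assume "t \<in> space circ_measure"
    then have "norm (k t) \<le> B" using B by simp
    then have "norm (k t) * norm (\<phi> t) \<le> B * norm (\<phi> t)" by (rule mult_right_mono) simp
    then show "norm (k t * \<phi> t) \<le> B * norm (\<phi> t)"
      using norm_mult_ineq[of "k t" "\<phi> t"] by simp
  next
    show "integrable circ_measure (\<lambda>t. k t * \<phi> t)" by (rule integrable_circ_mult_bounded[OF phi k B])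
  qed (use phi in auto)
  then show ?thesis by simp
qed

text \<open>The Herglotz kernel, whose real part is the Poisson kernel. It is also used at the
  boundary point \<open>z = 1\<close>, where it becomes \<open>- \<i> * cot (t / 2)\<close>, the
  kernel of the Hilbert transform.\<close>

definition hker :: "complex \<Rightarrow> real \<Rightarrow> complex" where
  "hker z t = (cis t + z) / (cis t - z)"

definition herglotz :: "(real \<Rightarrow> complex) \<Rightarrow> complex \<Rightarrow> complex" where
  "herglotz \<phi> z = 1 / (2 * pi) * (LINT t|circ_measure. hker z t * \<phi> t)"

lemma cis_minus_norm_ge: "norm (cis t - z) \<ge> 1 - norm z"
  using norm_triangle_ineq2[of "cis t" z] by simp

lemma cis_minus_nonzero: "norm z < 1 \<Longrightarrow> cis t - z \<noteq> 0"
  using cis_minus_norm_ge[of z t] by auto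

lemma cis_neq: "norm z < 1 \<Longrightarrow> cis t \<noteq> z"
  using cis_minus_nonzero by fastforce

lemma continuous_on_herglotz_kernel:
  "norm z < 1 \<Longrightarrow> continuous_on A (hker z)"
  unfolding hker_def[abs_def] by (intro continuous_intros) (simp add: cis_neq)

lemma integrable_herglotz:
  "integrable circ_measure \<phi> \<Longrightarrow> norm z < 1 \<Longrightarrow> integrable circ_measure (\<lambda>t. hker z t * \<phi> t)"
  by (rule integrable_circ_mult) (auto intro: continuous_on_herglotz_kernel)

lemma herglotz_add:
  "integrable circ_measure \<phi> \<Longrightarrow> integrable circ_measure \<psi> \<Longrightarrow> norm z < 1 \<Longrightarrow>
   herglotz (\<lambda>t. \<phi> t + \<psi> t) z = herglotz \<phi> z + herglotz \<psi> z"
  unfolding herglotz_def by (simp add: distrib_left integrable_herglotz add_divide_distrib)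

lemma herglotz_diff:
  "integrable circ_measure \<phi> \<Longrightarrow> integrable circ_measure \<psi> \<Longrightarrow> norm z < 1 \<Longrightarrow>
   herglotz (\<lambda>t. \<phi> t - \<psi> t) z = herglotz \<phi> z - herglotz \<psi> z"
  unfolding herglotz_def by (simp add: right_diff_distrib integrable_herglotz diff_divide_distrib)

lemma herglotz_cmult: "herglotz (\<lambda>t. c * \<phi> t) z = c * herglotz \<phi> z"
proof -
  have "(\<lambda>t. hker z t * (c * \<phi> t)) = (\<lambda>t. c * (hker z t * \<phi> t))"
    by (simp add: fun_eq_iff)
  then show ?thesis unfolding herglotz_def by simp
qed

text \<open>Differentiation under the integral with an explicit remainder: the difference quotient
  of the kernel minus its derivative is
  \<open>2 * cis t * (w - z) / ((cis t - w) * (cis t - z)\<^sup>2)\<close>, which is O(w - z)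
  uniformly in \<open>t\<close>.\<close>

lemma has_field_derivative_herglotz:
  assumes phi: "integrable circ_measure \<phi>" and z: "norm z < 1"
  shows "(herglotz \<phi> has_field_derivative 1 / (2 * pi) * (LINT t|circ_measure. 2 * cis t / (cis t - z)\<^sup>2 * \<phi> t)) (at z)"
proof -
  define \<delta> where "\<delta> = 1 - norm z"
  have \<delta>: "\<delta> > 0" using z by (simp add: \<delta>_def)
  define D where "D = 1 / (2 * pi) * (LINT t|circ_measure. 2 * cis t / (cis t - z)\<^sup>2 * \<phi> t)"
  define I where "I = (LINT t|circ_measure. norm (\<phi> t))"
  have bound: "norm ((herglotz \<phi> w - herglotz \<phi> z) / (w - z) - D) \<le> (1 / (2*pi) * (2 / (\<delta>/2 * \<delta>\<^sup>2)) * I) * norm (w - z)"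
    if w: "w \<noteq> z" "norm (w - z) < \<delta> / 2" for w
  proof -
    have nw: "norm w < 1" using w norm_triangle_ineq2[of w z] \<delta> by (simp add: \<delta>_def)
    have cw: "norm (cis t - w) \<ge> \<delta>/2" for t
      using cis_minus_norm_ge[of w t] w norm_triangle_ineq2[of w z] by (simp add: \<delta>_def field_simps)
    have cz: "norm (cis t - z) \<ge> \<delta>" for t
      using cis_minus_norm_ge[of z t] by (simp add: \<delta>_def)
    have i2: "integrable circ_measure (\<lambda>t. 2 * cis t / (cis t - z)\<^sup>2 * \<phi> t)"
      by (rule integrable_circ_mult[OF phi]) (auto intro!: continuous_intros simp: cis_neq[OF z])
    have pt: "(hker w t * \<phi> t - hker z t * \<phi> t) / (w - z) - 2 * cis t / (cis t - z)\<^sup>2 * \<phi> t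
        = 2 * cis t * (w - z) / ((cis t - w) * (cis t - z)\<^sup>2) * \<phi> t" for t
    proof -
      have nz: "cis t - w \<noteq> 0" "cis t - z \<noteq> 0" "w - z \<noteq> 0" using cis_minus_nonzero nw z w by auto
      have "hker w t - hker z t = 2 * cis t * (w - z) / ((cis t - w) * (cis t - z))"
        using nz unfolding hker_def by (simp add: divide_simps) (simp add: algebra_simps)
      then have "(hker w t * \<phi> t - hker z t * \<phi> t) / (w - z) = 2 * cis t / ((cis t - w) * (cis t - z)) * \<phi> t"
        using nz by (simp add: left_diff_distrib[symmetric])
      moreover have "2 * cis t / ((cis t - w) * (cis t - z)) - 2 * cis t / (cis t - z)\<^sup>2 = 2 * cis t * (w - z) / ((cis t - w) * (cis t - z)\<^sup>2)"
        using nz by (simp add: divide_simps power2_eq_square) (simp add: algebra_simps)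
      ultimately show ?thesis by (metis left_diff_distrib)
    qed
    have "(herglotz \<phi> w - herglotz \<phi> z) / (w - z) - D = 1 / (2*pi) *
       (LINT t|circ_measure. (hker w t * \<phi> t - hker z t * \<phi> t) / (w - z) - 2 * cis t / (cis t - z)\<^sup>2 * \<phi> t)"
      unfolding herglotz_def D_def
      using integrable_herglotz[OF phi nw] integrable_herglotz[OF phi z] i2
      by (simp add: right_diff_distrib diff_divide_distrib)
    also have "\<dots> = 1 / (2*pi) * (LINT t|circ_measure. 2 * cis t * (w - z) / ((cis t - w) * (cis t - z)\<^sup>2) * \<phi> t)"
      by (simp only: pt)
    also have "norm \<dots> \<le> 1 / (2*pi) * ((2 / (\<delta>/2 * \<delta>\<^sup>2)) * norm (w - z) * I)"
    proof -
      have "norm (LINT t|circ_measure. 2 * cis t * (w - z) / ((cis t - w) * (cis t - z)\<^sup>2) * \<phi> t) \<le> (2 / (\<delta>/2 * \<delta>\<^sup>2)) * norm (w - z) * I"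
        unfolding I_def
      proof (rule integral_circ_bound[OF phi])
        show "(\<lambda>t. 2 * cis t * (w - z) / ((cis t - w) * (cis t - z)\<^sup>2)) \<in> borel_measurable circ_measure"
          by (rule measurable_circ_continuous) (auto intro!: continuous_intros simp: cis_neq[OF nw] cis_neq[OF z])
        fix t
        have "\<delta>/2 * \<delta>\<^sup>2 \<le> norm (cis t - w) * (norm (cis t - z))\<^sup>2"
          using \<delta> cw[of t] cz[of t] by (intro mult_mono power_mono) auto
        then have "2 * norm (w - z) / (norm (cis t - w) * (norm (cis t - z))\<^sup>2) \<le> 2 * norm (w - z) / (\<delta>/2 * \<delta>\<^sup>2)"
          using \<delta> by (intro divide_left_mono mult_pos_pos zero_less_power) (auto simp: cis_neq[OF nw] cis_neq[OF z])
        then show "norm (2 * cis t * (w - z) / ((cis t - w) * (cis t - z)\<^sup>2)) \<le> (2 / (\<delta>/2 * \<delta>\<^sup>2)) * norm (w - z)"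
          by (simp add: norm_mult norm_divide norm_power)
      qed
      then have "1 / (2*pi) * norm (LINT t|circ_measure. 2 * cis t * (w - z) / ((cis t - w) * (cis t - z)\<^sup>2) * \<phi> t) \<le> 1 / (2*pi) * ((2 / (\<delta>/2 * \<delta>\<^sup>2)) * norm (w - z) * I)"
        by (rule mult_left_mono) simp
      then show ?thesis unfolding norm_mult norm_of_real by simp
    qed
    finally show ?thesis by (simp add: mult_ac)
  qed
  have "((\<lambda>w. (herglotz \<phi> w - herglotz \<phi> z) / (w - z) - D) \<longlongrightarrow> 0) (at z)"
  proof (rule Lim_null_comparison)
    show "\<forall>\<^sub>F w in at z. norm ((herglotz \<phi> w - herglotz \<phi> z) / (w - z) - D) \<le> (1 / (2*pi) * (2 / (\<delta>/2 * \<delta>\<^sup>2)) * I) * norm (w - z)"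
      unfolding eventually_at using \<delta> bound by (intro exI[of _ "\<delta>/2"]) (auto simp: dist_norm)
    show "((\<lambda>w. (1 / (2*pi) * (2 / (\<delta>/2 * \<delta>\<^sup>2)) * I) * norm (w - z)) \<longlongrightarrow> 0) (at z)"
      by (rule tendsto_eq_intros refl | simp)+
  qed
  then show ?thesis
    unfolding has_field_derivative_iff D_def[symmetric] by (simp add: LIM_zero_iff)
qed

lemma holomorphic_herglotz: "integrable circ_measure \<phi> \<Longrightarrow> herglotz \<phi> holomorphic_on ball 0 1"
  unfolding holomorphic_on_def field_differentiable_def
  by (intro ballI exI, rule has_field_derivative_at_within, rule has_field_derivative_herglotz) auto

lemma poisson_kernel_eq:
  assumes "norm z < 1"
  shows "(1 - (cmod z)\<^sup>2) / (cmod (1 - z * cis (-t)))\<^sup>2 = Re (hker z t)"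
proof -
  have n: "norm (cis t - z) = norm (1 - z * cis (-t))"
  proof -
    have "cis t - z = cis t * (1 - z * cis (-t))" by (simp add: right_diff_distrib mult.left_commute[of _ z] cis_mult)
    then show ?thesis by (simp add: norm_mult)
  qed
  have c: "(cos t)\<^sup>2 + (sin t)\<^sup>2 = 1" by simp
  have "Re (hker z t) = Re ((cis t + z) * cnj (cis t - z)) / (norm (cis t - z))\<^sup>2"
    by (simp only: hker_def Re_divide cmod_power2 times_complex.sel cnj.sel mult_minus_right diff_minus_eq_add)
  also have "Re ((cis t + z) * cnj (cis t - z)) = 1 - (cmod z)\<^sup>2"
    using c unfolding cmod_power2 by (simp add: algebra_simps power2_eq_square)
  finally show ?thesis using n by simp
qed

lemma poisson_eq:
  fixes \<phi> :: "real \<Rightarrow> complex"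
  assumes "norm z < 1"
  shows "poisson \<phi> z = 1 / (2*pi) * (LINT t|circ_measure. of_real (Re (hker z t)) * \<phi> t)"
  unfolding poisson_def poisson_kernel_eq[OF assms] by simp

lemma poisson_kernel_pos: 
  assumes "norm z < 1"
  shows "Re (hker z t) > 0"
proof -
  have "1 - z * cis (-t) \<noteq> 0" 
    using norm_triangle_ineq2[of 1 "z * cis (-t)"] assms by (auto simp: norm_mult)
  moreover have "(cmod z)\<^sup>2 < 1" using assms by (simp add: power_less_one_iff abs_square_less_1)
  ultimately show ?thesis unfolding poisson_kernel_eq[OF assms, symmetric] by simp
qed

lemma integrable_poisson:
  fixes \<phi> :: "real \<Rightarrow> complex"
  shows "integrable circ_measure \<phi> \<Longrightarrow> norm z < 1 \<Longrightarrow> integrable circ_measure (\<lambda>t. of_real (Re (hker z t)) * \<phi> t)"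
  by (rule integrable_circ_mult) (auto intro!: continuous_on_herglotz_kernel continuous_intros)

lemma integrable_poisson_real:
  fixes \<phi> :: "real \<Rightarrow> real"
  shows "integrable circ_measure \<phi> \<Longrightarrow> norm z < 1 \<Longrightarrow> integrable circ_measure (\<lambda>t. Re (hker z t) * \<phi> t)"
  by (rule integrable_circ_mult) (auto intro!: continuous_on_herglotz_kernel continuous_intros)

lemma cnj_herglotz_cnj:
  "cnj (herglotz (\<lambda>t. cnj (\<phi> t)) z) = 1 / (2*pi) * (LINT t|circ_measure. cnj (hker z t) * \<phi> t)"
proof -
  have "cnj (LINT t|circ_measure. hker z t * cnj (\<phi> t)) = (LINT t|circ_measure. cnj (hker z t * cnj (\<phi> t)))"
    by (rule Bochner_Integration.integral_cnj[symmetric])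
  then show ?thesis unfolding herglotz_def by simp
qed

lemma integrable_cnj_circ: "integrable circ_measure \<phi> \<Longrightarrow> integrable circ_measure (\<lambda>t. cnj (\<phi> t))"
  by (rule integrable_bounded_linear[OF bounded_linear_cnj])

text \<open>For complex \<open>\<phi>\<close> the Poisson integral is not the real part of the
  Herglotz transform. Twice the real part of the kernel is the kernel plus its conjugate, and the
  conjugate kernel is handled by conjugating \<open>\<phi>\<close>.\<close>

lemma poisson_herglotz:
  fixes \<phi> :: "real \<Rightarrow> complex"
  assumes phi: "integrable circ_measure \<phi>" and z: "norm z < 1"
  shows "poisson \<phi> z = (herglotz \<phi> z + cnj (herglotz (\<lambda>t. cnj (\<phi> t)) z)) / 2"
proof -
  have i: "integrable circ_measure (\<lambda>t. cnj (hker z t) * \<phi> t)"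
    by (rule integrable_circ_mult[OF phi]) (auto intro!: continuous_on_herglotz_kernel[OF z] continuous_on_cnj simp del: complex_cnj_divide)
  have "herglotz \<phi> z + cnj (herglotz (\<lambda>t. cnj (\<phi> t)) z) =
     1 / (2*pi) * ((LINT t|circ_measure. hker z t * \<phi> t) + (LINT t|circ_measure. cnj (hker z t) * \<phi> t))"
    unfolding cnj_herglotz_cnj by (simp only: herglotz_def distrib_left)
  also have "(LINT t|circ_measure. hker z t * \<phi> t) + (LINT t|circ_measure. cnj (hker z t) * \<phi> t)
     = (LINT t|circ_measure. hker z t * \<phi> t + cnj (hker z t) * \<phi> t)"
    by (rule Bochner_Integration.integral_add[OF integrable_herglotz[OF phi z] i, symmetric])
  also have "\<dots> = (LINT t|circ_measure. 2 * (of_real (Re (hker z t)) * \<phi> t))"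
    by (simp only: distrib_right[symmetric] complex_add_cnj mult.assoc of_real_mult of_real_numeral)
  also have "\<dots> = 2 * (LINT t|circ_measure. of_real (Re (hker z t)) * \<phi> t)" by simp
  finally show ?thesis unfolding poisson_eq[OF z] by simp
qed

section \<open>Cauchy's formula on the unit circle and the reproducing properties of the
  kernels\<close>

lemma circ_Cauchy_integral:
  fixes h :: "complex \<Rightarrow> complex"
  assumes h: "continuous_on (cball 0 1) h" "h holomorphic_on ball 0 1" and w: "norm w < 1"
  shows "(LINT t|circ_measure. cis t / (cis t - w) * h (cis t)) = 2 * pi * h w"
proof -
  have "((\<lambda>u. h u/(u-w)) has_contour_integral (2 * of_real pi * \<i> * h w)) (circlepath 0 1)"
    by (rule Cauchy_integral_circlepath[OF h]) (use w in simp)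
  then have "((\<lambda>t. h (0 + of_real 1 * cis t)/((0 + of_real 1 * cis t) - w) * of_real 1 * \<i> * cis t) has_integral (2 * of_real pi * \<i> * h w)) {0..2*pi}"
    unfolding circlepath_def by (subst (asm) has_contour_integral_part_circlepath_iff) auto
  then have "((\<lambda>t. -\<i> * (h (0 + of_real 1 * cis t)/((0 + of_real 1 * cis t) - w) * of_real 1 * \<i> * cis t)) has_integral (-\<i> * (2 * of_real pi * \<i> * h w))) {0..2*pi}"
    by (rule has_integral_mult_right)
  also have "(\<lambda>t. -\<i> * (h (0 + of_real 1 * cis t)/((0 + of_real 1 * cis t) - w) * of_real 1 * \<i> * cis t)) = (\<lambda>t. cis t / (cis t - w) * h (cis t))"
  proof
    fix t
    have "-\<i> * (h (cis t)/(cis t - w) * \<i> * cis t) = (-\<i> * \<i>) * (cis t / (cis t - w) * h (cis t))"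
      by (simp only: divide_inverse mult_ac)
    then show "-\<i> * (h (0 + of_real 1 * cis t)/((0 + of_real 1 * cis t) - w) * of_real 1 * \<i> * cis t) = cis t / (cis t - w) * h (cis t)"
      by simp
  qed
  finally have hi: "((\<lambda>t. cis t / (cis t - w) * h (cis t)) has_integral (2 * pi * h w)) {0..2*pi}" by (simp add: mult_ac)
  have "continuous_on {0..2*pi} (\<lambda>t. cis t / (cis t - w) * h (cis t))"
    by (intro continuous_intros continuous_on_compose2[OF h(1)]) (auto simp: cis_neq[OF w])
  then have "integrable (lebesgue_on {0..2*pi}) (\<lambda>t. cis t / (cis t - w) * h (cis t))"
    by (rule continuous_imp_integrable_real)
  from has_integral_integral_lebesgue_on[OF this] hi show ?thesis
    unfolding circ_measure_def by (auto intro: has_integral_unique)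
qed

lemma circ_mean_value:
  fixes h :: "complex \<Rightarrow> complex"
  assumes h: "continuous_on (cball 0 1) h" "h holomorphic_on ball 0 1"
  shows "(LINT t|circ_measure. h (cis t)) = 2 * pi * h 0"
  using circ_Cauchy_integral[OF h, of 0] by simp

lemma continuous_on_circ_compose: "continuous_on (cball 0 1) h \<Longrightarrow> continuous_on A (\<lambda>t. h (cis t))"
  by (rule continuous_on_compose2[of "cball 0 1" h]) (auto intro!: continuous_intros)

text \<open>The kernel is twice the Cauchy kernel \<open>cis t / (cis t - z)\<close> minus 1, so
  Cauchy's formula and the mean value property give the two terms.\<close>

lemma herglotz_of_holomorphic:
  fixes h :: "complex \<Rightarrow> complex"
  assumes h: "continuous_on (cball 0 1) h" "h holomorphic_on ball 0 1" and z: "norm z < 1"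
  shows "herglotz (\<lambda>t. h (cis t)) z = 2 * h z - h 0"
proof -
  have i: "integrable circ_measure (\<lambda>t. h (cis t))"
    by (rule integrable_circ_continuous) (rule continuous_on_circ_compose[OF h(1)])
  have *: "hker z t * h (cis t) = 2 * (cis t / (cis t - z) * h (cis t)) - h (cis t)" for t
    using cis_minus_nonzero[OF z, of t] unfolding hker_def by (simp add: divide_simps) (simp add: algebra_simps)
  then have "herglotz (\<lambda>t. h (cis t)) z = 1 / (2*pi) * (LINT t|circ_measure. 2 * (cis t / (cis t - z) * h (cis t)) - h (cis t))"
    unfolding herglotz_def by simp
  also have "(LINT t|circ_measure. 2 * (cis t / (cis t - z) * h (cis t)) - h (cis t)) = 2 * (2 * pi * h z) - 2 * pi * h 0"
  proof (subst Bochner_Integration.integral_diff[OF _ i])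
    show "integrable circ_measure (\<lambda>t. 2 * (cis t / (cis t - z) * h (cis t)))"
      by (intro integrable_mult_right integrable_circ_mult[OF i]) (auto intro!: continuous_intros simp: cis_neq[OF z])
  qed (simp add: circ_Cauchy_integral[OF h z] circ_mean_value[OF h] del: times_divide_eq_left)
  also have "1 / (2*pi) * (2 * (2 * pi * h z) - 2 * pi * h 0) = 2 * h z - h 0"
    by (simp add: right_diff_distrib)
  finally show ?thesis .
qed

text \<open>On the circle \<open>cnj (cis t) = 1 / cis t\<close> turns the conjugate kernel into
  \<open>(1 + cnj z * w) / (1 - cnj z * w)\<close> with \<open>w = cis t\<close>. This is
  holomorphic in \<open>w\<close> on the disc and continuous up to the boundary, so by the mean
  value property only the value at 0 survives.\<close>

lemma herglotz_of_cnj_holomorphic: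
  fixes h :: "complex \<Rightarrow> complex"
  assumes h: "continuous_on (cball 0 1) h" "h holomorphic_on ball 0 1" and z: "norm z < 1"
  shows "herglotz (\<lambda>t. cnj (h (cis t))) z = cnj (h 0)"
proof -
  have i: "integrable circ_measure (\<lambda>t. h (cis t))"
    by (rule integrable_circ_continuous) (rule continuous_on_circ_compose[OF h(1)])
  define g where "g = (\<lambda>w. h w / (1 - cnj z * w))"
  have nz: "1 - cnj z * w \<noteq> 0" if "norm w \<le> 1" for w
  proof -
    have "norm (cnj z * w) < 1" using z that mult_le_one[of "norm z" "norm w"] 
      by (simp add: norm_mult) (metis mult_left_le norm_ge_zero order_le_less_trans)
    then show ?thesis by auto
  qed
  have g: "continuous_on (cball 0 1) g" "g holomorphic_on ball 0 1"
    unfolding g_def using nz by (auto intro!: continuous_intros holomorphic_intros h)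
  have ig: "integrable circ_measure (\<lambda>t. g (cis t))"
    by (rule integrable_circ_continuous) (rule continuous_on_circ_compose[OF g(1)])
  have "cnj (hker z t) * h (cis t) = 2 * g (cis t) - h (cis t)" for t
  proof -
    have 1: "cnj (cis t) = 1 / cis t" by (simp add: cis_cnj cis_inverse divide_inverse)
    have 2: "1 - cnj z * cis t \<noteq> 0" by (rule nz) simp
    have 3: "cnj (cis t) - cnj z = (1 - cnj z * cis t) / cis t" "cnj (cis t) + cnj z = (1 + cnj z * cis t) / cis t"
      unfolding 1 by (simp_all add: field_simps)
    have 4: "cnj (hker z t) = (1 + cnj z * cis t) / (1 - cnj z * cis t)"
      unfolding hker_def by (simp add: 3)
    show ?thesis unfolding 4 g_def using 2 by (simp add: divide_simps) (simp add: algebra_simps)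
  qed
  then have "cnj (herglotz (\<lambda>t. cnj (h (cis t))) z) = 1 / (2*pi) * (LINT t|circ_measure. 2 * g (cis t) - h (cis t))"
    unfolding cnj_herglotz_cnj by simp
  also have "(LINT t|circ_measure. 2 * g (cis t) - h (cis t)) = 2 * (2 * pi * g 0) - 2 * pi * h 0"
    by (subst Bochner_Integration.integral_diff[OF _ i]) (use ig in \<open>simp_all add: circ_mean_value[OF g] circ_mean_value[OF h]\<close>)
  finally have "cnj (herglotz (\<lambda>t. cnj (h (cis t))) z) = h 0" by (simp add: g_def field_simps)
  then show ?thesis by (metis complex_cnj_cnj)
qed

lemma poisson_of_holomorphic:
  fixes h :: "complex \<Rightarrow> complex"
  assumes h: "continuous_on (cball 0 1) h" "h holomorphic_on ball 0 1" and z: "norm z < 1"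
  shows "poisson (\<lambda>t. h (cis t)) z = h z"
proof -
  have i: "integrable circ_measure (\<lambda>t. h (cis t))"
    by (rule integrable_circ_continuous) (rule continuous_on_circ_compose[OF h(1)])
  show ?thesis
    unfolding poisson_herglotz[OF i z] herglotz_of_holomorphic[OF h z] herglotz_of_cnj_holomorphic[OF h z] by simp
qed

lemma integral_poisson_kernel:
  assumes z: "norm z < 1"
  shows "(LINT t|circ_measure. Re (hker z t)) = 2 * pi"
proof -
  have "poisson (\<lambda>t. 1) z = 1" by (rule poisson_of_holomorphic[of "\<lambda>_. 1"]) (auto simp: z)
  then have "complex_of_real (1 / (2*pi)) * (LINT t|circ_measure. complex_of_real (Re (hker z t)) * 1) = 1"
    unfolding poisson_eq[OF z] .
  then have "complex_of_real (1 / (2*pi) * (LINT t|circ_measure. Re (hker z t))) = of_real 1" by simp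
  then have "1 / (2*pi) * (LINT t|circ_measure. Re (hker z t)) = 1" unfolding of_real_eq_iff .
  then show ?thesis by (simp add: field_simps)
qed



section \<open>Wirtinger derivatives of Poisson integrals\<close>

text \<open>The product is absolutely continuous because both factors are bounded and
  \<open>k\<close> is Lipschitz; the fundamental theorem applied to it is the claim.\<close>

lemma abs_cont_on_integration_by_parts:
  fixes g k :: "real \<Rightarrow> complex"
  assumes g: "abs_cont_on a b g" and ab: "a \<le> b" and N: "negligible N"
    and dg: "\<And>t. t \<in> {a<..<b} - N \<Longrightarrow> (g has_vector_derivative \<phi> t) (at t)"
    and dk: "\<And>t. t \<in> {a..b} \<Longrightarrow> (k has_vector_derivative k' t) (at t)"
    and ck: "continuous_on {a..b} k'"
  shows "((\<lambda>t. g t * k' t + \<phi> t * k t) has_integral (g b * k b - g a * k a)) {a..b}"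
proof (rule abs_cont_on_fundamental_theorem[OF _ ab N])
  have bounded: "\<exists>B\<ge>0. \<forall>t\<in>{a..b}. norm (h t) \<le> B" if "continuous_on {a..b} h" for h :: "real \<Rightarrow> complex"
  proof -
    have "compact (h ` {a..b})" by (rule compact_continuous_image[OF that]) simp
    then obtain B where B: "\<And>t. t \<in> {a..b} \<Longrightarrow> norm (h t) \<le> B"
      using compact_imp_bounded bounded_iff by (metis imageI)
    have "0 \<le> B" using order_trans[OF norm_ge_zero B[of a]] ab by simp
    with B show ?thesis by blast
  qed
  obtain Bg where Bg: "Bg \<ge> 0" "\<And>t. t \<in> {a..b} \<Longrightarrow> norm (g t) \<le> Bg"
    using bounded[OF abs_cont_on_continuous_on[OF g]] by blast
  have "continuous_on {a..b} k"
    by (intro continuous_at_imp_continuous_on ballI has_vector_derivative_continuous[OF dk])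
  then obtain Bk where Bk: "Bk \<ge> 0" "\<And>t. t \<in> {a..b} \<Longrightarrow> norm (k t) \<le> Bk"
    using bounded by blast
  obtain Bk' where Bk': "Bk' \<ge> 0" "\<And>t. t \<in> {a..b} \<Longrightarrow> norm (k' t) \<le> Bk'"
    using bounded[OF ck] by blast
  have lip: "norm (k y - k x) \<le> Bk' * (y - x)" if xy: "a \<le> x" "x \<le> y" "y \<le> b" for x y
  proof -
    have "(k' has_integral (k y - k x)) {x..y}"
      by (rule fundamental_theorem_of_calculus) (use xy in \<open>auto intro!: has_vector_derivative_at_within dk\<close>)
    then have "norm (k y - k x) \<le> Bk' * measure lborel (cbox x y)"
      by (intro has_integral_bound[OF Bk'(1)]) (use xy Bk' in auto)
    then show ?thesis using xy by simp
  qed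
  show "abs_cont_on a b (\<lambda>t. g t * k t)"
  proof (rule abs_cont_on_dominated[OF g Bk(1), of "Bg * Bk'"])
    fix x y assume xy: "a \<le> x" "x \<le> y" "y \<le> b"
    have "g y * k y - g x * k x = k y * (g y - g x) + g x * (k y - k x)" by (simp add: algebra_simps)
    also have "norm \<dots> \<le> norm (k y) * norm (g y - g x) + norm (g x) * norm (k y - k x)"
      by (metis norm_triangle_ineq norm_mult)
    also have "\<dots> \<le> Bk * norm (g y - g x) + Bg * (Bk' * (y - x))"
      using xy Bg Bk lip[OF xy] by (intro add_mono mult_mono) auto
    finally show "norm (g y * k y - g x * k x) \<le> Bk * norm (g y - g x) + Bg * Bk' * (y - x)" by (simp add: mult_ac)
  qed (use Bg Bk' in auto)
  fix t assume t: "t \<in> {a<..<b} - N"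
  then have "((\<lambda>t. g t * k t) has_vector_derivative (g t * k' t + \<phi> t * k t)) (at t)"
    by (intro has_vector_derivative_mult dg dk) auto
  then show "((\<lambda>t. g t * k t) has_vector_derivative (g t * k' t + \<phi> t * k t)) (at t)" .
qed

lemma has_vector_derivative_cis: "(cis has_vector_derivative \<i> * cis t) (at t within A)"
proof -
  have "((\<lambda>t. exp (\<i> * of_real t)) has_vector_derivative (\<i> * exp (\<i> * of_real t))) (at t within A)"
    by (rule has_vector_derivative_real_field) (auto intro!: derivative_eq_intros)
  then show ?thesis by (simp add: cis_conv_exp[abs_def])
qed

section \<open>The derivatives of P[F] as Cauchy-type integrals of the boundary derivative\<close>

text \<open>Up to the factor \<open>- \<i>\<close> this will be \<open>wirt_z\<close> of the Poisson
  integral. The usual numerator \<open>cis t\<close> of the Cauchy kernel is used up by the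
  integration by parts in \<open>t\<close>; in other words this is the Cauchy integral of
  \<open>\<phi> t * cis (- t)\<close>.\<close>

definition cauchy_transform :: "(real \<Rightarrow> complex) \<Rightarrow> complex \<Rightarrow> complex" where
  "cauchy_transform \<phi> z = 1 / (2 * pi) * (LINT t|circ_measure. 1 / (cis t - z) * \<phi> t)"

lemma integrable_circ_has_integral:
  fixes \<phi> :: "real \<Rightarrow> complex"
  assumes "integrable circ_measure \<phi>"
  shows "(\<phi> has_integral (LINT t|circ_measure. \<phi> t)) {0..2*pi}"
  using assms unfolding circ_measure_def by (intro has_integral_integral_lebesgue_on) auto

text \<open>The circle function lifted to the line, with its derivative given off a null set of the
  whole line rather than of one period, so that windows around any point can be used. The hypotheses
  are invariant under conjugation, which turns statements on \<open>wirt_z\<close> into statements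
  on \<open>wirt_zbar\<close>. Besides the given \<open>F\<close>, the locale serves the boundary
  primitive in Fatou's theorem.\<close>

locale periodic_ac =
  fixes g \<phi> :: "real \<Rightarrow> complex" and N :: "real set"
  assumes g_per: "\<And>t. g (t + 2 * pi) = g t"
    and phi_per: "\<And>t. \<phi> (t + 2 * pi) = \<phi> t"
    and ac: "abs_cont_on 0 (2*pi) g"
    and negl: "negligible N"
    and deriv: "\<And>t. t \<notin> N \<Longrightarrow> (g has_vector_derivative \<phi> t) (at t)"
    and phi_int: "integrable circ_measure \<phi>"
begin

lemma periodic_ac_cnj: "periodic_ac (\<lambda>t. cnj (g t)) (\<lambda>t. cnj (\<phi> t)) N"
proof
  show "abs_cont_on 0 (2*pi) (\<lambda>t. cnj (g t))"
    by (rule abs_cont_on_dominated[OF ac, of 1 0]) (auto simp flip: complex_cnj_diff)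
  show "((\<lambda>t. cnj (g t)) has_vector_derivative cnj (\<phi> t)) (at t)" if "t \<notin> N" for t
    using deriv[OF that] by (rule has_vector_derivative_cnj)
qed (auto simp: g_per phi_per negl phi_int)

lemma g_2pi: "g (2*pi) = g 0"
  using g_per[of 0] by simp

lemma by_parts:
  assumes dk: "\<And>t. t \<in> {0..2*pi} \<Longrightarrow> (k has_vector_derivative k' t) (at t)"
    and ck: "continuous_on {0..2*pi} k'" and per: "k (2*pi) = k 0"
  shows "(LINT t|circ_measure. k' t * g t) = - (LINT t|circ_measure. k t * \<phi> t)"
proof -
  have "continuous_on {0..2*pi} k"
    by (intro continuous_at_imp_continuous_on ballI has_vector_derivative_continuous[OF dk])
  then have i1: "integrable circ_measure (\<lambda>t. k t * \<phi> t)" by (rule integrable_circ_mult[OF phi_int])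
  have i2: "integrable circ_measure (\<lambda>t. k' t * g t)"
    by (rule integrable_circ_continuous) (intro continuous_intros ck abs_cont_on_continuous_on[OF ac])
  have "((\<lambda>t. g t * k' t + \<phi> t * k t) has_integral (g (2*pi) * k (2*pi) - g 0 * k 0)) {0..2*pi}"
    by (rule abs_cont_on_integration_by_parts[OF ac _ negl]) (use deriv dk ck in auto)
  then have "((\<lambda>t. k' t * g t + k t * \<phi> t) has_integral 0) {0..2*pi}"
    unfolding per g_2pi by (simp add: mult.commute)
  moreover have "((\<lambda>t. k' t * g t + k t * \<phi> t) has_integral (LINT t|circ_measure. k' t * g t) + (LINT t|circ_measure. k t * \<phi> t)) {0..2*pi}"
    by (intro has_integral_add integrable_circ_has_integral i1 i2)
  ultimately have "(LINT t|circ_measure. k' t * g t) + (LINT t|circ_measure. k t * \<phi> t) = 0"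
    by (metis has_integral_unique)
  then show ?thesis by (simp add: eq_neg_iff_add_eq_0)
qed

lemma integral_phi: "(LINT t|circ_measure. \<phi> t) = 0"
  using by_parts[of "\<lambda>_. 1" "\<lambda>_. 0"] by simp

lemma g_integrable: "integrable circ_measure g"
  by (rule integrable_circ_continuous) (rule abs_cont_on_continuous_on[OF ac])

text \<open>The \<open>z\<close>-derivative of the Herglotz kernel is \<open>2 * \<i>\<close> times
  the \<open>t\<close>-derivative of \<open>1 / (cis t - z)\<close>, so integration by parts brings
  in \<open>\<phi>\<close>.\<close>

lemma herglotz_has_derivative:
  assumes z: "norm z < 1"
  shows "(herglotz g has_field_derivative - 2 * \<i> * cauchy_transform \<phi> z) (at z)"
proof -
  have "(LINT t|circ_measure. (- (\<i> * cis t) / (cis t - z)\<^sup>2) * g t) = - (LINT t|circ_measure. 1 / (cis t - z) * \<phi> t)"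
  proof (rule by_parts)
    show "((\<lambda>t. 1 / (cis t - z)) has_vector_derivative - (\<i> * cis t) / (cis t - z)\<^sup>2) (at t)" for t
    proof -
      have "((\<lambda>w. 1 / (w - z)) has_field_derivative (- 1 / (cis t - z)\<^sup>2)) (at (cis t))"
        by (rule derivative_eq_intros refl | simp add: cis_neq[OF z] power2_eq_square)+
      from field_vector_diff_chain_at[OF has_vector_derivative_cis this] show ?thesis by (simp add: o_def mult_ac)
    qed
    show "continuous_on {0..2*pi} (\<lambda>t. - (\<i> * cis t) / (cis t - z)\<^sup>2)"
      by (intro continuous_intros) (auto simp: cis_neq[OF z])
  qed simp
  also have "(LINT t|circ_measure. (- (\<i> * cis t) / (cis t - z)\<^sup>2) * g t) = (LINT t|circ_measure. (-\<i>/2) * (2 * cis t / (cis t - z)\<^sup>2 * g t))"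
    by (rule Bochner_Integration.integral_cong) auto
  also have "\<dots> = (-\<i>/2) * (LINT t|circ_measure. 2 * cis t / (cis t - z)\<^sup>2 * g t)"
    by (rule integral_mult_right_zero)
  finally have e: "(-\<i>/2) * (LINT t|circ_measure. 2 * cis t / (cis t - z)\<^sup>2 * g t) = - (LINT t|circ_measure. 1 / (cis t - z) * \<phi> t)" .
  have "(LINT t|circ_measure. 2 * cis t / (cis t - z)\<^sup>2 * g t) = (2 * \<i>) * ((-\<i>/2) * (LINT t|circ_measure. 2 * cis t / (cis t - z)\<^sup>2 * g t))"
    by simp
  also have "\<dots> = - 2 * \<i> * (LINT t|circ_measure. 1 / (cis t - z) * \<phi> t)" unfolding e by simp
  finally show ?thesis
    using has_field_derivative_herglotz[OF g_integrable z] unfolding cauchy_transform_def by (simp add: mult_ac)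
qed

text \<open>The kernel is \<open>1 + 2 * z / (cis t - z)\<close>, and the constant 1 integrates to
  zero against \<open>\<phi>\<close> by periodicity of \<open>g\<close>.\<close>

lemma herglotz_eq_cauchy_transform:
  assumes z: "norm z < 1"
  shows "herglotz \<phi> z = 2 * z * cauchy_transform \<phi> z"
proof -
  have "hker z t * \<phi> t = \<phi> t + (2 * z) * (1 / (cis t - z) * \<phi> t)" for t
    using cis_minus_nonzero[OF z, of t] unfolding hker_def by (simp add: divide_simps) (simp add: algebra_simps)
  then have "herglotz \<phi> z = 1 / (2 * pi) * (LINT t|circ_measure. \<phi> t + (2 * z) * (1 / (cis t - z) * \<phi> t))"
    unfolding herglotz_def by simp
  also have "(LINT t|circ_measure. \<phi> t + (2 * z) * (1 / (cis t - z) * \<phi> t)) = (LINT t|circ_measure. \<phi> t) + (LINT t|circ_measure. (2 * z) * (1 / (cis t - z) * \<phi> t))"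
  proof (rule Bochner_Integration.integral_add[OF phi_int])
    show "integrable circ_measure (\<lambda>t. (2 * z) * (1 / (cis t - z) * \<phi> t))"
      by (intro integrable_mult_right integrable_circ_mult[OF phi_int]) (auto intro!: continuous_intros simp: cis_neq[OF z])
  qed
  also have "(LINT t|circ_measure. (2 * z) * (1 / (cis t - z) * \<phi> t)) = (2 * z) * (LINT t|circ_measure. 1 / (cis t - z) * \<phi> t)"
    by (rule integral_mult_right_zero)
  finally show ?thesis unfolding integral_phi cauchy_transform_def by simp
qed

text \<open>Covers the disc around 0, where dividing the Herglotz transform by \<open>2 * z\<close>
  gives no bound.\<close>

lemma cauchy_transform_bound:
  assumes z: "norm z \<le> 1/2"
  shows "norm (cauchy_transform \<phi> z) \<le> 1 / pi * (LINT t|circ_measure. norm (\<phi> t))"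
proof -
  have z1: "norm z < 1" using z by simp
  have "norm (LINT t|circ_measure. 1 / (cis t - z) * \<phi> t) \<le> 2 * (LINT t|circ_measure. norm (\<phi> t))"
  proof (rule integral_circ_bound[OF phi_int])
    show "(\<lambda>t. 1 / (cis t - z)) \<in> borel_measurable circ_measure"
      by (rule measurable_circ_continuous) (auto intro!: continuous_intros simp: cis_neq[OF z1])
    show "norm (1 / (cis t - z)) \<le> 2" for t
    proof -
      have "1/2 \<le> norm (cis t - z)" using cis_minus_norm_ge[of z t] z by simp
      then have "1 / norm (cis t - z) \<le> 1 / (1/2)" by (intro frac_le) auto
      then show ?thesis by (simp add: norm_divide)
    qed
  qed
  then have "1 / (2*pi) * norm (LINT t|circ_measure. 1 / (cis t - z) * \<phi> t) \<le> 1 / (2*pi) * (2 * (LINT t|circ_measure. norm (\<phi> t)))"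
    by (rule mult_left_mono) simp
  then show ?thesis unfolding cauchy_transform_def norm_mult norm_of_real by simp
qed

lemma poisson_has_derivative:
  assumes z: "norm z < 1"
  shows "(poisson g has_derivative (\<lambda>h. (- 2 * \<i> * cauchy_transform \<phi> z * h + cnj (- 2 * \<i> * cauchy_transform (\<lambda>t. cnj (\<phi> t)) z * h)) / 2)) (at z)"
proof -
  interpret c: periodic_ac "\<lambda>t. cnj (g t)" "\<lambda>t. cnj (\<phi> t)" N by (rule periodic_ac_cnj)
  have d1: "(herglotz g has_derivative (\<lambda>h. - 2 * \<i> * cauchy_transform \<phi> z * h)) (at z)"
    using herglotz_has_derivative[OF z] unfolding has_field_derivative_def .
  have d2: "(herglotz (\<lambda>t. cnj (g t)) has_derivative (\<lambda>h. - 2 * \<i> * cauchy_transform (\<lambda>t. cnj (\<phi> t)) z * h)) (at z)"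
    using c.herglotz_has_derivative[OF z] unfolding has_field_derivative_def .
  have "((\<lambda>w. (herglotz g w + cnj (herglotz (\<lambda>t. cnj (g t)) w)) / 2) has_derivative
     (\<lambda>h. (- 2 * \<i> * cauchy_transform \<phi> z * h + cnj (- 2 * \<i> * cauchy_transform (\<lambda>t. cnj (\<phi> t)) z * h)) / 2)) (at z)"
    by (intro bounded_linear.has_derivative[OF bounded_linear_divide] has_derivative_add d1 bounded_linear.has_derivative[OF bounded_linear_cnj d2])
  then show ?thesis
  proof (rule has_derivative_transform_within_open[of _ _ _ _ "ball 0 1"])
    show "(herglotz g w + cnj (herglotz (\<lambda>t. cnj (g t)) w)) / 2 = poisson g w" if "w \<in> ball 0 1" for w
      using poisson_herglotz[OF g_integrable] that by simp
  qed (use z in auto)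
qed

lemma wirt_z_poisson:
  assumes z: "norm z < 1"
  shows "wirt_z (poisson g) z = - \<i> * cauchy_transform \<phi> z"
  unfolding wirt_z_def frechet_derivative_at[OF poisson_has_derivative[OF z], symmetric]
  by (simp add: field_simps)

lemma wirt_zbar_poisson:
  assumes z: "norm z < 1"
  shows "cnj (wirt_zbar (poisson g) z) = - \<i> * cauchy_transform (\<lambda>t. cnj (\<phi> t)) z"
  unfolding wirt_zbar_def frechet_derivative_at[OF poisson_has_derivative[OF z], symmetric]
  by (simp add: field_simps)

lemma holomorphic_cauchy_transform: "(\<lambda>z. - \<i> * cauchy_transform \<phi> z) holomorphic_on ball 0 1"
proof -
  have "(\<lambda>z. deriv (herglotz g) z / 2) holomorphic_on ball 0 1"
    by (intro holomorphic_intros holomorphic_deriv holomorphic_herglotz g_integrable) auto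
  then show ?thesis
  proof (rule holomorphic_transform)
    show "deriv (herglotz g) z / 2 = - \<i> * cauchy_transform \<phi> z" if "z \<in> ball 0 1" for z
      using DERIV_imp_deriv[OF herglotz_has_derivative[of z]] that by simp
  qed
qed

lemma holomorphic_wirt_z: "wirt_z (poisson g) holomorphic_on ball 0 1"
  by (rule holomorphic_transform[OF holomorphic_cauchy_transform]) (simp add: wirt_z_poisson)

lemma wirt_z_herglotz:
  assumes z: "norm z < 1"
  shows "2 * \<i> * z * wirt_z (poisson g) z = herglotz \<phi> z"
  unfolding wirt_z_poisson[OF z] herglotz_eq_cauchy_transform[OF z] by simp

text \<open>Three glued periods contain every window of half-width pi around a point of
  \<open>{0..2*pi}\<close>.\<close>

lemma ac_wide: "abs_cont_on (- (2*pi)) (4*pi) g"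
proof -
  have sh: "(\<lambda>t. g (t + 2*pi)) = g" by (simp add: g_per fun_eq_iff)
  have "g (t + (-2*pi)) = g t" for t using g_per[of "t - 2*pi"] by simp
  then have sh': "(\<lambda>t. g (t + (-2*pi))) = g" by (simp add: fun_eq_iff)
  have "abs_cont_on (0 + 2*pi) (2*pi + 2*pi) g" by (rule abs_cont_on_shift) (simp add: sh ac)
  moreover have "abs_cont_on (0 + (-2*pi)) (2*pi + (-2*pi)) g" by (rule abs_cont_on_shift) (simp only: sh' ac)
  ultimately have "abs_cont_on (- (2*pi)) 0 g" "abs_cont_on (2*pi) (4*pi) g" by simp_all
  then have "abs_cont_on (- (2*pi)) (2*pi) g" by (intro abs_cont_on_combine[OF _ ac]) auto
  then show ?thesis using \<open>abs_cont_on (2*pi) (4*pi) g\<close> by (rule abs_cont_on_combine) auto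
qed

end



section \<open>Radial behaviour of Herglotz transforms and truncated Hilbert integrals\<close>

text \<open>The chord has length \<open>2 * sin (\<bar>s\<bar> / 2)\<close>, and the Taylor bound
  \<open>x - x ^ 3 / 6\<close> keeps \<open>sin x\<close> above \<open>x / 2\<close> up to
  pi/2.\<close>

lemma cis_minus_one_ge:
  assumes "\<bar>s\<bar> \<le> pi"
  shows "norm (cis s - 1) \<ge> \<bar>s\<bar> / 2"
proof -
  have sin_ge: "x / 2 \<le> sin x" if "0 \<le> x" "x \<le> pi / 2" for x :: real
  proof -
    have "\<bar>sin x - (\<Sum>m<3. sin_coeff m * x ^ m)\<bar> \<le> inverse (fact 3) * \<bar>x\<bar> ^ 3"
      by (rule Maclaurin_sin_bound)
    then have "\<bar>sin x - x\<bar> \<le> x ^ 3 / 6"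
      using that by (simp add: sin_coeff_def eval_nat_numeral fact_numeral)
    moreover have "x ^ 3 / 6 \<le> x / 2"
    proof -
      \<comment> \<open>17/10 exceeds pi/2, and its square 2.89 stays below the 3 that is
        needed.\<close>
      have "x \<le> 17/10" using that pi_less_4 pi_approx by simp
      then have "x\<^sup>2 \<le> (17/10)\<^sup>2" using that by (intro power_mono) auto
      then have "x * x\<^sup>2 \<le> x * 3" using that by (intro mult_left_mono) (auto simp: power2_eq_square)
      then show ?thesis by (simp add: power3_eq_cube power2_eq_square)
    qed
    ultimately show ?thesis by linarith
  qed
  have "(norm (cis s - 1))\<^sup>2 = (cos s - 1)\<^sup>2 + (sin s)\<^sup>2" by (simp add: cmod_power2)
  also have "\<dots> = 2 - 2 * cos s" using sin_cos_squared_add[of s] by (simp add: power2_eq_square algebra_simps)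
  also have "\<dots> = (2 * sin (s/2))\<^sup>2" using cos_double_sin[of "s/2"] by (simp add: power2_eq_square)
  finally have "norm (cis s - 1) = \<bar>2 * sin (s/2)\<bar>"
    by (metis norm_ge_zero power2_eq_iff_nonneg abs_ge_zero power2_abs)
  also have "\<bar>sin (s/2)\<bar> = sin (\<bar>s\<bar>/2)"
    using sin_ge[of "\<bar>s\<bar>/2"] assms by (cases "s \<ge> 0") (auto simp: abs_if)
  then have "\<bar>2 * sin (s/2)\<bar> = 2 * sin (\<bar>s\<bar>/2)" by (simp add: abs_mult)
  finally show ?thesis using sin_ge[of "\<bar>s\<bar>/2"] assms by simp
qed

lemma cis_minus_one_le: "norm (cis s - 1) \<le> \<bar>s\<bar>"
proof -
  have "norm (cis s - cis 0) \<le> 1 * norm (s - 0)"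
  proof (rule differentiable_bound[of UNIV])
    show "(cis has_derivative (\<lambda>h. h *\<^sub>R (\<i> * cis x))) (at x within UNIV)" for x
      using has_vector_derivative_cis[of x UNIV] unfolding has_vector_derivative_def .
    show "onorm (\<lambda>h. h *\<^sub>R (\<i> * cis x)) \<le> 1" for x
      by (rule onorm_le) (simp add: norm_mult)
  qed auto
  then show ?thesis by simp
qed

definition hker_deriv :: "complex \<Rightarrow> real \<Rightarrow> complex" where
  "hker_deriv z t = - (2 * \<i> * z * cis t) / (cis t - z)\<^sup>2"

lemma has_vector_derivative_hker:
  assumes "cis t \<noteq> z"
  shows "(hker z has_vector_derivative hker_deriv z t) (at t)"
proof -
  have nz: "cis t - z \<noteq> 0" using assms by simp
  have "((\<lambda>w. (w + z) / (w - z)) has_field_derivative (((1 + 0) * (cis t - z) - (cis t + z) * (1 - 0)) / ((cis t - z) * (cis t - z)))) (at (cis t))"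
    by (intro DERIV_divide DERIV_add DERIV_diff DERIV_ident DERIV_const nz)
  from field_vector_diff_chain_at[OF has_vector_derivative_cis this]
  have "((\<lambda>w. (w + z) / (w - z)) \<circ> cis has_vector_derivative \<i> * cis t * (((1 + 0) * (cis t - z) - (cis t + z) * (1 - 0)) / ((cis t - z) * (cis t - z)))) (at t)" .
  moreover have "(\<lambda>w. (w + z) / (w - z)) \<circ> cis = hker z" by (simp add: fun_eq_iff hker_def)
  moreover have "\<i> * cis t * (((1 + 0) * (cis t - z) - (cis t + z) * (1 - 0)) / ((cis t - z) * (cis t - z))) = hker_deriv z t"
    using nz unfolding hker_deriv_def power2_eq_square by (simp add: divide_simps)
  ultimately show ?thesis by simp
qed

lemma continuous_on_hker_deriv:
  "(\<And>t. t \<in> A \<Longrightarrow> cis t \<noteq> z) \<Longrightarrow> continuous_on A (hker_deriv z)"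
  unfolding hker_deriv_def[abs_def] by (intro continuous_intros) auto

lemma cis_neq_one: "s \<noteq> 0 \<Longrightarrow> \<bar>s\<bar> \<le> pi \<Longrightarrow> cis s \<noteq> 1"
  using cis_minus_one_ge[of s] by auto

text \<open>One bound for each zone of the truncation at \<open>1 - r\<close>: the first for
  \<open>\<bar>s\<bar>\<close> up to \<open>1 - r\<close>, the second for the two cut points, the
  third for the far zone, where replacing \<open>r\<close> by 1 gains a factor
  \<open>1 - r\<close>.\<close>

lemma hker_estimates:
  assumes r: "0 < r" "r < 1" and s: "\<bar>s\<bar> \<le> pi"
  shows "norm (hker_deriv (of_real r) s) \<le> 2 / (1 - r)\<^sup>2"
    and "s \<noteq> 0 \<Longrightarrow> norm (hker 1 s) \<le> 4 / \<bar>s\<bar>"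
    and "1 - r \<le> \<bar>s\<bar> \<Longrightarrow> norm (hker_deriv (of_real r) s - hker_deriv 1 s) \<le> 384 * (1 - r) / \<bar>s\<bar> ^ 3"
proof -
  define e where "e = cis s"
  have ne: "norm e = 1" by (simp add: e_def)
  have er: "norm (e - of_real r) \<ge> 1 - r" using cis_minus_norm_ge[of "of_real r" s] r by (simp add: e_def)
  have e1: "norm (e - 1) \<ge> \<bar>s\<bar> / 2" using cis_minus_one_ge[OF s] by (simp add: e_def)
  have "norm (e - 1) \<le> norm (e - of_real r) + norm (of_real r - 1 :: complex)"
    using norm_triangle_ineq[of "e - of_real r" "of_real r - 1"] by simp
  also have "norm (of_real r - 1 :: complex) = 1 - r" using r by (metis abs_of_neg diff_less_0_iff_less minus_diff_eq norm_of_real of_real_1 of_real_diff)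
  \<comment> \<open>Since \<open>norm (e - of_real r)\<close> is at least \<open>1 - r\<close>, the
    distance of \<open>e\<close> to 1 is at most twice its distance to \<open>r\<close>. This keeps
    the denominators of order \<open>\<bar>s\<bar>\<close> uniformly in \<open>r\<close>.\<close>
  finally have er2: "norm (e - of_real r) \<ge> \<bar>s\<bar> / 4" using er e1 by simp
  have "norm (hker_deriv (of_real r) s) = 2 * r / (norm (e - of_real r))\<^sup>2"
    using r by (simp add: hker_deriv_def norm_mult norm_divide norm_power e_def)
  also have "\<dots> \<le> 2 / (1 - r)\<^sup>2"
    using r er by (intro frac_le power_mono) auto
  finally show "norm (hker_deriv (of_real r) s) \<le> 2 / (1 - r)\<^sup>2" .
  show "norm (hker 1 s) \<le> 4 / \<bar>s\<bar>" if "s \<noteq> 0"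
  proof -
    have "norm (hker 1 s) = norm (e + 1) / norm (e - 1)" by (simp add: hker_def norm_divide e_def)
    also have "\<dots> \<le> 2 / (\<bar>s\<bar> / 2)"
      using norm_triangle_ineq[of e 1] ne e1 that by (intro frac_le) auto
    finally show ?thesis by simp
  qed
  show "norm (hker_deriv (of_real r) s - hker_deriv 1 s) \<le> 384 * (1 - r) / \<bar>s\<bar> ^ 3" if s1: "1 - r \<le> \<bar>s\<bar>"
  proof -
    have s0: "\<bar>s\<bar> > 0" using s1 r by simp
    have nz: "e - of_real r \<noteq> 0" "e - 1 \<noteq> 0" using er e1 s0 r by auto
    have "hker_deriv (of_real r) s - hker_deriv 1 s = - (2 * \<i> * e) * (of_real r / (e - of_real r)\<^sup>2 - 1 / (e - 1)\<^sup>2)"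
      by (simp add: hker_deriv_def e_def algebra_simps)
    also have "of_real r / (e - of_real r)\<^sup>2 - 1 / (e - 1)\<^sup>2 = (of_real r * (e - 1)\<^sup>2 - (e - of_real r)\<^sup>2) / ((e - of_real r)\<^sup>2 * (e - 1)\<^sup>2)"
      using nz by (simp add: divide_simps)
    \<comment> \<open>The factorisation exhibits the gain \<open>1 - r\<close>; the other factor is
      O(s), because both \<open>r\<close> and \<open>e\<^sup>2\<close> are within O(s) of 1.\<close>
    also have "of_real r * (e - 1)\<^sup>2 - (e - of_real r)\<^sup>2 = of_real (1 - r) * (of_real r - e\<^sup>2)"
      by (simp add: power2_eq_square algebra_simps)
    finally have eq: "norm (hker_deriv (of_real r) s - hker_deriv 1 s) = 2 * ((1 - r) * norm (of_real r - e\<^sup>2)) / ((norm (e - of_real r))\<^sup>2 * (norm (e - 1))\<^sup>2)"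
      using r ne by (simp add: norm_mult norm_divide norm_power del: of_real_diff)
    have "norm (of_real r - e\<^sup>2) \<le> 3 * \<bar>s\<bar>"
    proof -
      have "of_real r - e\<^sup>2 = (of_real r - 1) - (e - 1) * (e + 1)" by (simp add: power2_eq_square algebra_simps)
      also have "norm \<dots> \<le> norm (of_real r - 1 :: complex) + norm ((e - 1) * (e + 1))" by (rule norm_triangle_ineq4)
      also have "norm (of_real r - 1 :: complex) = 1 - r" by fact
      also have "norm ((e - 1) * (e + 1)) \<le> \<bar>s\<bar> * 2"
        unfolding norm_mult using cis_minus_one_le[of s] norm_triangle_ineq[of e 1] ne by (intro mult_mono) (auto simp: e_def)
      finally show ?thesis using s1 by simp
    qed
    then have "2 * ((1 - r) * norm (of_real r - e\<^sup>2)) \<le> 2 * ((1 - r) * (3 * \<bar>s\<bar>))" using r by simp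
    moreover have "(\<bar>s\<bar> / 4)\<^sup>2 * (\<bar>s\<bar> / 2)\<^sup>2 \<le> (norm (e - of_real r))\<^sup>2 * (norm (e - 1))\<^sup>2"
      by (intro mult_mono power_mono er2 e1) auto
    ultimately have "norm (hker_deriv (of_real r) s - hker_deriv 1 s) \<le> 2 * ((1 - r) * (3 * \<bar>s\<bar>)) / ((\<bar>s\<bar> / 4)\<^sup>2 * (\<bar>s\<bar> / 2)\<^sup>2)"
      unfolding eq using s0 r by (intro frac_le) auto
    \<comment> \<open>384 = 2 * 3 * 16 * 4, the last two factors coming from the squared lower
      bounds of the denominators.\<close>
    also have "\<dots> = 384 * (1 - r) / \<bar>s\<bar> ^ 3"
      using s0 by (simp add: field_simps power2_eq_square power3_eq_cube)
    finally show ?thesis .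
  qed
qed

lemma norm_integral_le_antiderivative:
  fixes f :: "real \<Rightarrow> complex"
  assumes ab: "a \<le> b" and f: "continuous_on {a..b} f"
    and G: "\<And>s. s \<in> {a..b} \<Longrightarrow> (G has_real_derivative G' s) (at s)"
    and le: "\<And>s. s \<in> {a..b} \<Longrightarrow> norm (f s) \<le> G' s"
  shows "norm (integral {a..b} f) \<le> G b - G a"
proof -
  have "(G' has_integral (G b - G a)) {a..b}"
    by (rule fundamental_theorem_of_calculus[OF ab])
       (use G in \<open>auto simp: has_real_derivative_iff_has_vector_derivative[symmetric] intro: has_field_derivative_at_within\<close>)
  then show ?thesis
    using integral_norm_bound_integral[of f "{a..b}" G'] f le
    by (auto simp: has_integral_iff integrable_continuous_real)
qed

text \<open>Integrating by parts on both sides moves the derivative off \<open>\<rho>'\<close>, after which \<open>\<rho>(s) = o(s)\<close> beats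
  the singularities of the kernels.\<close>

lemma herglotz_truncation_estimate:
  fixes \<rho> \<rho>' :: "real \<Rightarrow> complex"
  assumes ac: "abs_cont_on (-pi) pi \<rho>" and N: "negligible N"
    and d: "\<And>s. s \<in> {-pi<..<pi} - N \<Longrightarrow> (\<rho> has_vector_derivative \<rho>' s) (at s)"
    and per: "\<rho> pi = \<rho> (-pi)" and z: "\<rho> 0 = 0" and d0: "(\<rho> has_vector_derivative 0) (at 0)"
  shows "((\<lambda>r. integral {-pi..pi} (\<lambda>s. \<rho>' s * hker (of_real r) s)
           - (integral {1 - r..pi} (\<lambda>s. \<rho>' s * hker 1 s) + integral {-pi..-(1-r)} (\<lambda>s. \<rho>' s * hker 1 s))) \<longlongrightarrow> 0) (at_left 1)"
proof -
  have cr: "continuous_on {-pi..pi} \<rho>" by (rule abs_cont_on_continuous_on[OF ac])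
  have parts: "((\<lambda>s. \<rho>' s * hker z s) has_integral (\<rho> b * hker z b - \<rho> a * hker z a) - integral {a..b} (\<lambda>s. \<rho> s * hker_deriv z s)) {a..b}"
    if ab: "-pi \<le> a" "a \<le> b" "b \<le> pi" and nz: "\<And>s. s \<in> {a..b} \<Longrightarrow> cis s \<noteq> z" for a b z
  proof -
    have "((\<lambda>s. \<rho> s * hker_deriv z s + \<rho>' s * hker z s) has_integral (\<rho> b * hker z b - \<rho> a * hker z a)) {a..b}"
    proof (rule abs_cont_on_integration_by_parts[OF abs_cont_on_sub[OF ac ab(1,3)] ab(2) N])
      show "(hker z has_vector_derivative hker_deriv z t) (at t)" if "t \<in> {a..b}" for t
        by (rule has_vector_derivative_hker) (rule nz[OF that])
      show "continuous_on {a..b} (hker_deriv z)" by (rule continuous_on_hker_deriv) (rule nz)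
    qed (use ab d in auto)
    moreover have "((\<lambda>s. \<rho> s * hker_deriv z s) has_integral integral {a..b} (\<lambda>s. \<rho> s * hker_deriv z s)) {a..b}"
      by (intro integrable_integral integrable_continuous_real continuous_intros continuous_on_hker_deriv nz continuous_on_subset[OF cr]) (use ab in auto)
    ultimately have "((\<lambda>s. (\<rho> s * hker_deriv z s + \<rho>' s * hker z s) - \<rho> s * hker_deriv z s) has_integral (\<rho> b * hker z b - \<rho> a * hker z a) - integral {a..b} (\<lambda>s. \<rho> s * hker_deriv z s)) {a..b}"
      by (rule has_integral_diff)
    then show ?thesis by simp
  qed
  obtain B where B: "\<And>s. s \<in> {-pi..pi} \<Longrightarrow> norm (\<rho> s) \<le> B"
  proof -
    have "compact (\<rho> ` {-pi..pi})" by (rule compact_continuous_image[OF cr]) simp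
    then show ?thesis using that compact_imp_bounded bounded_iff by (metis imageI)
  qed
  have B0: "B \<ge> 0" using B[of 0] z by simp
  \<comment> \<open>The little-o at 0 is traded for a bound on the whole window. The remainder is
    cubic because the kernel derivatives differ by O((1 - r) / |s|^3): it then contributes only O(M
    (1 - r)), while \<eta> is as small as desired.\<close>
  have growth: "\<exists>M\<ge>0. \<forall>s\<in>{-pi..pi}. norm (\<rho> s) \<le> \<eta> * \<bar>s\<bar> + M * \<bar>s\<bar> ^ 3" if \<eta>: "\<eta> > 0" for \<eta>
  proof -
    obtain \<delta> where \<delta>: "\<delta> > 0" "\<And>s. norm (s - 0) < \<delta> \<Longrightarrow> norm (\<rho> s - \<rho> 0 - (s - 0) *\<^sub>R 0) \<le> \<eta> * norm (s - 0)"
      using d0 \<eta> unfolding has_vector_derivative_def has_derivative_at_alt by blast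
    have "norm (\<rho> s) \<le> \<eta> * \<bar>s\<bar> + B / \<delta> ^ 3 * \<bar>s\<bar> ^ 3" if s: "s \<in> {-pi..pi}" for s
    proof (cases "\<bar>s\<bar> < \<delta>")
      case True
      then have "norm (\<rho> s) \<le> \<eta> * \<bar>s\<bar>" using \<delta>(2)[of s] z by simp
      moreover have "0 \<le> B / \<delta> ^ 3 * \<bar>s\<bar> ^ 3" using B0 \<delta> by simp
      ultimately show ?thesis by linarith
    next
      case False
      then have "\<delta> ^ 3 \<le> \<bar>s\<bar> ^ 3" using \<delta> by (intro power_mono) auto
      then have "B * 1 \<le> B * (\<bar>s\<bar> ^ 3 / \<delta> ^ 3)" using \<delta> B0 by (intro mult_left_mono) (auto simp: field_simps)
      moreover have "0 \<le> \<eta> * \<bar>s\<bar>" using \<eta> by simp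
      ultimately show ?thesis using B[OF s] by simp
    qed
    then show ?thesis using B0 \<delta> by (intro exI[of _ "B / \<delta> ^ 3"]) auto
  qed
  define Z where "Z = (\<lambda>r. integral {-pi..pi} (\<lambda>s. \<rho>' s * hker (of_real r) s)
           - (integral {1 - r..pi} (\<lambda>s. \<rho>' s * hker 1 s) + integral {-pi..-(1-r)} (\<lambda>s. \<rho>' s * hker 1 s)))"
  have est: "norm (Z r) \<le> 800 * (\<eta> + 4 * M * (1 - r))"
    if r: "0 < r" "r < 1" and \<eta>: "\<eta> > 0" and M: "M \<ge> 0" "\<And>s. s \<in> {-pi..pi} \<Longrightarrow> norm (\<rho> s) \<le> \<eta> * \<bar>s\<bar> + M * \<bar>s\<bar> ^ 3" for r \<eta> M
  proof -
    define \<epsilon> where "\<epsilon> = 1 - r"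
    have \<epsilon>: "0 < \<epsilon>" "\<epsilon> < 1" using r by (auto simp: \<epsilon>_def)
    have epi: "\<epsilon> < pi" using \<epsilon> pi_gt3 by simp
    \<comment> \<open>No boundary terms remain at the ends of the window: \<rho> and the kernel for
      \<open>r\<close> take equal values at \<open>pi\<close> and \<open>-pi\<close>, and
      \<open>hker 1\<close> vanishes there.\<close>
    have hpi: "hker (of_real r) pi = hker (of_real r) (-pi)" by (simp add: hker_def flip: cis_cnj)
    have h1pi: "hker 1 pi = 0" "hker 1 (-pi) = 0" by (simp_all add: hker_def flip: cis_cnj)
    let ?f = "\<lambda>s. \<rho> s * hker_deriv (of_real r) s" and ?f1 = "\<lambda>s. \<rho> s * hker_deriv 1 s"
    have cf: "continuous_on A ?f" if "A \<subseteq> {-pi..pi}" for A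
      by (intro continuous_intros continuous_on_hker_deriv continuous_on_subset[OF cr that]) (use r cis_neq in auto)
    have n1: "cis s \<noteq> 1" if "s \<in> {\<epsilon>..pi} \<or> s \<in> {-pi..-\<epsilon>}" for s
      using that \<epsilon> by (intro cis_neq_one) auto
    have cf1: "continuous_on A ?f1" if "A \<subseteq> {\<epsilon>..pi} \<or> A \<subseteq> {-pi..-\<epsilon>}" for A
    proof (intro continuous_intros continuous_on_hker_deriv)
      have "A \<subseteq> {-pi..pi}" using that epi \<epsilon> by (auto simp: subset_iff)
      then show "continuous_on A \<rho>" by (rule continuous_on_subset[OF cr])
      show "cis t \<noteq> 1" if "t \<in> A" for t using n1 that \<open>A \<subseteq> {\<epsilon>..pi} \<or> A \<subseteq> {-pi..-\<epsilon>}\<close> by blast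
    qed
    have i1: "integral {-pi..pi} (\<lambda>s. \<rho>' s * hker (of_real r) s) = - integral {-pi..pi} ?f"
      using integral_unique[OF parts[of "-pi" pi "of_real r"]] r cis_neq hpi per by simp
    have i2: "integral {\<epsilon>..pi} (\<lambda>s. \<rho>' s * hker 1 s) = - \<rho> \<epsilon> * hker 1 \<epsilon> - integral {\<epsilon>..pi} ?f1"
      using integral_unique[OF parts[of \<epsilon> pi 1]] n1 epi \<epsilon> h1pi by simp
    have i3: "integral {-pi..-\<epsilon>} (\<lambda>s. \<rho>' s * hker 1 s) = \<rho> (-\<epsilon>) * hker 1 (-\<epsilon>) - integral {-pi..-\<epsilon>} ?f1"
      using integral_unique[OF parts[of "-pi" "-\<epsilon>" 1]] n1 epi \<epsilon> h1pi by simp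
    have c1: "integral {-pi..pi} ?f = integral {-pi..-\<epsilon>} ?f + integral {-\<epsilon>..pi} ?f"
      by (rule Henstock_Kurzweil_Integration.integral_combine[symmetric]) (use \<epsilon> epi in \<open>auto intro!: integrable_continuous_real cf\<close>)
    have c2: "integral {-\<epsilon>..pi} ?f = integral {-\<epsilon>..\<epsilon>} ?f + integral {\<epsilon>..pi} ?f"
      by (rule Henstock_Kurzweil_Integration.integral_combine[symmetric]) (use \<epsilon> epi in \<open>auto intro!: integrable_continuous_real cf\<close>)
    have d1: "integral {\<epsilon>..pi} ?f - integral {\<epsilon>..pi} ?f1 = integral {\<epsilon>..pi} (\<lambda>s. ?f s - ?f1 s)"
      by (rule Henstock_Kurzweil_Integration.integral_diff[symmetric]) (use \<epsilon> epi in \<open>auto intro!: integrable_continuous_real cf cf1\<close>)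
    have d2: "integral {-pi..-\<epsilon>} ?f - integral {-pi..-\<epsilon>} ?f1 = integral {-pi..-\<epsilon>} (\<lambda>s. ?f s - ?f1 s)"
      by (rule Henstock_Kurzweil_Integration.integral_diff[symmetric]) (use \<epsilon> epi in \<open>auto intro!: integrable_continuous_real cf cf1\<close>)
    have Zeq: "Z r = - integral {-\<epsilon>..\<epsilon>} ?f - integral {\<epsilon>..pi} (\<lambda>s. ?f s - ?f1 s) - integral {-pi..-\<epsilon>} (\<lambda>s. ?f s - ?f1 s)
        + \<rho> \<epsilon> * hker 1 \<epsilon> - \<rho> (-\<epsilon>) * hker 1 (-\<epsilon>)"
      unfolding Z_def \<epsilon>_def[symmetric] i1 i2 i3 c1 c2 d1[symmetric] d2[symmetric] by simp
    define Q where "Q = \<eta> + M * \<epsilon>\<^sup>2"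
    have near: "norm (integral {-\<epsilon>..\<epsilon>} ?f) \<le> 4 * Q"
    proof -
      have "norm (integral {-\<epsilon>..\<epsilon>} ?f) \<le> (2 / \<epsilon> * Q) * \<epsilon> - (2 / \<epsilon> * Q) * (- \<epsilon>)"
      proof (rule norm_integral_le_antiderivative[where G = "\<lambda>s. (2 / \<epsilon> * Q) * s" and G' = "\<lambda>s. 2 / \<epsilon> * Q"])
        show "((\<lambda>s. (2 / \<epsilon> * Q) * s) has_real_derivative 2 / \<epsilon> * Q) (at s)" for s
          by (rule DERIV_cmult_Id)
        show "norm (?f s) \<le> 2 / \<epsilon> * Q" if s: "s \<in> {-\<epsilon>..\<epsilon>}" for s
        proof -
          have s': "\<bar>s\<bar> \<le> \<epsilon>" "\<bar>s\<bar> \<le> pi" "s \<in> {-pi..pi}" using s epi by auto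
          have "\<eta> * \<bar>s\<bar> \<le> \<eta> * \<epsilon>" "M * \<bar>s\<bar> ^ 3 \<le> M * \<epsilon> ^ 3"
            using s'(1) \<eta> M by (auto intro!: mult_left_mono power_mono)
          then have "norm (\<rho> s) \<le> \<eta> * \<epsilon> + M * \<epsilon> ^ 3"
            using M(2)[OF s'(3)] by linarith
          then have "norm (?f s) \<le> (\<eta> * \<epsilon> + M * \<epsilon> ^ 3) * (2 / \<epsilon>\<^sup>2)"
            unfolding norm_mult using hker_estimates(1)[OF r s'(2)] \<eta> M \<epsilon> by (intro mult_mono) (auto simp: \<epsilon>_def)
          also have "\<dots> = 2 / \<epsilon> * Q" using \<epsilon> by (simp add: Q_def field_simps power2_eq_square power3_eq_cube)
          finally show ?thesis .
        qed
        show "continuous_on {-\<epsilon>..\<epsilon>} ?f" by (rule cf) (use epi in auto)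
      qed (use \<epsilon> in auto)
      also have "\<dots> = 4 * Q" using \<epsilon> by simp
      finally show ?thesis .
    qed
    have bd: "norm (\<rho> s * hker 1 s) \<le> 4 * Q" if "\<bar>s\<bar> = \<epsilon>" for s
    proof -
      have s: "s \<in> {-pi..pi}" "\<bar>s\<bar> \<le> pi" "s \<noteq> 0" using that epi \<epsilon> by auto
      have "norm (\<rho> s * hker 1 s) \<le> (\<eta> * \<epsilon> + M * \<epsilon> ^ 3) * (4 / \<epsilon>)"
        unfolding norm_mult using M(2)[OF s(1)] hker_estimates(2)[OF r s(2,3)] \<eta> M \<epsilon> that by (intro mult_mono) auto
      also have "\<dots> = 4 * Q" using \<epsilon> by (simp add: Q_def field_simps power2_eq_square power3_eq_cube)
      finally show ?thesis .
    qed
    have farpt: "norm (?f s - ?f1 s) \<le> 384 * \<epsilon> * (\<eta> / s\<^sup>2 + M)" if s: "\<epsilon> \<le> \<bar>s\<bar>" "\<bar>s\<bar> \<le> pi" for s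
    proof -
      have s0: "\<bar>s\<bar> > 0" using s \<epsilon> by simp
      have "norm (?f s - ?f1 s) = norm (\<rho> s) * norm (hker_deriv (of_real r) s - hker_deriv 1 s)"
        by (simp add: norm_mult[symmetric] right_diff_distrib)
      also have "\<dots> \<le> (\<eta> * \<bar>s\<bar> + M * \<bar>s\<bar> ^ 3) * (384 * \<epsilon> / \<bar>s\<bar> ^ 3)"
        using M(2)[of s] hker_estimates(3)[OF r s(2)] s \<eta> M by (intro mult_mono) (auto simp: \<epsilon>_def abs_le_iff)
      also have "\<dots> = 384 * \<epsilon> * (\<eta> / \<bar>s\<bar>\<^sup>2 + M)"
        using s0 by (simp add: field_simps power2_eq_square power3_eq_cube del: abs_mult_self_eq)
      finally show ?thesis by simp
    qed
    \<comment> \<open>An antiderivative of the bound in \<open>farpt\<close> on either side of 0.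
      Its singular part has size \<eta> at the cut points, where the prefactor \<epsilon> cancels
      the pole.\<close>
    define G where "G = (\<lambda>s. 384 * \<epsilon> * (- \<eta> / s + M * s))"
    have G: "(G has_real_derivative 384 * \<epsilon> * (\<eta> / s\<^sup>2 + M)) (at s)" if "s \<noteq> 0" for s
      unfolding G_def using that by (auto intro!: derivative_eq_intros simp: power2_eq_square)
    have cd: "continuous_on A (\<lambda>s. ?f s - ?f1 s)" if "A \<subseteq> {\<epsilon>..pi} \<or> A \<subseteq> {-pi..-\<epsilon>}" for A
    proof (intro continuous_on_diff cf cf1 that)
      show "A \<subseteq> {-pi..pi}" using that epi \<epsilon> by (auto simp: subset_iff)
    qed
    have Gb: "G pi - G \<epsilon> \<le> 384 * (\<eta> + 4 * M * \<epsilon>)" "G (-\<epsilon>) - G (-pi) \<le> 384 * (\<eta> + 4 * M * \<epsilon>)"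
    proof -
      have eq: "G pi - G \<epsilon> = 384 * (\<eta> - \<epsilon> * \<eta> / pi + \<epsilon> * M * (pi - \<epsilon>))" "G (-\<epsilon>) - G (-pi) = 384 * (\<eta> - \<epsilon> * \<eta> / pi + \<epsilon> * M * (pi - \<epsilon>))"
        using \<epsilon> by (simp_all add: G_def field_simps)
      have "\<epsilon> * M * (pi - \<epsilon>) \<le> \<epsilon> * M * 4" using \<epsilon> M pi_less_4 by (intro mult_left_mono) auto
      moreover have "0 \<le> \<epsilon> * \<eta> / pi" using \<epsilon> \<eta> by simp
      moreover have "\<epsilon> * M * 4 = 4 * M * \<epsilon>" by simp
      ultimately have "\<eta> - \<epsilon> * \<eta> / pi + \<epsilon> * M * (pi - \<epsilon>) \<le> \<eta> + 4 * M * \<epsilon>" by linarith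
      then show "G pi - G \<epsilon> \<le> 384 * (\<eta> + 4 * M * \<epsilon>)" "G (-\<epsilon>) - G (-pi) \<le> 384 * (\<eta> + 4 * M * \<epsilon>)"
        unfolding eq by simp_all
    qed
    have far1: "norm (integral {\<epsilon>..pi} (\<lambda>s. ?f s - ?f1 s)) \<le> 384 * (\<eta> + 4 * M * \<epsilon>)"
      by (rule order_trans[OF norm_integral_le_antiderivative[where G = G and G' = "\<lambda>s. 384 * \<epsilon> * (\<eta> / s\<^sup>2 + M)"] Gb(1)])
         (use \<epsilon> epi G farpt in \<open>auto intro!: cd\<close>)
    have far2: "norm (integral {-pi..-\<epsilon>} (\<lambda>s. ?f s - ?f1 s)) \<le> 384 * (\<eta> + 4 * M * \<epsilon>)"
      by (rule order_trans[OF norm_integral_le_antiderivative[where G = G and G' = "\<lambda>s. 384 * \<epsilon> * (\<eta> / s\<^sup>2 + M)"] Gb(2)])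
         (use \<epsilon> epi G farpt in \<open>auto intro!: cd\<close>)
    have tri: "norm (- a - b - c + d - e) \<le> norm a + norm b + norm c + norm d + norm e" for a b c d e :: complex
      by (smt (verit) norm_minus_cancel norm_triangle_ineq norm_triangle_ineq4)
    have "norm (Z r) \<le> 4 * Q + 384 * (\<eta> + 4 * M * \<epsilon>) + 384 * (\<eta> + 4 * M * \<epsilon>) + 4 * Q + 4 * Q"
      unfolding Zeq using \<epsilon>
      by (intro order_trans[OF tri] add_mono near far1 far2 bd) auto
    moreover have "Q \<le> \<eta> + 4 * M * \<epsilon>"
    proof -
      have "M * \<epsilon>\<^sup>2 \<le> M * (4 * \<epsilon>)" using \<epsilon> M by (intro mult_left_mono) (auto simp: power2_eq_square)
      then show ?thesis by (simp add: Q_def)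
    qed
    moreover have "0 \<le> \<eta> + 4 * M * \<epsilon>" using \<eta> M \<epsilon> by simp
    \<comment> \<open>3 * 4 + 2 * 384 = 780, rounded up to 800.\<close>
    moreover have "n \<le> 4 * q + 384 * E + 384 * E + 4 * q + 4 * q \<Longrightarrow> q \<le> E \<Longrightarrow> 0 \<le> E \<Longrightarrow> n \<le> 800 * E" for n q E :: real
      by linarith
    ultimately have "norm (Z r) \<le> 800 * (\<eta> + 4 * M * \<epsilon>)" by blast
    then show ?thesis unfolding \<epsilon>_def .
  qed
  have "(Z \<longlongrightarrow> 0) (at_left 1)"
  proof (rule tendstoI)
    fix e :: real assume e: "e > 0"
    define \<eta> where "\<eta> = e / 1600"
    have \<eta>: "\<eta> > 0" using e by (simp add: \<eta>_def)
    obtain M where M: "M \<ge> 0" "\<And>s. s \<in> {-pi..pi} \<Longrightarrow> norm (\<rho> s) \<le> \<eta> * \<bar>s\<bar> + M * \<bar>s\<bar> ^ 3"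
      using growth[OF \<eta>] by blast
    have "((\<lambda>r. 800 * (\<eta> + 4 * M * (1 - r))) \<longlongrightarrow> 800 * (\<eta> + 4 * M * (1 - 1))) (at_left 1)"
      by (intro tendsto_intros)
    then have "\<forall>\<^sub>F r in at_left 1. 800 * (\<eta> + 4 * M * (1 - r)) < e"
      by (rule order_tendstoD) (use e in \<open>simp add: \<eta>_def\<close>)
    moreover have "\<forall>\<^sub>F r in at_left (1::real). r \<in> {0<..<1}"
      by (rule eventually_at_leftI[of 0]) auto
    ultimately show "\<forall>\<^sub>F r in at_left 1. dist (Z r) 0 < e"
    proof eventually_elim
      case (elim r)
      then show ?case using est[of r \<eta> M] \<eta> M by (simp add: le_less_trans)
    qed
  qed
  then show ?thesis unfolding Z_def .
qed


section \<open>Periodic integrals over shifted windows and the truncated Hilbert integral\<close>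

lemma has_integral_periodic:
  fixes f :: "real \<Rightarrow> 'a::euclidean_space"
  assumes per: "\<And>t. f (t + 2*pi) = f t" and I: "(f has_integral I) {0..2*pi}" and a: "-2*pi \<le> a" "a \<le> 2*pi"
  shows "(f has_integral I) {a..a+2*pi}"
proof -
  have sh: "f \<circ> ((+) (2*pi)) = f" by (simp add: fun_eq_iff add.commute[of "2*pi"] per)
  have pos: "(f has_integral I) {b..b+2*pi}" if b: "0 \<le> b" "b \<le> 2*pi" for b
  proof -
    have fi: "f integrable_on {0..2*pi}" using I by blast
    have 1: "f integrable_on {0..b}" "f integrable_on {b..2*pi}"
      by (rule integrable_subinterval_real[OF fi]; use b in auto)+
    obtain J1 J2 where J: "(f has_integral J1) {0..b}" "(f has_integral J2) {b..2*pi}"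
      using 1 unfolding integrable_on_def by blast
    have "(f has_integral (J1 + J2)) {0..2*pi}" by (rule has_integral_combine[OF b J])
    then have eq: "I = J1 + J2" using I has_integral_unique by blast
    have "(f has_integral J1) {0 + 2*pi..b + 2*pi}"
      using has_integral_shift_Icc_real[of f "2*pi" J1 0 b] J(1) unfolding sh by blast
    then have "(f has_integral (J2 + J1)) {b..b+2*pi}"
      by (intro has_integral_combine[OF _ _ J(2)]) (use b in auto)
    then show ?thesis unfolding eq by (simp add: add.commute)
  qed
  show ?thesis
  proof (cases "0 \<le> a")
    case True
    then show ?thesis using pos a by blast
  next
    case False
    then have "(f has_integral I) {a + 2*pi..a + 2*pi + 2*pi}" using a by (intro pos) auto
    then show ?thesis
      using has_integral_shift_Icc_real[of f "2*pi" I a "a + 2*pi"] unfolding sh by simp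
  qed
qed

lemma has_integral_periodic_shift:
  fixes f :: "real \<Rightarrow> 'a::euclidean_space"
  assumes per: "\<And>t. f (t + 2*pi) = f t" and I: "(f has_integral I) {0..2*pi}" and \<theta>: "0 \<le> \<theta>" "\<theta> \<le> 2*pi"
  shows "((\<lambda>s. f (\<theta> + s)) has_integral I) {-pi..pi}"
proof -
  have "(f has_integral I) {(\<theta> - pi)..(\<theta> - pi) + 2*pi}"
    by (rule has_integral_periodic[OF per I]) (use \<theta> pi_gt_zero in linarith)+
  then have "(f has_integral I) {-pi + \<theta>..pi + \<theta>}" by (simp add: algebra_simps)
  then have "((f \<circ> ((+) \<theta>)) has_integral I) {-pi..pi}" by (simp only: has_integral_shift_Icc_real)
  then show ?thesis by (simp add: o_def)
qed

text \<open>The expression under the limit in \<open>hilbert\<close>, named so that the existence of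
  that limit can be discussed.\<close>

definition hilbert_trunc :: "(real \<Rightarrow> complex) \<Rightarrow> real \<Rightarrow> real \<Rightarrow> complex" where
  "hilbert_trunc \<phi> \<theta> \<epsilon> = (1 / (2*pi)) *
      integral\<^sup>L (lebesgue_on {s. \<epsilon> \<le> \<bar>s\<bar> \<and> \<bar>s\<bar> \<le> pi})
        (\<lambda>s. \<phi> (\<theta> - s) * complex_of_real (cot (s / 2)))"

lemma hilbert_eq_Lim: "hilbert \<phi> \<theta> = Lim (at_right 0) (hilbert_trunc \<phi> \<theta>)"
  unfolding hilbert_def hilbert_trunc_def[abs_def] ..

text \<open>Dividing by the half-angle \<open>cis (u / 2)\<close> leaves a sum over a difference of
  conjugates. The Hilbert kernel is thus the boundary value of the Herglotz kernel.\<close>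

lemma hker_one_eq_cot: "hker 1 u = - \<i> * of_real (cot (u / 2))"
proof -
  define c where "c = cis (u/2)"
  have c2: "cis u = c * c" by (simp add: c_def cis_mult)
  have cc: "c * cnj c = 1" by (simp add: c_def cis_cnj cis_mult)
  have c0: "cnj c \<noteq> 0" using cc by auto
  have "hker 1 u = ((c * c + 1) * cnj c) / ((c * c - 1) * cnj c)" unfolding hker_def c2 using c0 by simp
  also have "(c * c + 1) * cnj c = c + cnj c"
  proof -
    have "(c * c + 1) * cnj c = c * (c * cnj c) + cnj c" by (simp add: algebra_simps)
    then show ?thesis by (simp add: cc)
  qed
  also have "(c * c - 1) * cnj c = c - cnj c"
  proof -
    have "(c * c - 1) * cnj c = c * (c * cnj c) - cnj c" by (simp add: algebra_simps)
    then show ?thesis by (simp add: cc)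
  qed
  also have "c + cnj c = of_real (2 * cos (u/2))" unfolding complex_add_cnj by (simp add: c_def)
  also have "c - cnj c = of_real (2 * sin (u/2)) * \<i>" unfolding complex_diff_cnj by (simp add: c_def)
  also have "complex_of_real (2 * cos (u/2)) / (of_real (2 * sin (u/2)) * \<i>) = of_real (2 * cos (u/2) / (2 * sin (u/2))) * inverse \<i>"
    unfolding of_real_divide by (simp only: divide_inverse inverse_mult_distrib mult_ac)
  also have "\<dots> = - \<i> * of_real (cot (u / 2))" by (simp add: cot_def)
  finally show ?thesis .
qed

lemma herglotz_of_Re_holomorphic:
  fixes h :: "complex \<Rightarrow> complex"
  assumes h: "continuous_on (cball 0 1) h" "h holomorphic_on ball 0 1" and z: "norm z < 1"
  shows "herglotz (\<lambda>t. of_real (Re (h (cis t)))) z = h z - \<i> * Im (h 0)"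
proof -
  have i: "integrable circ_measure (\<lambda>t. h (cis t))" "integrable circ_measure (\<lambda>t. cnj (h (cis t)))"
    by (rule integrable_circ_continuous, intro continuous_on_cnj continuous_on_circ_compose[OF h(1)])+
  have "herglotz (\<lambda>t. of_real (Re (h (cis t)))) z = herglotz (\<lambda>t. (1/2) * (h (cis t) + cnj (h (cis t)))) z"
    by (simp only: complex_add_cnj of_real_mult of_real_numeral) simp
  also have "\<dots> = (1/2) * ((2 * h z - h 0) + cnj (h 0))"
    unfolding herglotz_cmult herglotz_add[OF i z] herglotz_of_holomorphic[OF h z] herglotz_of_cnj_holomorphic[OF h z] ..
  also have "\<dots> = h z - \<i> * Im (h 0)" by (simp add: complex_eq_iff)
  finally show ?thesis .
qed

lemma absolutely_integrable_mult_continuous: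
  fixes f k :: "real \<Rightarrow> complex"
  assumes f: "f absolutely_integrable_on {a..b}" and k: "continuous_on {a..b} k"
  shows "(\<lambda>x. f x * k x) absolutely_integrable_on {a..b}"
proof -
  have "(\<lambda>x. k x * f x) absolutely_integrable_on {a..b}"
  proof (rule absolutely_integrable_bounded_measurable_product[where h = "(*)"])
    show "bilinear ((*) :: complex \<Rightarrow> complex \<Rightarrow> complex)" by (rule bilinear_times)
    show "k \<in> borel_measurable (lebesgue_on {a..b})" using k by (rule continuous_imp_measurable_on_sets_lebesgue) auto
    show "bounded (k ` {a..b})" by (intro compact_imp_bounded compact_continuous_image k) simp
  qed (use f in auto)
  then show ?thesis by (simp add: mult.commute)
qed

context periodic_ac
begin

lemma phi_shift_absolutely_integrable:
  assumes \<theta>: "0 \<le> \<theta>" "\<theta> \<le> 2*pi"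
  shows "(\<lambda>s. \<phi> (\<theta> + s)) absolutely_integrable_on {-pi..pi}"
proof -
  have "integrable circ_measure (\<lambda>t. norm (\<phi> t))" using phi_int by auto
  then have "((\<lambda>t. norm (\<phi> t)) has_integral (LINT t|circ_measure. norm (\<phi> t))) {0..2*pi}"
    unfolding circ_measure_def by (intro has_integral_integral_lebesgue_on) auto
  from has_integral_periodic_shift[OF _ this \<theta>] has_integral_periodic_shift[OF phi_per integrable_circ_has_integral[OF phi_int] \<theta>]
  show ?thesis unfolding absolutely_integrable_on_def by (auto simp: phi_per integrable_on_def)
qed

text \<open>The reflection \<open>s \<mapsto> - s\<close> swaps the two halves of the truncated
  integral and turns \<open>\<i> * cot (s / 2)\<close> into \<open>hker 1 s\<close>.\<close>

lemma hilbert_trunc_eq: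
  assumes \<theta>: "0 \<le> \<theta>" "\<theta> \<le> 2*pi" and \<epsilon>: "0 < \<epsilon>" "\<epsilon> < pi"
  shows "\<i> * hilbert_trunc \<phi> \<theta> \<epsilon> = 1 / (2*pi) *
     (integral {\<epsilon>..pi} (\<lambda>s. \<phi> (\<theta> + s) * hker 1 s) + integral {-pi..-\<epsilon>} (\<lambda>s. \<phi> (\<theta> + s) * hker 1 s))"
proof -
  define q where "q = (\<lambda>s. \<phi> (\<theta> - s) * complex_of_real (cot (s / 2)))"
  have refl: "(\<lambda>s. \<phi> (\<theta> - s)) absolutely_integrable_on {-pi..pi}"
    using phi_shift_absolutely_integrable[OF \<theta>] absolutely_integrable_reflect_real[where f = "\<lambda>s. \<phi> (\<theta> + s)" and a = "-pi" and b = pi] by simp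
  have ccot: "continuous_on A (\<lambda>s. complex_of_real (cot (s / 2)))" if "A \<subseteq> {\<epsilon>..pi} \<or> A \<subseteq> {-pi..-\<epsilon>}" for A
  proof -
    have "sin (s/2) \<noteq> 0" if "s \<in> A" for s
    proof -
      have "s \<in> {\<epsilon>..pi} \<or> s \<in> {-pi..-\<epsilon>}" using that \<open>A \<subseteq> {\<epsilon>..pi} \<or> A \<subseteq> {-pi..-\<epsilon>}\<close> by blast
      then show ?thesis
      proof
        assume "s \<in> {\<epsilon>..pi}"
        then have "sin (s/2) > 0" using \<epsilon> by (intro sin_gt_zero) auto
        then show ?thesis by simp
      next
        assume "s \<in> {-pi..-\<epsilon>}"
        then have "sin (-s/2) > 0" using \<epsilon> by (intro sin_gt_zero) auto
        then show ?thesis by simp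
      qed
    qed
    then show ?thesis by (intro continuous_intros) auto
  qed
  have q1: "q absolutely_integrable_on {\<epsilon>..pi}"
    unfolding q_def by (rule absolutely_integrable_mult_continuous[OF absolutely_integrable_on_subinterval[OF refl] ccot]) (use \<epsilon> in auto)
  have q2: "q absolutely_integrable_on {-pi..-\<epsilon>}"
    unfolding q_def by (rule absolutely_integrable_mult_continuous[OF absolutely_integrable_on_subinterval[OF refl] ccot]) (use \<epsilon> in auto)
  have S: "{s. \<epsilon> \<le> \<bar>s\<bar> \<and> \<bar>s\<bar> \<le> pi} = {\<epsilon>..pi} \<union> {-pi..-\<epsilon>}" using \<epsilon> by auto
  have "integrable (lebesgue_on ({\<epsilon>..pi} \<union> {-pi..-\<epsilon>})) q"
    using absolutely_integrable_Un[OF q1 q2] by (subst integrable_restrict_space) (auto simp: set_integrable_def)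
  then have L: "integral\<^sup>L (lebesgue_on ({\<epsilon>..pi} \<union> {-pi..-\<epsilon>})) q = integral ({\<epsilon>..pi} \<union> {-pi..-\<epsilon>}) q"
    by (rule lebesgue_integral_eq_integral) auto
  also have "\<dots> = integral {\<epsilon>..pi} q + integral {-pi..-\<epsilon>} q"
    by (rule integral_Un) (use q1 q2 \<epsilon> set_lebesgue_integral_eq_integral(1) in \<open>auto intro!: negligible_subset[OF negligible_empty]\<close>)
  finally have L: "integral\<^sup>L (lebesgue_on {s. \<epsilon> \<le> \<bar>s\<bar> \<and> \<bar>s\<bar> \<le> pi}) q = integral {\<epsilon>..pi} q + integral {-pi..-\<epsilon>} q"
    unfolding S .
  have qm: "\<i> * q (- s) = \<phi> (\<theta> + s) * hker 1 s" for s by (simp add: q_def hker_one_eq_cot)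
  have r1: "\<i> * integral {\<epsilon>..pi} q = integral {-pi..-\<epsilon>} (\<lambda>s. \<phi> (\<theta> + s) * hker 1 s)"
    using Henstock_Kurzweil_Integration.integral_reflect_real[of pi \<epsilon> q] by (simp only: qm[symmetric] integral_mult_right)
  have r2: "\<i> * integral {-pi..-\<epsilon>} q = integral {\<epsilon>..pi} (\<lambda>s. \<phi> (\<theta> + s) * hker 1 s)"
    using Henstock_Kurzweil_Integration.integral_reflect_real[of "-\<epsilon>" "-pi" q] by (simp only: qm[symmetric] integral_mult_right minus_minus)
  have "\<i> * hilbert_trunc \<phi> \<theta> \<epsilon> = 1 / (2*pi) * (\<i> * integral {\<epsilon>..pi} q + \<i> * integral {-pi..-\<epsilon>} q)"
    unfolding hilbert_trunc_def q_def[symmetric] L by (simp add: algebra_simps)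
  then show ?thesis unfolding r1 r2 by (simp add: add.commute)
qed

text \<open>After a rotation the truncation estimate needs a primitive with derivative 0 at 0, so
  the tangent has to be removed. The function \<open>c * sin s\<close> is subtracted because it
  keeps the period, the Herglotz transform of its derivative is known exactly, and that derivative
  is even, so it drops out of the truncated integral against the odd kernel.\<close>

lemma herglotz_minus_truncated_hilbert_tendsto:
  assumes \<theta>: "0 \<le> \<theta>" "\<theta> \<le> 2*pi" and \<theta>N: "\<theta> \<notin> N"
  shows "((\<lambda>r. herglotz \<phi> (of_real r * cis \<theta>) - (\<phi> \<theta> + \<i> * hilbert_trunc \<phi> \<theta> (1 - r))) \<longlongrightarrow> 0) (at_left 1)"
proof -
  define c where "c = \<phi> \<theta>"
  define \<rho> where "\<rho> = (\<lambda>s. g (\<theta> + s) - g \<theta> - c * of_real (sin s))"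
  define \<rho>' where "\<rho>' = (\<lambda>s. \<phi> (\<theta> + s) - c * of_real (cos s))"
  define N' where "N' = (+) (-\<theta>) ` N"
  have N': "negligible N'" unfolding N'_def by (rule negligible_translation[OF negl])
  have acG: "abs_cont_on (-pi) pi (\<lambda>s. g (\<theta> + s))"
  proof -
    have "abs_cont_on (-(2*pi) + (-\<theta>)) (4*pi + (-\<theta>)) (\<lambda>s. g (\<theta> + s))"
      by (rule abs_cont_on_shift) (simp add: ac_wide)
    then show ?thesis by (rule abs_cont_on_sub) (use \<theta> pi_gt_zero in linarith)+
  qed
  have ac\<rho>: "abs_cont_on (-pi) pi \<rho>"
  proof (rule abs_cont_on_dominated[OF acG, of 1 "norm c"])
    fix x y :: real assume "x \<le> y"
    have "\<bar>sin y - sin x\<bar> \<le> \<bar>y - x\<bar>"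
    proof -
      have "norm (sin y - sin x) \<le> 1 * norm (y - x)"
        by (rule field_differentiable_bound[of UNIV sin cos]) (auto intro: DERIV_sin has_field_derivative_at_within)
      then show ?thesis by simp
    qed
    then have "norm c * norm (complex_of_real (sin y - sin x)) \<le> norm c * (y - x)"
      using \<open>x \<le> y\<close> by (intro mult_left_mono) (auto simp del: of_real_diff)
    moreover have "\<rho> y - \<rho> x = (g (\<theta> + y) - g (\<theta> + x)) - c * of_real (sin y - sin x)" by (simp add: \<rho>_def algebra_simps)
    then have "norm (\<rho> y - \<rho> x) \<le> norm (g (\<theta> + y) - g (\<theta> + x)) + norm c * norm (complex_of_real (sin y - sin x))"
      by (metis norm_triangle_ineq4 norm_mult)
    ultimately show "norm (\<rho> y - \<rho> x) \<le> 1 * norm (g (\<theta> + y) - g (\<theta> + x)) + norm c * (y - x)" by simp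
  qed auto
  have vd: "(\<rho> has_vector_derivative (\<phi> (\<theta> + s) - c * of_real (cos s))) (at s)" if "\<theta> + s \<notin> N" for s
  proof -
    have "((\<lambda>s. g (\<theta> + s)) has_vector_derivative \<phi> (\<theta> + s)) (at s)"
    proof -
      have "(g \<circ> (\<lambda>s. \<theta> + s) has_vector_derivative (1 *\<^sub>R \<phi> (\<theta> + s))) (at s)"
        by (rule vector_diff_chain_at) (auto intro!: derivative_eq_intros deriv that)
      then show ?thesis by (simp add: o_def)
    qed
    moreover have "((\<lambda>s. complex_of_real (sin s)) has_vector_derivative of_real (cos s)) (at s)"
      by (intro has_vector_derivative_of_real) (simp add: has_real_derivative_iff_has_vector_derivative[symmetric] DERIV_sin)
    then have "((\<lambda>s. c * complex_of_real (sin s)) has_vector_derivative c * of_real (cos s)) (at s)"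
      by (rule has_vector_derivative_mult_right)
    ultimately have "((\<lambda>s. g (\<theta> + s) - g \<theta> - c * of_real (sin s)) has_vector_derivative (\<phi> (\<theta> + s) - 0 - c * of_real (cos s))) (at s)"
      by (intro has_vector_derivative_diff has_vector_derivative_const)
    then show ?thesis by (simp add: \<rho>_def)
  qed
  define Z where "Z = (\<lambda>r. integral {-pi..pi} (\<lambda>s. \<rho>' s * hker (of_real r) s)
           - (integral {1 - r..pi} (\<lambda>s. \<rho>' s * hker 1 s) + integral {-pi..-(1-r)} (\<lambda>s. \<rho>' s * hker 1 s)))"
  have Z: "(Z \<longlongrightarrow> 0) (at_left 1)"
    unfolding Z_def
  proof (rule herglotz_truncation_estimate[OF ac\<rho> N'])
    show "(\<rho> has_vector_derivative \<rho>' s) (at s)" if "s \<in> {-pi<..<pi} - N'" for s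
    proof -
      have "\<theta> + s \<notin> N" using that by (auto simp: N'_def image_iff)
      then show ?thesis unfolding \<rho>'_def by (rule vd)
    qed
    show "\<rho> pi = \<rho> (-pi)" using g_per[of "\<theta> - pi"] by (simp add: \<rho>_def algebra_simps)
    show "\<rho> 0 = 0" by (simp add: \<rho>_def)
    show "(\<rho> has_vector_derivative 0) (at 0)" using vd[of 0] \<theta>N by (simp add: c_def)
  qed
  have eq: "herglotz \<phi> (of_real r * cis \<theta>) - (\<phi> \<theta> + \<i> * hilbert_trunc \<phi> \<theta> (1 - r)) = 1 / (2*pi) * Z r - c * of_real (1 - r)"
    if r: "0 < r" "r < 1" for r
  proof -
    define z where "z = of_real r * cis \<theta>"
    have z: "norm z < 1" using r by (simp add: z_def norm_mult)
    have k1: "hker z (\<theta> + s) = hker (of_real r) s" for s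
    proof -
      have "hker z (\<theta> + s) = (cis \<theta> * (cis s + of_real r)) / (cis \<theta> * (cis s - of_real r))"
        by (simp add: hker_def z_def cis_mult[symmetric] algebra_simps)
      then show ?thesis by (simp add: hker_def)
    qed
    \<comment> \<open>The cosine centred at \<open>\<theta>\<close>, written as the real part of a
      linear function of \<open>cis t\<close>. Its Herglotz transform at \<open>z\<close> is exactly
      \<open>r\<close>, which is the source of the term \<open>\<phi> \<theta>\<close> in the
      limit.\<close>
    define w where "w = (\<lambda>t. complex_of_real (Re (cis (-\<theta>) * cis t)))"
    have w: "w (\<theta> + s) = of_real (cos s)" for s by (simp add: w_def cis_mult del: cis.sel) simp
    have wi: "integrable circ_measure (\<lambda>t. c * w t)"
      unfolding w_def by (intro integrable_mult_right integrable_circ_continuous continuous_intros)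
    have hw: "herglotz w z = of_real r"
    proof -
      have "herglotz w z = cis (-\<theta>) * z - \<i> * Im (cis (-\<theta>) * 0)"
        unfolding w_def by (rule herglotz_of_Re_holomorphic[OF _ _ z]) (intro continuous_intros holomorphic_intros)+
      also have "\<dots> = of_real r" by (simp add: z_def cis_mult mult.left_commute)
      finally show ?thesis .
    qed
    define f where "f = (\<lambda>t. hker z t * (\<phi> t - c * w t))"
    have fi: "integrable circ_measure f" unfolding f_def by (intro integrable_herglotz z Bochner_Integration.integrable_diff phi_int wi)
    have per: "f (t + 2*pi) = f t" for t
    proof -
      have "cis (t + 2*pi) = cis t" by (simp add: cis_mult[symmetric])
      then show ?thesis unfolding f_def hker_def w_def phi_per by simp
    qed
    have "((\<lambda>s. f (\<theta> + s)) has_integral (LINT t|circ_measure. f t)) {-pi..pi}"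
      by (rule has_integral_periodic_shift[OF per integrable_circ_has_integral[OF fi] \<theta>])
    moreover have "(\<lambda>s. f (\<theta> + s)) = (\<lambda>s. \<rho>' s * hker (of_real r) s)"
      by (simp add: f_def k1 w \<rho>'_def fun_eq_iff mult.commute)
    ultimately have "integral {-pi..pi} (\<lambda>s. \<rho>' s * hker (of_real r) s) = (LINT t|circ_measure. f t)"
      by (simp add: integral_unique)
    also have "1 / (2*pi) * (LINT t|circ_measure. f t) = herglotz (\<lambda>t. \<phi> t - c * w t) z"
      unfolding herglotz_def f_def ..
    also have "\<dots> = herglotz \<phi> z - c * of_real r"
      unfolding herglotz_diff[OF phi_int wi z] herglotz_cmult hw ..
    finally have X: "1 / (2*pi) * integral {-pi..pi} (\<lambda>s. \<rho>' s * hker (of_real r) s) = herglotz \<phi> z - c * of_real r" .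
    define \<epsilon> where "\<epsilon> = 1 - r"
    have \<epsilon>: "0 < \<epsilon>" "\<epsilon> < pi" using r pi_gt3 by (auto simp: \<epsilon>_def)
    define cs where "cs = (\<lambda>s. c * of_real (cos s) * hker 1 s)"
    have ck: "continuous_on A (hker 1)" if "A \<subseteq> {\<epsilon>..pi} \<or> A \<subseteq> {-pi..-\<epsilon>}" for A
    proof -
      have "cis s \<noteq> 1" if "s \<in> A" for s
      proof (rule cis_neq_one)
        have "s \<in> {\<epsilon>..pi} \<or> s \<in> {-pi..-\<epsilon>}" using that \<open>A \<subseteq> {\<epsilon>..pi} \<or> A \<subseteq> {-pi..-\<epsilon>}\<close> by blast
        then show "s \<noteq> 0" "\<bar>s\<bar> \<le> pi" using \<epsilon> by auto
      qed
      then show ?thesis unfolding hker_def[abs_def] by (intro continuous_intros) auto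
    qed
    have split: "integral A (\<lambda>s. \<rho>' s * hker 1 s) = integral A (\<lambda>s. \<phi> (\<theta> + s) * hker 1 s) - integral A cs"
      if A: "A = {\<epsilon>..pi} \<or> A = {-pi..-\<epsilon>}" for A
    proof -
      have "\<exists>a b. A = {a..b} \<and> {a..b} \<subseteq> {-pi..pi}"
        using A
      proof
        assume "A = {\<epsilon>..pi}"
        then show ?thesis using \<epsilon> by (intro exI[of _ \<epsilon>] exI[of _ pi]) auto
      next
        assume "A = {-pi..-\<epsilon>}"
        then show ?thesis using \<epsilon> by (intro exI[of _ "-pi"] exI[of _ "-\<epsilon>"]) auto
      qed
      then obtain a b where ab: "A = {a..b}" "{a..b} \<subseteq> {-pi..pi}" by blast
      have "(\<lambda>s. \<phi> (\<theta> + s) * hker 1 s) absolutely_integrable_on A"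
        unfolding ab(1) by (rule absolutely_integrable_mult_continuous[OF absolutely_integrable_on_subinterval[OF phi_shift_absolutely_integrable[OF \<theta>] ab(2)]])
           (use A ab ck in blast)
      then have 1: "(\<lambda>s. \<phi> (\<theta> + s) * hker 1 s) integrable_on A" by (rule set_lebesgue_integral_eq_integral(1))
      have 2: "cs integrable_on A"
        unfolding cs_def ab(1) by (intro integrable_continuous_real continuous_intros) (use A ab ck in blast)
      have "(\<lambda>s. \<rho>' s * hker 1 s) = (\<lambda>s. \<phi> (\<theta> + s) * hker 1 s - cs s)" by (simp add: \<rho>'_def cs_def fun_eq_iff left_diff_distrib)
      then show ?thesis using Henstock_Kurzweil_Integration.integral_diff[OF 1 2] by simp
    qed
    have odd: "cs (- s) = - cs s" for s by (simp add: cs_def hker_one_eq_cot)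
    have "integral {-pi..-\<epsilon>} cs = - integral {\<epsilon>..pi} cs"
      using Henstock_Kurzweil_Integration.integral_reflect_real[of pi \<epsilon> "\<lambda>s. - cs s"] by (simp add: odd)
    then have "integral {\<epsilon>..pi} (\<lambda>s. \<rho>' s * hker 1 s) + integral {-pi..-\<epsilon>} (\<lambda>s. \<rho>' s * hker 1 s)
       = integral {\<epsilon>..pi} (\<lambda>s. \<phi> (\<theta> + s) * hker 1 s) + integral {-pi..-\<epsilon>} (\<lambda>s. \<phi> (\<theta> + s) * hker 1 s)"
      unfolding split[of "{\<epsilon>..pi}", simplified] split[of "{-pi..-\<epsilon>}", simplified] by simp
    then have Y: "1 / (2*pi) * (integral {\<epsilon>..pi} (\<lambda>s. \<rho>' s * hker 1 s) + integral {-pi..-\<epsilon>} (\<lambda>s. \<rho>' s * hker 1 s))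
       = \<i> * hilbert_trunc \<phi> \<theta> \<epsilon>"
      unfolding hilbert_trunc_eq[OF \<theta> \<epsilon>] by simp
    have "1 / (2*pi) * Z r = (herglotz \<phi> z - c * of_real r) - \<i> * hilbert_trunc \<phi> \<theta> \<epsilon>"
      unfolding Z_def \<epsilon>_def[symmetric] right_diff_distrib X Y ..
    then show ?thesis unfolding z_def \<epsilon>_def c_def by (simp add: algebra_simps)
  qed
  have "((\<lambda>r. 1 / (2*pi) * Z r - c * of_real (1 - r)) \<longlongrightarrow> of_real (1 / (2*pi)) * 0 - c * of_real (1 - 1)) (at_left 1)"
    by (intro tendsto_intros Z)
  then have "((\<lambda>r. 1 / (2*pi) * Z r - c * of_real (1 - r)) \<longlongrightarrow> 0) (at_left 1)" by simp
  moreover have "\<forall>\<^sub>F r in at_left (1::real). r \<in> {0<..<1}"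
    by (rule eventually_at_leftI[of 0]) auto
  then have "\<forall>\<^sub>F r in at_left 1. 1 / (2*pi) * Z r - c * of_real (1 - r) = herglotz \<phi> (of_real r * cis \<theta>) - (\<phi> \<theta> + \<i> * hilbert_trunc \<phi> \<theta> (1 - r))"
    by (rule eventually_mono) (simp add: eq)
  ultimately show ?thesis by (rule Lim_transform_eventually)
qed

text \<open>Average the expansion for \<open>\<phi>\<close> and the conjugate of the one for
  \<open>cnj \<phi>\<close>: the truncated Hilbert integrals cancel before any limit is taken, so
  their convergence is not at issue.\<close>

lemma poisson_radial_limit:
  assumes \<theta>: "0 \<le> \<theta>" "\<theta> \<le> 2*pi" and \<theta>N: "\<theta> \<notin> N"
  shows "((\<lambda>r. poisson \<phi> (of_real r * cis \<theta>)) \<longlongrightarrow> \<phi> \<theta>) (at_left 1)"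
proof -
  interpret c: periodic_ac "\<lambda>t. cnj (g t)" "\<lambda>t. cnj (\<phi> t)" N by (rule periodic_ac_cnj)
  have hc: "cnj (\<i> * hilbert_trunc (\<lambda>t. cnj (\<phi> t)) \<theta> \<epsilon>) = - \<i> * hilbert_trunc \<phi> \<theta> \<epsilon>" for \<epsilon>
  proof -
    have "(LINT s|lebesgue_on {s. \<epsilon> \<le> \<bar>s\<bar> \<and> \<bar>s\<bar> \<le> pi}. cnj (\<phi> (\<theta> - s) * complex_of_real (cot (s / 2))))
       = cnj (LINT s|lebesgue_on {s. \<epsilon> \<le> \<bar>s\<bar> \<and> \<bar>s\<bar> \<le> pi}. \<phi> (\<theta> - s) * complex_of_real (cot (s / 2)))"
      by (rule Bochner_Integration.integral_cnj)
    then show ?thesis unfolding hilbert_trunc_def by simp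
  qed
  have 1: "((\<lambda>r. herglotz \<phi> (of_real r * cis \<theta>) - (\<phi> \<theta> + \<i> * hilbert_trunc \<phi> \<theta> (1 - r))) \<longlongrightarrow> 0) (at_left 1)"
    by (rule herglotz_minus_truncated_hilbert_tendsto[OF assms])
  have 2: "((\<lambda>r. cnj (herglotz (\<lambda>t. cnj (\<phi> t)) (of_real r * cis \<theta>) - (cnj (\<phi> \<theta>) + \<i> * hilbert_trunc (\<lambda>t. cnj (\<phi> t)) \<theta> (1 - r)))) \<longlongrightarrow> cnj 0) (at_left 1)"
    by (intro tendsto_cnj c.herglotz_minus_truncated_hilbert_tendsto[OF assms])
  have "((\<lambda>r. \<phi> \<theta> + (1/2) * ((herglotz \<phi> (of_real r * cis \<theta>) - (\<phi> \<theta> + \<i> * hilbert_trunc \<phi> \<theta> (1 - r)))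
       + cnj (herglotz (\<lambda>t. cnj (\<phi> t)) (of_real r * cis \<theta>) - (cnj (\<phi> \<theta>) + \<i> * hilbert_trunc (\<lambda>t. cnj (\<phi> t)) \<theta> (1 - r))))) \<longlongrightarrow> \<phi> \<theta> + (1/2) * (0 + cnj 0)) (at_left 1)"
    by (intro tendsto_intros 1 2)
  then have "((\<lambda>r. \<phi> \<theta> + (1/2) * ((herglotz \<phi> (of_real r * cis \<theta>) - (\<phi> \<theta> + \<i> * hilbert_trunc \<phi> \<theta> (1 - r)))
       + cnj (herglotz (\<lambda>t. cnj (\<phi> t)) (of_real r * cis \<theta>) - (cnj (\<phi> \<theta>) + \<i> * hilbert_trunc (\<lambda>t. cnj (\<phi> t)) \<theta> (1 - r))))) \<longlongrightarrow> \<phi> \<theta>) (at_left 1)" by simp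
  moreover have "\<forall>\<^sub>F r in at_left (1::real). r \<in> {0<..<1}"
    by (rule eventually_at_leftI[of 0]) auto
  then have "\<forall>\<^sub>F r in at_left 1. \<phi> \<theta> + (1/2) * ((herglotz \<phi> (of_real r * cis \<theta>) - (\<phi> \<theta> + \<i> * hilbert_trunc \<phi> \<theta> (1 - r)))
       + cnj (herglotz (\<lambda>t. cnj (\<phi> t)) (of_real r * cis \<theta>) - (cnj (\<phi> \<theta>) + \<i> * hilbert_trunc (\<lambda>t. cnj (\<phi> t)) \<theta> (1 - r)))) = poisson \<phi> (of_real r * cis \<theta>)"
  proof eventually_elim
    case (elim r)
    then have z: "norm (of_real r * cis \<theta>) < 1" by (simp add: norm_mult)
    show ?case unfolding poisson_herglotz[OF phi_int z] complex_cnj_diff complex_cnj_add hc complex_cnj_cnj by (simp add: field_simps)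
  qed
  ultimately show ?thesis by (rule Lim_transform_eventually)
qed

end



section \<open>Radial limits\<close>

lemma AE_circ_iff: "(AE t in circ_measure. P t) \<longleftrightarrow> (AE t in lebesgue. t \<in> {0..2*pi} \<longrightarrow> P t)"
  unfolding circ_measure_def by (rule AE_restrict_space_iff) simp

lemma AE_circ_not_in_negligible: "negligible N \<Longrightarrow> AE t in circ_measure. t \<notin> N"
  unfolding AE_circ_iff by (rule AE_mp[OF AE_not_in[of N]]) (auto simp: negligible_iff_null_sets)

lemma measurable_circ_AE_cong:
  fixes f g :: "real \<Rightarrow> complex"
  assumes f: "f \<in> borel_measurable circ_measure" and eq: "AE t in circ_measure. f t = g t"
  shows "g \<in> borel_measurable circ_measure"
proof -
  have "(\<lambda>x. if x \<in> {0..2*pi} then f x else 0) \<in> borel_measurable lebesgue"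
    using f unfolding circ_measure_def by (rule borel_measurable_if_I) simp
  moreover have "AE x in lebesgue. (if x \<in> {0..2*pi} then f x else 0) = (if x \<in> {0..2*pi} then g x else 0)"
    using eq unfolding AE_circ_iff by eventually_elim auto
  ultimately have "(\<lambda>x. if x \<in> {0..2*pi} then g x else 0) \<in> borel_measurable lebesgue"
    by (rule borel_measurable_AE)
  then show ?thesis unfolding circ_measure_def by (rule borel_measurable_if_D)
qed

text \<open>Meant for \<open>hilbert\<close>, whose values come from \<open>Lim\<close> and are
  identified only almost everywhere; completeness of Lebesgue measure carries measurability across
  the null set.\<close>

lemma measurable_circ_AE_limit:
  fixes f :: "nat \<Rightarrow> real \<Rightarrow> complex"
  assumes f: "\<And>n. f n \<in> borel_measurable circ_measure" and lim: "AE t in circ_measure. (\<lambda>n. f n t) \<longlonglongrightarrow> g t"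
  shows "g \<in> borel_measurable circ_measure"
proof -
  obtain N where N: "{t \<in> space circ_measure. \<not> (\<lambda>n. f n t) \<longlonglongrightarrow> g t} \<subseteq> N" "N \<in> null_sets circ_measure"
    using lim by (auto elim!: AE_E simp: null_setsI)
  define g' where "g' = (\<lambda>t. if t \<in> N then 0 else g t)"
  have "g' \<in> borel_measurable circ_measure"
  proof (rule borel_measurable_LIMSEQ_metric)
    show "(\<lambda>t. if t \<in> N then 0 else f n t) \<in> borel_measurable circ_measure" for n
      using f[of n] sets.Int[OF null_setsD2[OF N(2)] sets.top] by (intro measurable_If_set) auto
    show "(\<lambda>n. if t \<in> N then 0 else f n t) \<longlonglongrightarrow> g' t" if "t \<in> space circ_measure" for t
      using N(1) that by (auto simp: g'_def)
  qed
  moreover have "AE t in circ_measure. g' t = g t"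
    using AE_not_in[OF N(2)] by eventually_elim (simp add: g'_def)
  ultimately show ?thesis by (rule measurable_circ_AE_cong)
qed

lemma has_vector_derivative_periodic:
  fixes g :: "real \<Rightarrow> complex"
  assumes per: "\<And>t. g (t + p) = g t"
  shows "(g has_vector_derivative D) (at (t + p)) \<longleftrightarrow> (g has_vector_derivative D) (at t)"
proof
  assume "(g has_vector_derivative D) (at (t + p))"
  then have "(g \<circ> (\<lambda>t. t + p) has_vector_derivative 1 *\<^sub>R D) (at t)"
    by (intro vector_diff_chain_at) (auto intro!: derivative_eq_intros)
  then show "(g has_vector_derivative D) (at t)" by (simp add: o_def per)
next
  assume *: "(g has_vector_derivative D) (at t)"
  have per': "g (t - p) = g t" for t using per[of "t - p"] by simp
  have "(g \<circ> (\<lambda>t. t - p) has_vector_derivative 1 *\<^sub>R D) (at (t + p))"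
    by (rule vector_diff_chain_at) (use * in \<open>auto intro!: derivative_eq_intros\<close>)
  then show "(g has_vector_derivative D) (at (t + p))" by (simp add: o_def per')
qed

lemma vector_derivative_periodic:
  fixes g :: "real \<Rightarrow> complex"
  assumes per: "\<And>t. g (t + p) = g t"
  shows "vector_derivative g (at (t + p)) = vector_derivative g (at t)"
  unfolding vector_derivative_def has_vector_derivative_periodic[of g p, OF per] ..

text \<open>The points of one period without derivative form a null set, and periodicity spreads it
  over countably many translates. The point 0 is added by hand, since the theorem on one period
  concerns only its interior.\<close>

lemma periodic_acI:
  fixes g :: "real \<Rightarrow> complex"
  assumes per: "\<And>t. g (t + 2*pi) = g t" and ac: "abs_cont_on 0 (2*pi) g"
    and int: "integrable circ_measure (\<lambda>t. vector_derivative g (at t))"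
  shows "periodic_ac g (\<lambda>t. vector_derivative g (at t)) {t. \<not> g differentiable (at t)}"
proof
  show "negligible {t. \<not> g differentiable (at t)}"
  proof -
    define E where "E = {t \<in> {0<..<2*pi}. \<not> g differentiable (at t)} \<union> {0}"
    have E: "negligible E"
      unfolding E_def using abs_cont_on_complex_ae_derivative[OF ac] by (simp add: negligible_Un)
    have perk: "g (t + 2 * pi * of_int k) = g t" for t and k :: int
    proof (induction k rule: int_induct[where k = 0])
      case (step1 i)
      have "g (t + 2 * pi * of_int (i + 1)) = g ((t + 2 * pi * of_int i) + 2 * pi)" by (simp add: algebra_simps)
      then show ?case using per step1 by simp
    next
      case (step2 i)
      have "g (t + 2 * pi * of_int i) = g ((t + 2 * pi * of_int (i - 1)) + 2 * pi)" by (simp add: algebra_simps)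
      then show ?case using per step2 by simp
    qed simp
    have "{t. \<not> g differentiable (at t)} \<subseteq> (\<Union>k::int. (+) (2 * pi * of_int k) ` E)"
    proof
      fix t assume t: "t \<in> {t. \<not> g differentiable (at t)}"
      define k where "k = \<lfloor>t / (2*pi)\<rfloor>"
      define s where "s = t - 2 * pi * of_int k"
      have "of_int k \<le> t / (2*pi)" "t / (2*pi) < of_int k + 1" unfolding k_def by linarith+
      then have s: "0 \<le> s" "s < 2*pi" by (simp_all add: s_def field_simps)
      have ts: "t = s + 2 * pi * of_int k" by (simp add: s_def)
      have "\<not> g differentiable (at s)"
      proof
        assume "g differentiable (at s)"
        then have "(g has_vector_derivative vector_derivative g (at s)) (at s)" by (simp add: vector_derivative_works)
        then have "(g has_vector_derivative vector_derivative g (at s)) (at t)"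
          unfolding ts using has_vector_derivative_periodic[of g "2 * pi * of_int k", OF perk] by blast
        then show False using t differentiableI_vector by blast
      qed
      then have "s \<in> E" using s by (auto simp: E_def)
      then show "t \<in> (\<Union>k::int. (+) (2 * pi * of_int k) ` E)" using ts by (auto simp: image_iff add.commute intro!: exI[of _ k] bexI[of _ s])
    qed
    moreover have "negligible (\<Union>k::int. (+) (2 * pi * of_int k) ` E)"
      unfolding negligible_iff_null_sets
      by (intro null_sets_UN) (use negligible_translation[OF E] in \<open>auto simp: negligible_iff_null_sets\<close>)
    ultimately show ?thesis by (metis negligible_subset)
  qed
  show "(g has_vector_derivative vector_derivative g (at t)) (at t)" if "t \<notin> {t. \<not> g differentiable (at t)}" for t
    using that by (simp add: vector_derivative_works)
qed (use assms vector_derivative_periodic[of g "2*pi"] in auto)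

lemma lipschitz_derivative_bound:
  fixes g :: "real \<Rightarrow> complex"
  assumes L: "\<And>s. norm (g s - g t) \<le> M * \<bar>s - t\<bar>" and d: "(g has_vector_derivative D) (at t)"
  shows "norm D \<le> M"
proof (rule field_le_epsilon)
  fix e :: real assume e: "e > 0"
  obtain \<delta> where \<delta>: "\<delta> > 0" "\<And>s. norm (s - t) < \<delta> \<Longrightarrow> norm (g s - g t - (s - t) *\<^sub>R D) \<le> e * norm (s - t)"
    using d e unfolding has_vector_derivative_def has_derivative_at_alt by blast
  define s where "s = t + \<delta> / 2"
  have st: "s - t = \<delta> / 2" by (simp add: s_def)
  have "(\<delta>/2) * norm D = norm ((s - t) *\<^sub>R D)" using \<delta> by (simp add: st)
  also have "\<dots> = norm ((g s - g t) - (g s - g t - (s - t) *\<^sub>R D))" by simp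
  also have "\<dots> \<le> norm (g s - g t) + norm (g s - g t - (s - t) *\<^sub>R D)" by (rule norm_triangle_ineq4)
  also have "\<dots> \<le> M * (\<delta>/2) + e * (\<delta>/2)"
    using L[of s] \<delta>(2)[of s] \<delta>(1) by (intro add_mono) (simp_all add: st)
  finally have "(\<delta>/2) * norm D \<le> (\<delta>/2) * (M + e)" by (simp add: algebra_simps)
  then show "norm D \<le> M + e" using \<delta>(1) by (simp only: mult_le_cancel_left_pos half_gt_zero_iff)
qed

text \<open>Fatou's theorem: the primitive of a bounded holomorphic function is Lipschitz up to the boundary, hence
  absolutely continuous there.\<close>

lemma bounded_holomorphic_radial_limits:
  assumes hol: "b holomorphic_on ball 0 1" and bd: "\<And>z. norm z < 1 \<Longrightarrow> norm (b z) \<le> M"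
  shows "\<exists>\<beta>. AE t in circ_measure. ((\<lambda>r. b (of_real r * cis t)) \<longlongrightarrow> \<beta> t) (at_left 1)"
proof -
  have M: "M \<ge> 0" using bd[of 0] by (simp add: order_trans[OF norm_ge_zero])
  obtain B where B: "\<And>z. z \<in> ball 0 1 \<Longrightarrow> (B has_field_derivative b z) (at z within ball 0 1)"
    using holomorphic_convex_primitive'[OF convex_ball open_ball hol] by blast
  have "M-lipschitz_on (ball 0 1) B"
  proof (rule lipschitz_onI[OF _ M])
    show "dist (B x) (B y) \<le> M * dist x y" if "x \<in> ball 0 1" "y \<in> ball 0 1" for x y
      unfolding dist_norm
      by (rule field_differentiable_bound[of "ball 0 1" B b]) (use that B bd in auto)
  qed
  \<comment> \<open>Extended continuously to the closed disc, the primitive is the Poisson integral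
    of its own boundary function \<open>g\<close>.\<close>
  then obtain E where E: "M-lipschitz_on (cball 0 1) E" "\<And>x. x \<in> ball 0 1 \<Longrightarrow> E x = B x"
    using lipschitz_extend_closure[of M "ball 0 1" B] closure_ball[of 1 "0::complex"] by auto
  have dE: "(E has_field_derivative b z) (at z)" if "norm z < 1" for z
  proof -
    have z: "z \<in> ball 0 1" using that by simp
    have "(B has_field_derivative b z) (at z)" using B[OF z] at_within_open[OF z open_ball] by simp
    then show ?thesis
      by (rule has_field_derivative_transform_within_open[of _ _ _ "ball 0 1"]) (use z E in auto)
  qed
  have Ec: "continuous_on (cball 0 1) E" by (rule lipschitz_on_continuous_on[OF E(1)])
  have Eh: "E holomorphic_on ball 0 1"
    unfolding holomorphic_on_def field_differentiable_def using dE has_field_derivative_at_within by fastforce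
  define g where "g = (\<lambda>t. E (cis t))"
  define \<phi> where "\<phi> = (\<lambda>t. vector_derivative g (at t))"
  define N where "N = {t. \<not> g differentiable (at t)}"
  have gl: "norm (g s - g t) \<le> M * \<bar>s - t\<bar>" for s t
  proof -
    have "norm (g s - g t) \<le> M * norm (cis s - cis t)"
      unfolding g_def dist_norm[symmetric] by (rule lipschitz_onD[OF E(1)]) auto
    also have "cis s - cis t = cis t * (cis (s - t) - 1)" by (simp add: right_diff_distrib cis_mult)
    also have "norm \<dots> \<le> \<bar>s - t\<bar>" using cis_minus_one_le[of "s - t"] by (simp add: norm_mult)
    finally show ?thesis using M by (simp add: mult_left_mono order_trans)
  qed
  have "abs_cont_on 0 (2*pi) (\<lambda>t::real. 0 :: complex)"
    unfolding abs_cont_on_def by (auto intro: exI[of _ 1])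
  then have ac: "abs_cont_on 0 (2*pi) g"
  proof (rule abs_cont_on_dominated[of _ _ _ 0 M])
    show "norm (g y - g x) \<le> 0 * norm (0 - 0 :: complex) + M * (y - x)" if "x \<le> y" for x y
      using gl[of y x] that by simp
  qed (use M in auto)
  have neg: "negligible {x \<in> {0<..<2*pi}. \<not> g differentiable (at x)}" by (rule abs_cont_on_complex_ae_derivative[OF ac])
  have dphi: "(g has_vector_derivative \<phi> t) (at t)" if "g differentiable (at t)" for t
    using that unfolding \<phi>_def by (simp add: vector_derivative_works)
  have "(\<phi> has_integral (g (2*pi) - g 0)) {0..2*pi}"
    by (rule abs_cont_on_fundamental_theorem[OF ac _ neg]) (use dphi in auto)
  then have m\<phi>: "\<phi> \<in> borel_measurable circ_measure"
    unfolding circ_measure_def by (auto intro: integrable_imp_measurable)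
  have "integrable circ_measure \<phi>"
  proof (rule Bochner_Integration.integrable_bound[where f = "\<lambda>_. M"])
    have "negligible ({x \<in> {0<..<2*pi}. \<not> g differentiable (at x)} \<union> {0, 2*pi})" using neg by (simp add: negligible_Un)
    from AE_circ_not_in_negligible[OF this] have "AE t in circ_measure. g differentiable (at t)"
      by (rule AE_mp) (auto intro!: AE_I2)
    then show "AE t in circ_measure. norm (\<phi> t) \<le> norm M"
      by eventually_elim (use lipschitz_derivative_bound[OF gl dphi] M in auto)
  qed (use m\<phi> in auto)
  then interpret periodic_ac g \<phi> N
    unfolding \<phi>_def N_def by (intro periodic_acI ac) (auto simp: g_def cis_mult[symmetric])
  \<comment> \<open>Inside the disc \<open>poisson g\<close> is holomorphic, so its
    \<open>wirt_zbar\<close> vanishes and the conjugate half of \<open>poisson_herglotz\<close>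
    drops out; half of \<open>2 * \<i> * z * b z\<close> remains. Radial limits of the Poisson
    integral thereby become radial limits of \<open>b\<close>.\<close>
  have key: "poisson \<phi> z = \<i> * z * b z" if z: "norm z < 1" for z
  proof -
    have pE: "E w = poisson g w" if "w \<in> ball 0 1" for w
      unfolding g_def by (rule poisson_of_holomorphic[OF Ec Eh, symmetric]) (use that in simp)
    have "(E has_derivative (\<lambda>h. b z * h)) (at z)" using dE[OF z] by (simp add: has_field_derivative_def)
    then have "(poisson g has_derivative (\<lambda>h. b z * h)) (at z)"
    proof (rule has_derivative_transform_within_open)
      show "z \<in> ball 0 1" using z by simp
    qed (auto simp: pE)
    note fd = frechet_derivative_at[OF this, symmetric]
    have w1: "wirt_z (poisson g) z = b z" unfolding wirt_z_def fd by (simp add: mult.commute[of "b z"])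
    have w2: "cnj (wirt_zbar (poisson g) z) = 0" unfolding wirt_zbar_def fd by (simp add: mult.commute[of "b z"])
    interpret c: periodic_ac "\<lambda>t. cnj (g t)" "\<lambda>t. cnj (\<phi> t)" N by (rule periodic_ac_cnj)
    have "herglotz \<phi> z = 2 * \<i> * z * b z" using wirt_z_herglotz[OF z] w1 by simp
    moreover have "herglotz (\<lambda>t. cnj (\<phi> t)) z = 0"
      using wirt_zbar_poisson[OF z] w2 c.herglotz_eq_cauchy_transform[OF z] by simp
    ultimately show ?thesis unfolding poisson_herglotz[OF phi_int z] by simp
  qed
  have "AE t in circ_measure. ((\<lambda>r. b (of_real r * cis t)) \<longlongrightarrow> \<phi> t / (\<i> * cis t)) (at_left 1)"
  proof (rule AE_mp[OF AE_circ_not_in_negligible[OF negl]], rule AE_I2, rule impI)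
    fix t assume t: "t \<in> space circ_measure" "t \<notin> N"
    have "((\<lambda>r. poisson \<phi> (of_real r * cis t)) \<longlongrightarrow> \<phi> t) (at_left 1)"
      by (rule poisson_radial_limit) (use t in auto)
    then have "((\<lambda>r. poisson \<phi> (of_real r * cis t) / (\<i> * of_real r * cis t)) \<longlongrightarrow> \<phi> t / (\<i> * of_real 1 * cis t)) (at_left 1)"
      by (intro tendsto_intros) auto
    then have "((\<lambda>r. poisson \<phi> (of_real r * cis t) / (\<i> * of_real r * cis t)) \<longlongrightarrow> \<phi> t / (\<i> * cis t)) (at_left 1)" by simp
    moreover have "\<forall>\<^sub>F r in at_left (1::real). r \<in> {0<..<1}"
      by (rule eventually_at_leftI[of 0]) auto
    then have "\<forall>\<^sub>F r in at_left 1. poisson \<phi> (of_real r * cis t) / (\<i> * of_real r * cis t) = b (of_real r * cis t)"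
    proof eventually_elim
      case (elim r)
      then have "poisson \<phi> (of_real r * cis t) = \<i> * (of_real r * cis t) * b (of_real r * cis t)"
        by (intro key) (simp add: norm_mult)
      then show ?case using elim by simp
    qed
    ultimately show "((\<lambda>r. b (of_real r * cis t)) \<longlongrightarrow> \<phi> t / (\<i> * cis t)) (at_left 1)"
      by (rule Lim_transform_eventually)
  qed
  then show ?thesis by (rule exI[of _ "\<lambda>t. \<phi> t / (\<i> * cis t)"])
qed

section \<open>Dilations and radial limits of Herglotz transforms\<close>

lemma holomorphic_dilate:
  fixes h :: "complex \<Rightarrow> complex"
  assumes h: "h holomorphic_on ball 0 1" and r: "0 \<le> r" "r < 1"
  shows "(\<lambda>w. h (of_real r * w)) holomorphic_on ball 0 1" and "continuous_on (cball 0 1) (\<lambda>w. h (of_real r * w))"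
proof -
  have sub: "(\<lambda>w::complex. of_real r * w) ` cball 0 1 \<subseteq> ball 0 1"
  proof
    fix y :: complex assume "y \<in> (\<lambda>w. of_real r * w) ` cball 0 1"
    then obtain w where w: "norm w \<le> 1" "y = of_real r * w" by auto
    have "r * norm w \<le> r" using w r by (simp add: mult_left_le)
    then show "y \<in> ball 0 1" using w r by (simp add: norm_mult)
  qed
  have "h \<circ> (\<lambda>w. of_real r * w) holomorphic_on ball 0 1"
  proof (rule holomorphic_on_compose_gen[OF _ h])
    show "(\<lambda>w::complex. of_real r * w) ` ball 0 1 \<subseteq> ball 0 1"
      using sub ball_subset_cball[of "0::complex" 1] by blast
  qed (intro holomorphic_intros)
  then show "(\<lambda>w. h (of_real r * w)) holomorphic_on ball 0 1" by (simp add: o_def)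
  show "continuous_on (cball 0 1) (\<lambda>w. h (of_real r * w))"
    by (rule continuous_on_compose2[OF holomorphic_on_imp_continuous_on[OF h] _ sub]) (intro continuous_intros)
qed

lemma continuous_on_circ_dilate:
  fixes h :: "complex \<Rightarrow> complex"
  assumes h: "h holomorphic_on ball 0 1" and r: "0 \<le> r" "r < 1"
  shows "continuous_on A (\<lambda>t. h (of_real r * cis t))"
  by (rule continuous_on_circ_compose[OF holomorphic_dilate(2)[OF h r]])

lemma mean_value_dilate:
  fixes h :: "complex \<Rightarrow> complex"
  assumes h: "h holomorphic_on ball 0 1" and r: "0 \<le> r" "r < 1"
  shows "(LINT t|circ_measure. h (of_real r * cis t)) = 2 * pi * h 0"
  using circ_mean_value[OF holomorphic_dilate(2,1)[OF h r]] by simp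

text \<open>A fixed sequence of radii tending to 1, for the tools that need sequences: Fatou's
  lemma, dominated convergence, measurability of limits. The summand 2 keeps \<open>rad 0\<close>
  positive.\<close>

definition rad :: "nat \<Rightarrow> real" where "rad n = 1 - 1 / (real n + 2)"

lemma rad_bounds: "0 < rad n" "rad n < 1"
  by (auto simp: rad_def field_simps)

lemma rad_at_left: "filterlim rad (at_left 1) sequentially"
proof -
  have "rad \<longlonglongrightarrow> 1"
    unfolding rad_def[abs_def] by real_asymp
  then show ?thesis unfolding filterlim_at using rad_bounds by (auto intro!: always_eventually simp: less_imp_neq)
qed

lemma herglotz_Re_nonneg:
  assumes phi: "integrable circ_measure \<phi>" and nonneg: "\<And>t. 0 \<le> (\<phi> t :: real)" and z: "norm z < 1"
  shows "Re (herglotz (\<lambda>t. of_real (\<phi> t)) z) = 1 / (2*pi) * (LINT t|circ_measure. Re (hker z t) * \<phi> t)"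
    and "0 \<le> Re (herglotz (\<lambda>t. of_real (\<phi> t)) z)"
proof -
  have i: "integrable circ_measure (\<lambda>t. hker z t * of_real (\<phi> t))"
    by (rule integrable_herglotz[OF _ z]) (use phi in auto)
  have "Re (LINT t|circ_measure. hker z t * of_real (\<phi> t)) = (LINT t|circ_measure. Re (hker z t * of_real (\<phi> t)))"
    by (rule integral_Re[OF i, symmetric])
  then show eq: "Re (herglotz (\<lambda>t. of_real (\<phi> t)) z) = 1 / (2*pi) * (LINT t|circ_measure. Re (hker z t) * \<phi> t)"
    by (simp add: herglotz_def)
  have "0 \<le> (LINT t|circ_measure. Re (hker z t) * \<phi> t)"
    by (rule integral_nonneg_AE, rule AE_I2, rule mult_nonneg_nonneg)
       (use poisson_kernel_pos[OF z] nonneg in \<open>auto simp: less_imp_le\<close>)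
  then show "0 \<le> Re (herglotz (\<lambda>t. of_real (\<phi> t)) z)" unfolding eq by simp
qed

text \<open>For \<open>\<phi> \<ge> 0\<close> the function \<open>1 / (1 + herglotz \<phi>)\<close> is bounded by 1, and the subharmonic lower bound for
  \<open>\<surd>(1 + herglotz \<phi>)\<close> shows that its radial limits vanish almost nowhere.\<close>

lemma herglotz_radial_limits_nonneg:
  assumes phi: "integrable circ_measure \<phi>" and nonneg: "\<And>t. 0 \<le> (\<phi> t :: real)"
  shows "\<exists>\<gamma>. AE t in circ_measure. ((\<lambda>r. herglotz (\<lambda>t. of_real (\<phi> t)) (of_real r * cis t)) \<longlongrightarrow> \<gamma> t) (at_left 1)"
proof -
  define G where "G = herglotz (\<lambda>t. of_real (\<phi> t))"
  have G: "G holomorphic_on ball 0 1" unfolding G_def by (rule holomorphic_herglotz) (use phi in auto)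
  have ReG: "Re (1 + G z) \<ge> 1" if "norm z < 1" for z
    using herglotz_Re_nonneg(2)[OF phi nonneg that] by (simp add: G_def)
  then have n1: "norm (1 + G z) \<ge> 1" if "norm z < 1" for z
    using that complex_Re_le_cmod order_trans by blast
  then have nz: "1 + G z \<noteq> 0" if "norm z < 1" for z using that by fastforce
  define b where "b = (\<lambda>z. 1 / (1 + G z))"
  have "b holomorphic_on ball 0 1" unfolding b_def by (intro holomorphic_intros G) (use nz in auto)
  moreover have "norm (b z) \<le> 1" if "norm z < 1" for z
  proof -
    have "1 / norm (1 + G z) \<le> 1 / 1" using n1[OF that] by (intro frac_le) auto
    then show ?thesis by (simp add: b_def norm_divide)
  qed
  ultimately obtain \<beta> where \<beta>: "AE t in circ_measure. ((\<lambda>r. b (of_real r * cis t)) \<longlongrightarrow> \<beta> t) (at_left 1)"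
    using bounded_holomorphic_radial_limits[of b 1] by blast
  define h where "h = (\<lambda>z. csqrt (1 + G z))"
  have h: "h holomorphic_on ball 0 1"
  proof -
    have "1 + G z \<notin> \<real>\<^sub>\<le>\<^sub>0" if "norm z < 1" for z
      using ReG[OF that] by (auto simp: complex_nonpos_Reals_iff)
    then show ?thesis unfolding h_def by (intro holomorphic_intros G) auto
  qed
  \<comment> \<open>\<open>1 + G\<close> has positive real part, so its square root lies in the
    sector where the imaginary part does not exceed the real part in modulus. The mean of
    \<open>norm (h z)\<close> over circles is thereby controlled by \<open>Re (h 0)\<close>.\<close>
  have hRe: "norm (h z) \<le> 2 * Re (h z)" if z: "norm z < 1" for z
  proof -
    have "Re ((h z)\<^sup>2) \<ge> 0" using ReG[OF z] by (simp add: h_def)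
    then have "(Im (h z))\<^sup>2 \<le> (Re (h z))\<^sup>2" by (simp add: Re_power2)
    moreover have "0 \<le> (Re (h z))\<^sup>2" by simp
    moreover have four: "(2::real)\<^sup>2 = 4" by simp
    ultimately have "(norm (h z))\<^sup>2 \<le> (2 * Re (h z))\<^sup>2" unfolding cmod_power2 power_mult_distrib four by linarith
    moreover have "0 \<le> Re (h z)" unfolding h_def using csqrt_principal[of "1 + G z"] by auto
    then have "0 \<le> 2 * Re (h z)" by simp
    ultimately show ?thesis by (intro power2_le_imp_le[of "norm (h z)" "2 * Re (h z)"])
  qed
  define H where "H = (\<lambda>n t. norm (h (of_real (rad n) * cis t)))"
  have zn: "norm (of_real (rad n) * cis t) < 1" for n t using rad_bounds[of n] by (simp add: norm_mult)
  have cH: "continuous_on {0..2*pi} (\<lambda>t. h (of_real (rad n) * cis t))" for n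
    by (rule continuous_on_circ_dilate[OF h]) (use rad_bounds[of n] in auto)
  have mH: "H n \<in> borel_measurable circ_measure" for n
    unfolding H_def by (intro measurable_circ_continuous continuous_intros cH)
  have intH: "(\<integral>\<^sup>+t. ennreal (H n t) \<partial>circ_measure) \<le> ennreal (4 * pi * Re (h 0))" for n
  proof -
    have i1: "integrable circ_measure (H n)" unfolding H_def by (intro integrable_circ_continuous continuous_intros cH)
    have i2: "integrable circ_measure (\<lambda>t. h (of_real (rad n) * cis t))" by (intro integrable_circ_continuous cH)
    have "(\<integral>\<^sup>+t. ennreal (H n t) \<partial>circ_measure) = ennreal (LINT t|circ_measure. H n t)"
      by (rule nn_integral_eq_integral[OF i1]) (simp add: H_def)
    also have "(LINT t|circ_measure. H n t) \<le> (LINT t|circ_measure. 2 * Re (h (of_real (rad n) * cis t)))"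
      by (rule integral_mono[OF i1]) (use i2 hRe zn in \<open>auto simp: H_def\<close>)
    also have "\<dots> = 2 * Re (LINT t|circ_measure. h (of_real (rad n) * cis t))"
      using integral_Re[OF i2] by simp
    also have "\<dots> = 4 * pi * Re (h 0)"
      using mean_value_dilate[OF h, of "rad n"] rad_bounds[of n] by simp
    finally show ?thesis by (simp add: ennreal_leI)
  qed
  have "(\<integral>\<^sup>+t. liminf (\<lambda>n. ennreal (H n t)) \<partial>circ_measure) \<le> liminf (\<lambda>n. \<integral>\<^sup>+t. ennreal (H n t) \<partial>circ_measure)"
    by (rule nn_integral_liminf) (use mH in measurable)
  also have "\<dots> \<le> ennreal (4 * pi * Re (h 0))"
    by (rule Liminf_le) (use intH in auto)
  finally have "(\<integral>\<^sup>+t. liminf (\<lambda>n. ennreal (H n t)) \<partial>circ_measure) \<noteq> \<infinity>"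
    by (metis ennreal_neq_top infinity_ennreal_def top.extremum_unique)
  then have fin: "AE t in circ_measure. liminf (\<lambda>n. ennreal (H n t)) \<noteq> \<infinity>"
    by (rule nn_integral_PInf_AE[rotated]) (use mH in measurable)
  have "AE t in circ_measure. ((\<lambda>r. G (of_real r * cis t)) \<longlongrightarrow> 1 / \<beta> t - 1) (at_left 1)"
    using \<beta> fin
  proof eventually_elim
    case (elim t)
    \<comment> \<open>A zero limit of \<open>b\<close> would send \<open>norm h\<close>, which is
      the square root of \<open>norm (1 + G)\<close>, to infinity along \<open>rad\<close>;
      \<open>fin\<close>, which came from Fatou's lemma, excludes this.\<close>
    have b0: "\<beta> t \<noteq> 0"
    proof
      assume "\<beta> t = 0"
      then have lim0: "(\<lambda>n. b (of_real (rad n) * cis t)) \<longlonglongrightarrow> 0"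
        using filterlim_compose[OF elim(1) rad_at_left] by simp
      have "filterlim (\<lambda>n. norm (1 + G (of_real (rad n) * cis t))) at_top sequentially"
      proof -
        have "filterlim (\<lambda>n. inverse (b (of_real (rad n) * cis t))) at_infinity sequentially"
          by (rule filterlim_compose[OF filterlim_inverse_at_infinity])
             (use lim0 nz[OF zn] in \<open>auto simp: filterlim_at b_def intro!: always_eventually\<close>)
        then show ?thesis by (simp add: b_def filterlim_at_infinity_conv_norm_at_top)
      qed
      then have "filterlim (\<lambda>n. sqrt (norm (1 + G (of_real (rad n) * cis t)))) at_top sequentially"
        by (rule filterlim_compose[OF sqrt_at_top])
      then have "filterlim (\<lambda>n. H n t) at_top sequentially" by (simp add: H_def h_def)
      then have ge: "ennreal (real k) \<le> liminf (\<lambda>n. ennreal (H n t))" for k :: nat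
        unfolding filterlim_at_top by (intro Liminf_bounded) (auto elim!: allE[of _ "real k"] eventually_mono intro: ennreal_leI)
      obtain k :: nat where "liminf (\<lambda>n. ennreal (H n t)) < of_nat k"
        using ennreal_Ex_less_of_nat[of "liminf (\<lambda>n. ennreal (H n t))"] elim(2) by (auto simp: less_top)
      with ge[of k] show False by (simp add: ennreal_of_nat_eq_real_of_nat)
    qed
    have "((\<lambda>r. 1 / b (of_real r * cis t) - 1) \<longlongrightarrow> 1 / \<beta> t - 1) (at_left 1)"
      by (intro tendsto_intros elim(1) b0)
    then show ?case
      by (simp add: b_def)
  qed
  then show ?thesis unfolding G_def by (rule exI[of _ "\<lambda>t. 1 / \<beta> t - 1"])
qed

lemma herglotz_radial_limits:
  assumes phi: "integrable circ_measure \<phi>"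
  shows "\<exists>\<gamma>. AE t in circ_measure. ((\<lambda>r. herglotz \<phi> (of_real r * cis t)) \<longlongrightarrow> \<gamma> t) (at_left 1)"
proof -
  define p where "p = (\<lambda>u::real \<Rightarrow> real. \<lambda>t. max 0 (u t))"
  have real: "\<exists>\<gamma>. AE t in circ_measure. ((\<lambda>r. herglotz (\<lambda>t. of_real (u t)) (of_real r * cis t)) \<longlongrightarrow> \<gamma> t) (at_left 1)"
    if u: "integrable circ_measure u" for u :: "real \<Rightarrow> real"
  proof -
    have i: "integrable circ_measure (\<lambda>t. max 0 (u t))" "integrable circ_measure (\<lambda>t. max 0 (- u t))" using u by auto
    obtain \<gamma>1 \<gamma>2 where
      1: "AE t in circ_measure. ((\<lambda>r. herglotz (\<lambda>t. of_real (max 0 (u t))) (of_real r * cis t)) \<longlongrightarrow> \<gamma>1 t) (at_left 1)" and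
      2: "AE t in circ_measure. ((\<lambda>r. herglotz (\<lambda>t. of_real (max 0 (- u t))) (of_real r * cis t)) \<longlongrightarrow> \<gamma>2 t) (at_left 1)"
      using herglotz_radial_limits_nonneg[OF i(1)] herglotz_radial_limits_nonneg[OF i(2)] by auto
    have "AE t in circ_measure. ((\<lambda>r. herglotz (\<lambda>t. of_real (u t)) (of_real r * cis t)) \<longlongrightarrow> \<gamma>1 t - \<gamma>2 t) (at_left 1)"
      using 1 2
    proof eventually_elim
      case (elim t)
      have "((\<lambda>r. herglotz (\<lambda>t. of_real (max 0 (u t))) (of_real r * cis t) - herglotz (\<lambda>t. of_real (max 0 (- u t))) (of_real r * cis t)) \<longlongrightarrow> \<gamma>1 t - \<gamma>2 t) (at_left 1)"
        by (rule tendsto_diff[OF elim])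
      moreover have "\<forall>\<^sub>F r in at_left (1::real). r \<in> {0<..<1}"
        by (rule eventually_at_leftI[of 0]) auto
      then have "\<forall>\<^sub>F r in at_left 1. herglotz (\<lambda>t. of_real (max 0 (u t))) (of_real r * cis t) - herglotz (\<lambda>t. of_real (max 0 (- u t))) (of_real r * cis t)
           = herglotz (\<lambda>t. of_real (u t)) (of_real r * cis t)"
      proof eventually_elim
        case (elim r)
        have m: "complex_of_real (max 0 x) - of_real (max 0 (- x)) = of_real x" for x by (simp add: max_def)
        show ?case
          by (subst herglotz_diff[symmetric]) (use i elim in \<open>simp_all add: m norm_mult\<close>)
      qed
      ultimately show ?case by (rule Lim_transform_eventually)
    qed
    then show ?thesis by (rule exI[of _ "\<lambda>t. \<gamma>1 t - \<gamma>2 t"])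
  qed
  have i: "integrable circ_measure (\<lambda>t. Re (\<phi> t))" "integrable circ_measure (\<lambda>t. Im (\<phi> t))"
    using phi by auto
  obtain \<gamma>1 \<gamma>2 where
    1: "AE t in circ_measure. ((\<lambda>r. herglotz (\<lambda>t. of_real (Re (\<phi> t))) (of_real r * cis t)) \<longlongrightarrow> \<gamma>1 t) (at_left 1)" and
    2: "AE t in circ_measure. ((\<lambda>r. herglotz (\<lambda>t. of_real (Im (\<phi> t))) (of_real r * cis t)) \<longlongrightarrow> \<gamma>2 t) (at_left 1)"
    using real[OF i(1)] real[OF i(2)] by auto
  have "AE t in circ_measure. ((\<lambda>r. herglotz \<phi> (of_real r * cis t)) \<longlongrightarrow> \<gamma>1 t + \<i> * \<gamma>2 t) (at_left 1)"
    using 1 2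
  proof eventually_elim
    case (elim t)
    have "((\<lambda>r. herglotz (\<lambda>t. of_real (Re (\<phi> t))) (of_real r * cis t) + \<i> * herglotz (\<lambda>t. of_real (Im (\<phi> t))) (of_real r * cis t)) \<longlongrightarrow> \<gamma>1 t + \<i> * \<gamma>2 t) (at_left 1)"
      by (intro tendsto_intros elim)
    moreover have "\<forall>\<^sub>F r in at_left (1::real). r \<in> {0<..<1}"
      by (rule eventually_at_leftI[of 0]) auto
    then have "\<forall>\<^sub>F r in at_left 1. herglotz (\<lambda>t. of_real (Re (\<phi> t))) (of_real r * cis t) + \<i> * herglotz (\<lambda>t. of_real (Im (\<phi> t))) (of_real r * cis t)
         = herglotz \<phi> (of_real r * cis t)"
    proof eventually_elim
      case (elim r)
      have "\<phi> = (\<lambda>t. of_real (Re (\<phi> t)) + \<i> * of_real (Im (\<phi> t)))" by (simp add: fun_eq_iff complex_eq_iff)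
      then have "herglotz \<phi> (of_real r * cis t) = herglotz (\<lambda>t. of_real (Re (\<phi> t)) + \<i> * of_real (Im (\<phi> t))) (of_real r * cis t)" by simp
      also have "\<dots> = herglotz (\<lambda>t. of_real (Re (\<phi> t))) (of_real r * cis t) + \<i> * herglotz (\<lambda>t. of_real (Im (\<phi> t))) (of_real r * cis t)"
        by (subst herglotz_add) (use i elim in \<open>auto simp: norm_mult herglotz_cmult\<close>)
      finally show ?case ..
    qed
    ultimately show ?case by (rule Lim_transform_eventually)
  qed
  then show ?thesis by (rule exI[of _ "\<lambda>t. \<gamma>1 t + \<i> * \<gamma>2 t"])
qed

text \<open>The radial limit exists, and the difference to the truncated integral with
  \<open>\<epsilon> = 1 - r\<close> tends to 0. So the truncations converge almost everywhere, and
  there \<open>Lim\<close> denotes a genuine limit.\<close>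

lemma (in periodic_ac) herglotz_radial_limit_hilbert:
  "AE t in circ_measure. ((\<lambda>r. herglotz \<phi> (of_real r * cis t)) \<longlongrightarrow> \<phi> t + \<i> * hilbert \<phi> t) (at_left 1)"
proof -
  obtain \<gamma> where "AE t in circ_measure. ((\<lambda>r. herglotz \<phi> (of_real r * cis t)) \<longlongrightarrow> \<gamma> t) (at_left 1)"
    using herglotz_radial_limits[OF phi_int] by blast
  moreover have "AE t in circ_measure. t \<in> {0..2*pi}" by (rule AE_I2) simp
  ultimately show ?thesis using AE_circ_not_in_negligible[OF negl]
  proof eventually_elim
    case (elim t)
    have "((\<lambda>r. -\<i> * (herglotz \<phi> (of_real r * cis t) - (herglotz \<phi> (of_real r * cis t) - (\<phi> t + \<i> * hilbert_trunc \<phi> t (1 - r))) - \<phi> t)) \<longlongrightarrow> -\<i> * (\<gamma> t - 0 - \<phi> t)) (at_left 1)"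
      by (intro tendsto_intros elim(1) herglotz_minus_truncated_hilbert_tendsto) (use elim in auto)
    then have lim: "((\<lambda>r. hilbert_trunc \<phi> t (1 - r)) \<longlongrightarrow> -\<i> * (\<gamma> t - \<phi> t)) (at_left 1)" by (simp add: algebra_simps)
    have "filterlim (\<lambda>\<epsilon>::real. 1 - \<epsilon>) (at_left 1) (at_right 0)"
      unfolding filterlim_at by (auto intro!: tendsto_eq_intros eventually_at_rightI[of 0 1])
    from filterlim_compose[OF lim this] have "(hilbert_trunc \<phi> t \<longlongrightarrow> -\<i> * (\<gamma> t - \<phi> t)) (at_right 0)" by simp
    then have "hilbert \<phi> t = -\<i> * (\<gamma> t - \<phi> t)"
      unfolding hilbert_eq_Lim by (intro tendsto_Lim) auto
    then have "\<i> * hilbert \<phi> t = \<gamma> t - \<phi> t" by simp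
    then have "\<gamma> t = \<phi> t + \<i> * hilbert \<phi> t" by simp
    then show ?case using elim(1) by simp
  qed
qed

lemma (in periodic_ac) measurable_hilbert: "hilbert \<phi> \<in> borel_measurable circ_measure"
proof -
  have "(\<lambda>t. \<phi> t + \<i> * hilbert \<phi> t) \<in> borel_measurable circ_measure"
  proof (rule measurable_circ_AE_limit)
    show "(\<lambda>t. herglotz \<phi> (of_real (rad n) * cis t)) \<in> borel_measurable circ_measure" for n
      by (intro measurable_circ_continuous continuous_on_circ_dilate holomorphic_herglotz phi_int)
         (use rad_bounds[of n] in auto)
    show "AE t in circ_measure. (\<lambda>n. herglotz \<phi> (of_real (rad n) * cis t)) \<longlonglongrightarrow> \<phi> t + \<i> * hilbert \<phi> t"
      using herglotz_radial_limit_hilbert by eventually_elim (rule filterlim_compose[OF _ rad_at_left])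
  qed
  then have "(\<lambda>t. -\<i> * ((\<phi> t + \<i> * hilbert \<phi> t) - \<phi> t)) \<in> borel_measurable circ_measure"
    using borel_measurable_integrable[OF phi_int] by measurable
  then show ?thesis by simp
qed



section \<open>The inequality of M. Riesz\<close>

text \<open>After scaling to \<open>a = 1\<close> this is the weighted mean inequality between 1 and
  \<open>y powr p\<close>, a case of the convexity of \<open>exp\<close>.\<close>

lemma powr_tangent_le:
  fixes x a p :: real
  assumes x: "0 \<le> x" and a: "0 < a" and p: "1 \<le> p"
  shows "a powr p + p * a powr (p - 1) * (x - a) \<le> x powr p"
proof (cases "x = 0")
  case True
  have "a powr p = a powr (p - 1) * a" using a by (simp add: powr_diff)
  then have "a powr p + p * a powr (p - 1) * (x - a) = (1 - p) * (a powr (p - 1) * a)" using True by (simp add: algebra_simps)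
  also have "\<dots> \<le> 0" using p a by (intro mult_nonpos_nonneg) auto
  finally show ?thesis using True p by simp
next
  case False
  then have x: "x > 0" using x by simp
  define y where "y = x / a"
  have y: "y > 0" using x a by (simp add: y_def)
  define w where "w = y powr p"
  have w: "w > 0" using y by (simp add: w_def)
  have "exp ((1 - 1/p) *\<^sub>R 0 + (1/p) *\<^sub>R ln w) \<le> (1 - 1/p) * exp 0 + (1/p) * exp (ln w)"
    by (rule convex_onD[OF exp_convex]) (use p in auto)
  moreover have "exp ((1/p) * ln w) = y" using y p by (simp add: w_def ln_powr)
  ultimately have "y \<le> (1 - 1/p) + (1/p) * w" using w by simp
  then have "p * y \<le> p * ((1 - 1/p) + (1/p) * w)" using p by (intro mult_left_mono) auto
  also have "\<dots> = p - 1 + w" using p by (simp add: field_simps)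
  finally have "1 + p * (y - 1) \<le> y powr p" by (simp add: w_def algebra_simps)
  then have "a powr p * (1 + p * (y - 1)) \<le> a powr p * y powr p" by (intro mult_left_mono) auto
  moreover have "a powr p * y powr p = x powr p" using a x by (simp add: y_def powr_divide)
  moreover have "a powr p = a powr (p - 1) * a" using a by (simp add: powr_diff)
  then have "a powr p * (1 + p * (y - 1)) = a powr p + p * a powr (p - 1) * (x - a)"
    using a by (simp add: y_def field_simps)
  ultimately show ?thesis by simp
qed

lemma powr_add_le:
  fixes x y p :: real
  assumes "0 \<le> x" "0 \<le> y" "0 \<le> p"
  shows "(x + y) powr p \<le> 2 powr p * (x powr p + y powr p)"
proof -
  have "(x + y) powr p \<le> (2 * max x y) powr p" using assms by (intro powr_mono2) auto
  also have "\<dots> = 2 powr p * max x y powr p" using assms by (simp add: powr_mult)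
  also have "max x y powr p \<le> x powr p + y powr p" by (simp add: max_def)
  finally show ?thesis by simp
qed

text \<open>The measure is finite and \<open>x \<le> 1 + x powr p\<close> for nonnegative
  \<open>x\<close>.\<close>

lemma integrable_powr_imp_integrable:
  fixes u :: "real \<Rightarrow> 'a::euclidean_space"
  assumes m: "u \<in> borel_measurable circ_measure" and i: "integrable circ_measure (\<lambda>t. norm (u t) powr p)" and p: "1 \<le> p"
  shows "integrable circ_measure u"
proof (rule Bochner_Integration.integrable_bound[where f = "\<lambda>t. 1 + norm (u t) powr p"])
  show "integrable circ_measure (\<lambda>t. 1 + norm (u t) powr p)" using i by (intro Bochner_Integration.integrable_add) auto
  show "AE t in circ_measure. norm (u t) \<le> norm (1 + norm (u t) powr p)"
  proof (rule AE_I2)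
    fix t
    show "norm (u t) \<le> norm (1 + norm (u t) powr p)"
    proof (cases "norm (u t) \<le> 1")
      case True
      then show ?thesis by simp (metis add_increasing2 powr_ge_zero)
    next
      case False
      then have "norm (u t) powr 1 \<le> norm (u t) powr p" using p by (intro powr_mono) auto
      then show ?thesis using False by simp
    qed
  qed
qed (rule m)

text \<open>Jensen's inequality for the probability measure given by the Poisson kernel: integrate
  the tangent inequality at the mean \<open>a\<close>. A vanishing mean is treated apart because the
  tangent needs \<open>a > 0\<close>.\<close>

lemma poisson_Jensen:
  fixes v :: "real \<Rightarrow> real"
  assumes v: "integrable circ_measure v" "\<And>t. 0 \<le> v t" and vp: "integrable circ_measure (\<lambda>t. v t powr p)"
    and p: "1 \<le> p" and z: "norm z < 1"
  shows "Re (herglotz (\<lambda>t. of_real (v t)) z) powr p \<le> Re (herglotz (\<lambda>t. of_real (v t powr p)) z)"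
proof -
  define a where "a = Re (herglotz (\<lambda>t. of_real (v t)) z)"
  have a0: "0 \<le> a" unfolding a_def by (rule herglotz_Re_nonneg(2)[OF v z])
  have eq: "Re (herglotz (\<lambda>t. of_real (v t powr p)) z) = 1 / (2*pi) * (LINT t|circ_measure. Re (hker z t) * v t powr p)"
    by (rule herglotz_Re_nonneg(1)[OF vp _ z]) simp
  have aeq: "a = 1 / (2*pi) * (LINT t|circ_measure. Re (hker z t) * v t)"
    unfolding a_def by (rule herglotz_Re_nonneg(1)[OF v z])
  show ?thesis
  proof (cases "a = 0")
    case True
    then show ?thesis using herglotz_Re_nonneg(2)[OF vp _ z] p unfolding a_def by simp
  next
    case False
    then have a: "a > 0" using a0 by simp
    have ik: "integrable circ_measure (\<lambda>t. Re (hker z t))"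
      by (intro integrable_circ_continuous continuous_intros continuous_on_herglotz_kernel[OF z])
    have i1: "integrable circ_measure (\<lambda>t. Re (hker z t) * v t)" by (rule integrable_poisson_real[OF v(1) z])
    have i2: "integrable circ_measure (\<lambda>t. Re (hker z t) * v t powr p)" by (rule integrable_poisson_real[OF vp z])
    define c where "c = p * a powr (p - 1)"
    have "(LINT t|circ_measure. (a powr p - c * a) * Re (hker z t) + c * (Re (hker z t) * v t)) \<le> (LINT t|circ_measure. Re (hker z t) * v t powr p)"
    proof (rule integral_mono)
      show "integrable circ_measure (\<lambda>t. (a powr p - c * a) * Re (hker z t) + c * (Re (hker z t) * v t))" using ik i1 by auto
      fix t
      have "Re (hker z t) * (a powr p + c * (v t - a)) \<le> Re (hker z t) * v t powr p"
        using powr_tangent_le[OF v(2) a p, of t] poisson_kernel_pos[OF z, of t] unfolding c_def by (intro mult_left_mono) auto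
      then show "(a powr p - c * a) * Re (hker z t) + c * (Re (hker z t) * v t) \<le> Re (hker z t) * v t powr p" by (simp add: algebra_simps)
    qed (rule i2)
    also have "(LINT t|circ_measure. (a powr p - c * a) * Re (hker z t) + c * (Re (hker z t) * v t)) = (a powr p - c * a) * (2 * pi) + c * (2 * pi * a)"
      using ik i1 integral_poisson_kernel[OF z] aeq by simp
    finally have "2 * pi * a powr p \<le> (LINT t|circ_measure. Re (hker z t) * v t powr p)" by (simp add: algebra_simps)
    then show ?thesis unfolding eq a_def[symmetric] by (simp add: field_simps)
  qed
qed

lemma integral_circ_herglotz:
  assumes phi: "integrable circ_measure \<phi>" and r: "0 \<le> r" "r < 1"
  shows "(LINT t|circ_measure. herglotz \<phi> (of_real r * cis t)) = (LINT t|circ_measure. \<phi> t)"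
proof -
  have "herglotz \<phi> 0 = 1 / (2*pi) * (LINT t|circ_measure. \<phi> t)" by (simp add: herglotz_def hker_def)
  then show ?thesis using mean_value_dilate[OF holomorphic_herglotz[OF phi] r] by simp
qed

lemma continuous_on_circ_herglotz:
  "integrable circ_measure \<phi> \<Longrightarrow> 0 \<le> r \<Longrightarrow> r < 1 \<Longrightarrow> continuous_on A (\<lambda>t. herglotz \<phi> (of_real r * cis t))"
  by (rule continuous_on_circ_dilate[OF holomorphic_herglotz])

text \<open>No Fubini is needed: the mean of the harmonic function \<open>P[v\<^sup>p]\<close> over a circle is its value at the centre.\<close>

lemma poisson_Lp_bound_nonneg:
  fixes v :: "real \<Rightarrow> real"
  assumes v: "integrable circ_measure v" "\<And>t. 0 \<le> v t" and vp: "integrable circ_measure (\<lambda>t. v t powr p)"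
    and p: "1 \<le> p" and r: "0 \<le> r" "r < 1"
  shows "(LINT t|circ_measure. Re (herglotz (\<lambda>t. of_real (v t)) (of_real r * cis t)) powr p) \<le> (LINT t|circ_measure. v t powr p)"
proof -
  have z: "norm (of_real r * cis t) < 1" for t using r by (simp add: norm_mult)
  have iv: "integrable circ_measure (\<lambda>t. complex_of_real (v t))" "integrable circ_measure (\<lambda>t. complex_of_real (v t powr p))"
    using v vp by auto
  have i2: "integrable circ_measure (\<lambda>t. herglotz (\<lambda>t. of_real (v t powr p)) (of_real r * cis t))"
    by (intro integrable_circ_continuous continuous_on_circ_herglotz iv r)
  have "(LINT t|circ_measure. Re (herglotz (\<lambda>t. of_real (v t)) (of_real r * cis t)) powr p)
     \<le> (LINT t|circ_measure. Re (herglotz (\<lambda>t. of_real (v t powr p)) (of_real r * cis t)))"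
  proof (rule integral_mono)
    show "integrable circ_measure (\<lambda>t. Re (herglotz (\<lambda>t. of_real (v t)) (of_real r * cis t)) powr p)"
      by (intro integrable_circ_continuous continuous_on_powr' continuous_intros continuous_on_circ_herglotz iv r)
         (use herglotz_Re_nonneg(2)[OF v z] p in auto)
    show "integrable circ_measure (\<lambda>t. Re (herglotz (\<lambda>t. of_real (v t powr p)) (of_real r * cis t)))" using i2 by auto
  qed (rule poisson_Jensen[OF v vp p z])
  also have "\<dots> = Re (LINT t|circ_measure. herglotz (\<lambda>t. of_real (v t powr p)) (of_real r * cis t))"
    by (rule integral_Re[OF i2])
  also have "\<dots> = (LINT t|circ_measure. v t powr p)"
    unfolding integral_circ_herglotz[OF iv(2) r] by simp
  finally show ?thesis .
qed

lemma poisson_norm_le: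
  fixes \<phi> :: "real \<Rightarrow> complex"
  assumes phi: "integrable circ_measure \<phi>" and z: "norm z < 1"
  shows "norm (poisson \<phi> z) \<le> Re (herglotz (\<lambda>t. of_real (norm (\<phi> t))) z)"
proof -
  have "norm (LINT t|circ_measure. of_real (Re (hker z t)) * \<phi> t) \<le> (LINT t|circ_measure. Re (hker z t) * norm (\<phi> t))"
  proof (rule Bochner_Integration.integral_norm_bound_integral)
    show "integrable circ_measure (\<lambda>t. Re (hker z t) * norm (\<phi> t))" by (rule integrable_poisson_real[OF _ z]) (use phi in auto)
    show "norm (of_real (Re (hker z t)) * \<phi> t) \<le> Re (hker z t) * norm (\<phi> t)" for t
      using poisson_kernel_pos[OF z, of t] by (simp add: norm_mult)
  qed (rule integrable_poisson[OF phi z])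
  then have "1 / (2*pi) * norm (LINT t|circ_measure. of_real (Re (hker z t)) * \<phi> t) \<le> 1 / (2*pi) * (LINT t|circ_measure. Re (hker z t) * norm (\<phi> t))"
    by (rule mult_left_mono) simp
  also have "\<dots> = Re (herglotz (\<lambda>t. of_real (norm (\<phi> t))) z)"
    by (rule herglotz_Re_nonneg(1)[symmetric, OF _ _ z]) (use phi in auto)
  finally show ?thesis unfolding poisson_eq[OF z] norm_mult norm_of_real by simp
qed

lemma continuous_on_circ_poisson:
  fixes \<phi> :: "real \<Rightarrow> complex"
  assumes phi: "integrable circ_measure \<phi>" and r: "0 \<le> r" "r < 1"
  shows "continuous_on A (\<lambda>t. poisson \<phi> (of_real r * cis t))"
proof -
  have "continuous_on A (\<lambda>t. (herglotz \<phi> (of_real r * cis t) + cnj (herglotz (\<lambda>t. cnj (\<phi> t)) (of_real r * cis t))) / 2)"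
    by (intro continuous_intros continuous_on_circ_herglotz phi integrable_cnj_circ r) auto
  then show ?thesis using r by (subst poisson_herglotz[OF phi]) (auto simp: norm_mult)
qed

lemma poisson_Lp_bound:
  fixes \<phi> :: "real \<Rightarrow> complex"
  assumes phi: "integrable circ_measure \<phi>" and phip: "integrable circ_measure (\<lambda>t. norm (\<phi> t) powr p)"
    and p: "1 \<le> p" and r: "0 \<le> r" "r < 1"
  shows "(LINT t|circ_measure. norm (poisson \<phi> (of_real r * cis t)) powr p) \<le> (LINT t|circ_measure. norm (\<phi> t) powr p)"
proof -
  have z: "norm (of_real r * cis t) < 1" for t using r by (simp add: norm_mult)
  have n: "integrable circ_measure (\<lambda>t. norm (\<phi> t))" using phi by auto
  then have nc: "integrable circ_measure (\<lambda>t. complex_of_real (norm (\<phi> t)))" by auto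
  have "(LINT t|circ_measure. norm (poisson \<phi> (of_real r * cis t)) powr p) \<le> (LINT t|circ_measure. Re (herglotz (\<lambda>t. of_real (norm (\<phi> t))) (of_real r * cis t)) powr p)"
  proof (rule integral_mono)
    show "integrable circ_measure (\<lambda>t. norm (poisson \<phi> (of_real r * cis t)) powr p)"
      by (intro integrable_circ_continuous continuous_on_powr' continuous_intros continuous_on_circ_poisson phi r) (use p in auto)
    show "integrable circ_measure (\<lambda>t. Re (herglotz (\<lambda>t. of_real (norm (\<phi> t))) (of_real r * cis t)) powr p)"
      by (intro integrable_circ_continuous continuous_on_powr' continuous_intros continuous_on_circ_herglotz nc r)
         (use herglotz_Re_nonneg(2)[OF n _ z] p in auto)
    show "norm (poisson \<phi> (of_real r * cis t)) powr p \<le> Re (herglotz (\<lambda>t. of_real (norm (\<phi> t))) (of_real r * cis t)) powr p" for t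
      using poisson_norm_le[OF phi z] p by (intro powr_mono2) auto
  qed
  also have "\<dots> \<le> (LINT t|circ_measure. norm (\<phi> t) powr p)"
    by (rule poisson_Lp_bound_nonneg[OF n _ phip p r]) simp
  finally show ?thesis .
qed

text \<open>Near the imaginary axis the left side is absorbed by the last term because \<open>cos (p\<pi>/2) < 0\<close>.\<close>

lemma powr_half_plane_inequality:
  assumes p: "1 < p" "p \<le> 2"
  shows "\<exists>A\<ge>0. \<exists>B\<ge>0. \<forall>w::complex. Re w > 0 \<longrightarrow> norm w powr p \<le> A * Re w powr p - B * Re (w powr of_real p)"
proof -
  define k where "k = cos (p * (pi / 2))"
  have k: "k < 0"
  proof -
    have "cos (p * (pi/2)) = - sin (p * (pi/2) - pi/2)" by (simp add: sin_diff)
    moreover have "sin (p * (pi/2) - pi/2) > 0" using p by (intro sin_gt_zero) (auto simp: field_simps)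
    ultimately show ?thesis by (simp add: k_def)
  qed
  \<comment> \<open>Normalised so that \<open>- B * cos (p * \<theta>)\<close> equals 2 at pi/2 and
    therefore stays above 1 nearby.\<close>
  define B where "B = 2 / (- k)"
  have B: "B > 0" using k by (simp add: B_def)
  have "isCont (\<lambda>\<theta>. - B * cos (p * \<theta>)) (pi/2)" by (intro continuous_intros)
  moreover have "- B * cos (p * (pi/2)) = 2" unfolding k_def[symmetric] using k by (simp add: B_def)
  ultimately have "\<exists>d>0. \<forall>\<theta>. \<bar>\<theta> - pi/2\<bar> < d \<longrightarrow> \<bar>- B * cos (p * \<theta>) - 2\<bar> < 1"
    unfolding isCont_def LIM_eq real_norm_def by (metis abs_zero diff_self zero_less_one)
  then obtain d where d: "d > 0" "\<And>\<theta>. \<bar>\<theta> - pi/2\<bar> < d \<Longrightarrow> \<bar>- B * cos (p * \<theta>) - 2\<bar> < 1" by blast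
  define d' where "d' = min d (pi/2)"
  have d': "0 < d'" "d' \<le> d" "d' \<le> pi/2" using d by (auto simp: d'_def)
  define c where "c = cos (pi/2 - d')"
  have c: "c > 0" unfolding c_def using d' by (intro cos_gt_zero_pi) auto
  \<comment> \<open>Away from pi/2 the cosine is at least \<open>c\<close>; the numerator
    \<open>1 + B\<close> compensates the worst value of the subtracted term.\<close>
  define A where "A = (1 + B) / c powr p"
  have A: "A \<ge> 0" using B c by (simp add: A_def)
  have key: "1 \<le> A * cos \<theta> powr p - B * cos (p * \<theta>)" if \<theta>: "0 \<le> \<theta>" "\<theta> < pi/2" for \<theta>
  proof (cases "\<theta> > pi/2 - d'")
    case True
    then have "\<bar>- B * cos (p * \<theta>) - 2\<bar> < 1" using \<theta> d' by (intro d(2)) auto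
    then have "1 \<le> - B * cos (p * \<theta>)" by linarith
    moreover have "0 \<le> A * cos \<theta> powr p" using A by simp
    ultimately show ?thesis by linarith
  next
    case False
    have "c \<le> cos \<theta>" unfolding c_def using False \<theta> d' by (intro cos_monotone_0_pi_le) auto
    then have "c powr p \<le> cos \<theta> powr p" using c p by (intro powr_mono2) auto
    then have "A * c powr p \<le> A * cos \<theta> powr p" using A by (rule mult_left_mono)
    moreover have "A * c powr p = 1 + B" using c by (simp add: A_def)
    moreover have "B * cos (p * \<theta>) \<le> B * 1" using B by (intro mult_left_mono) auto
    ultimately show ?thesis by linarith
  qed
  have "norm w powr p \<le> A * Re w powr p - B * Re (w powr of_real p)" if w: "Re w > 0" for w :: complex
  proof -
    have w0: "w \<noteq> 0" using w by auto
    define \<theta> where "\<theta> = Arg w"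
    have \<theta>: "\<bar>\<theta>\<bar> < pi/2" unfolding \<theta>_def using Re_Ln_pos_lt[OF w0] w by (simp add: Arg_eq_Im_Ln w0)
    have wp: "w = of_real (norm w) * cis \<theta>" unfolding \<theta>_def using Arg_eq[OF w0] by (simp add: cis_conv_exp)
    have re: "Re w = norm w * cos \<bar>\<theta>\<bar>" by (subst wp) simp
    have "w powr of_real p = exp (of_real p * Ln w)" using w0 by (simp add: powr_def)
    also have "Ln w = of_real (ln (norm w)) + \<i> * of_real \<theta>"
      using w0 by (simp add: complex_eq_iff \<theta>_def Arg_eq_Im_Ln)
    finally have "Re (w powr of_real p) = exp (p * ln (norm w)) * cos (p * \<theta>)"
      by (simp add: Re_exp)
    also have "exp (p * ln (norm w)) = norm w powr p" using w0 by (simp add: powr_def)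
    also have "cos (p * \<theta>) = cos (p * \<bar>\<theta>\<bar>)" by (cases "\<theta> \<ge> 0") auto
    finally have rp: "Re (w powr of_real p) = norm w powr p * cos (p * \<bar>\<theta>\<bar>)" .
    have "0 \<le> cos \<bar>\<theta>\<bar>" using \<theta> by (intro cos_ge_zero) auto
    then have rep: "Re w powr p = norm w powr p * cos \<bar>\<theta>\<bar> powr p" unfolding re by (simp add: powr_mult)
    have "norm w powr p * 1 \<le> norm w powr p * (A * cos \<bar>\<theta>\<bar> powr p - B * cos (p * \<bar>\<theta>\<bar>))"
      by (intro mult_left_mono key) (use \<theta> in auto)
    then show ?thesis unfolding rp rep by (simp add: algebra_simps)
  qed
  then show ?thesis using A B by (meson less_imp_le)
qed

section \<open>From nonnegative densities and small exponents to all exponents above 1\<close>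

text \<open>Integrated over a circle, the last term of the half plane inequality is a multiple of
  the value of \<open>G powr p\<close> at 0. Since \<open>G 0\<close> is the normalised mean of
  \<open>u\<close>, a positive number, that term may be dropped; the first term is the Poisson
  bound.\<close>

lemma riesz_nonneg:
  assumes p: "1 < p" "p \<le> 2"
  shows "\<exists>A\<ge>0. \<forall>(u::real \<Rightarrow> real) s. integrable circ_measure u \<longrightarrow> (\<forall>t. 0 \<le> u t) \<longrightarrow> integrable circ_measure (\<lambda>t. u t powr p) \<longrightarrow>
     0 \<le> s \<longrightarrow> s < 1 \<longrightarrow>
     (LINT t|circ_measure. norm (herglotz (\<lambda>t. of_real (u t)) (of_real s * cis t)) powr p) \<le> A * (LINT t|circ_measure. u t powr p)"
proof -
  obtain A B where AB: "A \<ge> 0" "B \<ge> 0" and ineq: "\<And>w::complex. Re w > 0 \<Longrightarrow> norm w powr p \<le> A * Re w powr p - B * Re (w powr of_real p)"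
    using powr_half_plane_inequality[OF p] by blast
  have "(LINT t|circ_measure. norm (herglotz (\<lambda>t. of_real (u t)) (of_real s * cis t)) powr p) \<le> A * (LINT t|circ_measure. u t powr p)"
    if u: "integrable circ_measure u" "\<And>t. 0 \<le> u t" and up: "integrable circ_measure (\<lambda>t. u t powr p)" and s: "0 \<le> s" "s < 1"
    for u :: "real \<Rightarrow> real" and s
  \<comment> \<open>The power of \<open>G\<close> requires \<open>Re (G z) > 0\<close> strictly,
    which fails exactly when \<open>u\<close> vanishes almost everywhere.\<close>
  proof (cases "AE t in circ_measure. u t = 0")
    case True
    have "herglotz (\<lambda>t. of_real (u t)) z = 0" for z
    proof -
      have "(LINT t|circ_measure. hker z t * of_real (u t)) = 0"
        by (rule integral_eq_zero_AE) (use True in \<open>auto elim!: eventually_mono\<close>)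
      then show ?thesis by (simp add: herglotz_def)
    qed
    then show ?thesis using p AB by (auto intro!: mult_nonneg_nonneg integral_nonneg_AE)
  next
    case False
    define G where "G = herglotz (\<lambda>t. of_real (u t))"
    have ic: "integrable circ_measure (\<lambda>t. complex_of_real (u t))" using u by auto
    have G: "G holomorphic_on ball 0 1" unfolding G_def by (rule holomorphic_herglotz[OF ic])
    have pos: "Re (G z) > 0" if z: "norm z < 1" for z
    proof (rule ccontr)
      assume "\<not> ?thesis"
      then have "Re (G z) = 0" using herglotz_Re_nonneg(2)[OF u z] by (simp add: G_def)
      then have "(LINT t|circ_measure. Re (hker z t) * u t) = 0"
        unfolding G_def herglotz_Re_nonneg(1)[OF u z] by simp
      then have "AE t in circ_measure. Re (hker z t) * u t = 0"
        by (subst (asm) integral_nonneg_eq_0_iff_AE[OF integrable_poisson_real[OF u(1) z]])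
           (use poisson_kernel_pos[OF z] u(2) in \<open>auto intro!: AE_I2 simp: less_imp_le\<close>)
      then have "AE t in circ_measure. u t = 0"
        by eventually_elim (use poisson_kernel_pos[OF z] in \<open>auto simp: less_imp_neq[symmetric]\<close>)
      with False show False by simp
    qed
    have z: "norm (of_real s * cis t) < 1" for t using s by (simp add: norm_mult)
    define h where "h = (\<lambda>w. G w powr of_real p)"
    have h: "h holomorphic_on ball 0 1"
    proof -
      have "G w \<notin> \<real>\<^sub>\<le>\<^sub>0" if "norm w < 1" for w using pos[OF that] by (auto simp: complex_nonpos_Reals_iff)
      then show ?thesis unfolding h_def by (intro holomorphic_intros G) auto
    qed
    have cG: "continuous_on X (\<lambda>t. G (of_real s * cis t))" for X by (rule continuous_on_circ_dilate[OF G s])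
    have ch: "continuous_on X (\<lambda>t. h (of_real s * cis t))" for X by (rule continuous_on_circ_dilate[OF h s])
    have i0: "integrable circ_measure (\<lambda>t. norm (G (of_real s * cis t)) powr p)"
      by (intro integrable_circ_continuous continuous_on_powr' continuous_intros cG) (use p in auto)
    have i1: "integrable circ_measure (\<lambda>t. Re (G (of_real s * cis t)) powr p)"
      by (intro integrable_circ_continuous continuous_on_powr' continuous_intros cG) (use p pos[OF z] in \<open>auto simp: less_imp_le\<close>)
    have i2: "integrable circ_measure (\<lambda>t. h (of_real s * cis t))" by (intro integrable_circ_continuous ch)
    have "(LINT t|circ_measure. norm (G (of_real s * cis t)) powr p) \<le> (LINT t|circ_measure. A * Re (G (of_real s * cis t)) powr p - B * Re (h (of_real s * cis t)))"
      by (rule integral_mono[OF i0]) (use i1 i2 ineq[OF pos[OF z]] in \<open>auto simp: h_def\<close>)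
    also have "\<dots> = A * (LINT t|circ_measure. Re (G (of_real s * cis t)) powr p) - B * Re (LINT t|circ_measure. h (of_real s * cis t))"
      using i1 i2 by (simp add: integral_Re)
    also have "\<dots> \<le> A * (LINT t|circ_measure. u t powr p) - 0"
    proof (rule diff_mono)
      show "A * (LINT t|circ_measure. Re (G (of_real s * cis t)) powr p) \<le> A * (LINT t|circ_measure. u t powr p)"
        unfolding G_def by (intro mult_left_mono poisson_Lp_bound_nonneg u up s AB) (use p in auto)
      have "G 0 = of_real (1 / (2*pi) * (LINT t|circ_measure. u t))"
        by (simp add: G_def herglotz_def hker_def)
      then obtain x where x: "G 0 = of_real x" by blast
      have "x > 0" using pos[of 0] x by simp
      then have "h 0 = of_real (x powr p)" unfolding h_def x by (simp add: powr_of_real)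
      then have "0 \<le> Re (h 0)" by simp
      then show "0 \<le> B * Re (LINT t|circ_measure. h (of_real s * cis t))"
        unfolding mean_value_dilate[OF h s] using AB by simp
    qed
    finally show ?thesis by (simp add: G_def)
  qed
  then show ?thesis using AB by blast
qed

text \<open>Restricted to functions continuous on the closed disc and vanishing at 0: boundary
  values are plain values, the integrals are finite, and squaring stays in the class, as the
  doubling step requires. Dilation extends the bound to Herglotz transforms.\<close>

definition riesz_bound :: "real \<Rightarrow> real \<Rightarrow> bool" where
  "riesz_bound p A \<longleftrightarrow> (\<forall>h. h holomorphic_on ball 0 1 \<longrightarrow> continuous_on (cball 0 1) h \<longrightarrow> h 0 = 0 \<longrightarrow>
     (LINT t|circ_measure. norm (h (cis t)) powr p) \<le> A * (LINT t|circ_measure. \<bar>Re (h (cis t))\<bar> powr p))"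

text \<open>Because \<open>h 0 = 0\<close>, \<open>h\<close> is the difference of the Herglotz
  transforms of the positive and negative parts of its boundary real part. The bound holds on
  smaller circles and reaches the unit circle by dominated convergence.\<close>

lemma riesz_bound_base:
  assumes p: "1 < p" "p \<le> 2"
  shows "\<exists>A\<ge>0. riesz_bound p A"
proof -
  obtain A where A: "A \<ge> 0" and R: "\<And>u s. integrable circ_measure u \<Longrightarrow> (\<And>t. 0 \<le> (u t :: real)) \<Longrightarrow> integrable circ_measure (\<lambda>t. u t powr p) \<Longrightarrow>
     0 \<le> s \<Longrightarrow> s < 1 \<Longrightarrow>
     (LINT t|circ_measure. norm (herglotz (\<lambda>t. of_real (u t)) (of_real s * cis t)) powr p) \<le> A * (LINT t|circ_measure. u t powr p)"
    using riesz_nonneg[OF p] by blast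
  have "(LINT t|circ_measure. norm (h (cis t)) powr p) \<le> (2 powr p * (2 * A)) * (LINT t|circ_measure. \<bar>Re (h (cis t))\<bar> powr p)"
    if h: "h holomorphic_on ball 0 1" "continuous_on (cball 0 1) h" "h 0 = 0" for h
  proof -
    define I where "I = (LINT t|circ_measure. \<bar>Re (h (cis t))\<bar> powr p)"
    define u1 where "u1 = (\<lambda>t. max 0 (Re (h (cis t))))"
    define u2 where "u2 = (\<lambda>t. max 0 (- Re (h (cis t))))"
    have ch: "continuous_on X (\<lambda>t. h (cis t))" for X by (rule continuous_on_circ_compose[OF h(2)])
    have c1: "continuous_on X u1" and c2: "continuous_on X u2" for X unfolding u1_def u2_def by (intro continuous_intros ch)+
    have u: "integrable circ_measure u1" "integrable circ_measure u2" by (intro integrable_circ_continuous c1 c2)+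
    have u0: "0 \<le> u1 t" "0 \<le> u2 t" for t by (simp_all add: u1_def u2_def)
    have up: "integrable circ_measure (\<lambda>t. u1 t powr p)" "integrable circ_measure (\<lambda>t. u2 t powr p)"
      by (intro integrable_circ_continuous continuous_on_powr' continuous_intros c1 c2; use p u0 in force)+
    have iI: "integrable circ_measure (\<lambda>t. \<bar>Re (h (cis t))\<bar> powr p)"
      by (intro integrable_circ_continuous continuous_on_powr' continuous_intros ch) (use p in auto)
    have uI: "(LINT t|circ_measure. u1 t powr p) \<le> I" "(LINT t|circ_measure. u2 t powr p) \<le> I"
    proof -
      show "(LINT t|circ_measure. u1 t powr p) \<le> I"
        unfolding I_def by (rule integral_mono[OF up(1) iI]) (use p in \<open>auto intro!: powr_mono2 simp: u1_def\<close>)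
      show "(LINT t|circ_measure. u2 t powr p) \<le> I"
        unfolding I_def by (rule integral_mono[OF up(2) iI]) (use p in \<open>auto intro!: powr_mono2 simp: u2_def\<close>)
    qed
    define G1 where "G1 = herglotz (\<lambda>t. of_real (u1 t))"
    define G2 where "G2 = herglotz (\<lambda>t. of_real (u2 t))"
    have ci: "integrable circ_measure (\<lambda>t. complex_of_real (u1 t))" "integrable circ_measure (\<lambda>t. complex_of_real (u2 t))" using u by auto
    have hG: "h z = G1 z - G2 z" if z: "norm z < 1" for z
    proof -
      have "h z = herglotz (\<lambda>t. of_real (Re (h (cis t)))) z"
        using herglotz_of_Re_holomorphic[OF h(2,1) z] h(3) by simp
      also have "(\<lambda>t. complex_of_real (Re (h (cis t)))) = (\<lambda>t. of_real (u1 t) - of_real (u2 t))"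
        by (auto simp: fun_eq_iff u1_def u2_def max_def)
      also have "herglotz \<dots> z = G1 z - G2 z" unfolding G1_def G2_def by (rule herglotz_diff[OF ci z])
      finally show ?thesis .
    qed
    have bnd: "(LINT t|circ_measure. norm (h (of_real s * cis t)) powr p) \<le> 2 powr p * (2 * A) * I" if s: "0 \<le> s" "s < 1" for s
    proof -
      have z: "norm (of_real s * cis t) < 1" for t using s by (simp add: norm_mult)
      have cG: "continuous_on X (\<lambda>t. G1 (of_real s * cis t))" "continuous_on X (\<lambda>t. G2 (of_real s * cis t))" for X
        unfolding G1_def G2_def by (intro continuous_on_circ_herglotz ci s)+
      have i1: "integrable circ_measure (\<lambda>t. norm (G1 (of_real s * cis t)) powr p)" "integrable circ_measure (\<lambda>t. norm (G2 (of_real s * cis t)) powr p)"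
        by (intro integrable_circ_continuous continuous_on_powr' continuous_intros cG; use p in force)+
      have "(LINT t|circ_measure. norm (h (of_real s * cis t)) powr p) \<le> (LINT t|circ_measure. 2 powr p * (norm (G1 (of_real s * cis t)) powr p + norm (G2 (of_real s * cis t)) powr p))"
      proof (rule integral_mono)
        show "integrable circ_measure (\<lambda>t. norm (h (of_real s * cis t)) powr p)"
          by (intro integrable_circ_continuous continuous_on_powr' continuous_intros continuous_on_circ_dilate[OF h(1)] s) (use p in auto)
        show "integrable circ_measure (\<lambda>t. 2 powr p * (norm (G1 (of_real s * cis t)) powr p + norm (G2 (of_real s * cis t)) powr p))" using i1 by auto
        fix t
        have "norm (h (of_real s * cis t)) \<le> norm (G1 (of_real s * cis t)) + norm (G2 (of_real s * cis t))"
          unfolding hG[OF z] by (rule norm_triangle_ineq4)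
        then have "norm (h (of_real s * cis t)) powr p \<le> (norm (G1 (of_real s * cis t)) + norm (G2 (of_real s * cis t))) powr p"
          using p by (intro powr_mono2) auto
        also have "\<dots> \<le> 2 powr p * (norm (G1 (of_real s * cis t)) powr p + norm (G2 (of_real s * cis t)) powr p)"
          using p by (intro powr_add_le) auto
        finally show "norm (h (of_real s * cis t)) powr p \<le> \<dots>" .
      qed
      also have "\<dots> = 2 powr p * ((LINT t|circ_measure. norm (G1 (of_real s * cis t)) powr p) + (LINT t|circ_measure. norm (G2 (of_real s * cis t)) powr p))"
        using i1 by simp
      also have "\<dots> \<le> 2 powr p * (A * I + A * I)"
        using R[OF u(1) u0(1) up(1) s] R[OF u(2) u0(2) up(2) s] mult_left_mono[OF uI(1) A] mult_left_mono[OF uI(2) A]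
        unfolding G1_def G2_def by (intro mult_left_mono add_mono) auto
      finally show ?thesis by (simp add: algebra_simps)
    qed
    obtain M where M: "\<And>w. w \<in> cball 0 1 \<Longrightarrow> norm (h w) \<le> M"
      using compact_imp_bounded[OF compact_continuous_image[OF h(2) compact_cball]] unfolding bounded_iff by blast
    have "(\<lambda>n. LINT t|circ_measure. norm (h (of_real (rad n) * cis t)) powr p) \<longlonglongrightarrow> (LINT t|circ_measure. norm (h (cis t)) powr p)"
    proof (rule integral_dominated_convergence[where w = "\<lambda>_. M powr p"])
      show "(\<lambda>t. norm (h (cis t)) powr p) \<in> borel_measurable circ_measure"
        by (intro measurable_circ_continuous continuous_on_powr' continuous_intros ch) (use p in auto)
      show "(\<lambda>t. norm (h (of_real (rad n) * cis t)) powr p) \<in> borel_measurable circ_measure" for n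
        by (intro measurable_circ_continuous continuous_on_powr' continuous_intros continuous_on_circ_dilate[OF h(1)])
           (use p rad_bounds[of n] in auto)
      show "AE t in circ_measure. norm (norm (h (of_real (rad n) * cis t)) powr p) \<le> M powr p" for n
        using rad_bounds[of n] p by (auto intro!: AE_I2 powr_mono2 M simp: norm_mult)
      show "AE t in circ_measure. (\<lambda>n. norm (h (of_real (rad n) * cis t)) powr p) \<longlonglongrightarrow> norm (h (cis t)) powr p"
      proof (rule AE_I2)
        fix t
        have "rad \<longlonglongrightarrow> 1" using rad_at_left by (simp add: filterlim_at)
        then have "(\<lambda>n. of_real (rad n) * cis t) \<longlonglongrightarrow> of_real 1 * cis t" by (intro tendsto_intros)
        then have "(\<lambda>n. h (of_real (rad n) * cis t)) \<longlonglongrightarrow> h (of_real 1 * cis t)"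
          by (rule continuous_on_tendsto_compose[OF h(2)]) (use rad_bounds in \<open>auto simp: norm_mult less_imp_le intro!: always_eventually\<close>)
        then have "(\<lambda>n. norm (h (of_real (rad n) * cis t)) powr p) \<longlonglongrightarrow> norm (h (of_real 1 * cis t)) powr p"
          by (intro tendsto_powr' tendsto_norm tendsto_const) (use p in auto)
        then show "(\<lambda>n. norm (h (of_real (rad n) * cis t)) powr p) \<longlonglongrightarrow> norm (h (cis t)) powr p" by simp
      qed
    qed auto
    then show ?thesis unfolding I_def[symmetric]
      by (rule LIMSEQ_le_const2) (use bnd rad_bounds in \<open>auto simp: less_imp_le\<close>)
  qed
  then show ?thesis unfolding riesz_bound_def using A by (intro exI[of _ "2 powr p * (2 * A)"]) auto
qed

text \<open>Bochner's doubling trick: apply the inequality for \<open>p\<close> to \<open>h\<^sup>2\<close>, whose imaginary part is \<open>2uv\<close>.\<close>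

lemma riesz_bound_double:
  assumes p: "p > 0" and A: "A \<ge> 0" "riesz_bound p A"
  shows "\<exists>A'\<ge>0. riesz_bound (2 * p) A'"
proof -
  define K where "K = (A + 1) * 2 powr p"
  have K: "K > 0" using A by (simp add: K_def)
  have "(LINT t|circ_measure. norm (h (cis t)) powr (2 * p)) \<le> K\<^sup>2 * (LINT t|circ_measure. \<bar>Re (h (cis t))\<bar> powr (2 * p))"
    if h: "h holomorphic_on ball 0 1" "continuous_on (cball 0 1) h" "h 0 = 0" for h
  proof -
    have ch: "continuous_on X (\<lambda>t. h (cis t))" for X by (rule continuous_on_circ_compose[OF h(2)])
    have iu: "integrable circ_measure (\<lambda>t. \<bar>Re (h (cis t))\<bar> powr (2 * p))"
      by (intro integrable_circ_continuous continuous_on_powr' continuous_intros ch) (use p in auto)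
    have ih: "integrable circ_measure (\<lambda>t. norm (h (cis t)) powr (2 * p))"
      by (intro integrable_circ_continuous continuous_on_powr' continuous_intros ch) (use p in auto)
    have pw: "x powr (2 * p) = (x powr p)\<^sup>2" for x :: real
      by (cases "x = 0") (use p in \<open>auto simp: powr_def power2_eq_square exp_add[symmetric] algebra_simps\<close>)
    define f where "f = (\<lambda>w. - \<i> * (h w)\<^sup>2)"
    have nf: "norm (f (cis t)) powr p = norm (h (cis t)) powr (2 * p)" for t
      by (simp add: f_def norm_mult norm_power pw) (simp add: power2_eq_square powr_mult)
    have i3: "integrable circ_measure (\<lambda>t. \<bar>Re (f (cis t))\<bar> powr p)"
      unfolding f_def by (intro integrable_circ_continuous continuous_on_powr' continuous_intros ch) (use p in auto)
    have "(LINT t|circ_measure. norm (f (cis t)) powr p) \<le> A * (LINT t|circ_measure. \<bar>Re (f (cis t))\<bar> powr p)"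
    proof (rule A(2)[unfolded riesz_bound_def, rule_format])
      show "f holomorphic_on ball 0 1" unfolding f_def by (intro holomorphic_intros h)
      show "continuous_on (cball 0 1) f" unfolding f_def by (intro continuous_intros h)
      show "f 0 = 0" by (simp add: f_def h(3))
    qed
    also have "\<dots> \<le> (A + 1) * (LINT t|circ_measure. \<bar>Re (f (cis t))\<bar> powr p)"
      by (intro mult_right_mono integral_nonneg_AE) auto
    also have "\<dots> = (LINT t|circ_measure. (A + 1) * \<bar>Re (f (cis t))\<bar> powr p)" by simp
    \<comment> \<open>Young's inequality leaves half of the integral of
      \<open>norm (h (cis t)) powr (2 * p)\<close>, which is finite and can be absorbed on the
      left.\<close>
    also have "\<dots> \<le> (LINT t|circ_measure. K\<^sup>2 / 2 * \<bar>Re (h (cis t))\<bar> powr (2 * p) + 1 / 2 * norm (h (cis t)) powr (2 * p))"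
    proof (rule integral_mono)
      fix t
      define x where "x = \<bar>Re (h (cis t))\<bar> powr p"
      define y where "y = norm (h (cis t)) powr p"
      have xy: "0 \<le> x" "0 \<le> y" by (simp_all add: x_def y_def)
      have "Re (f (cis t)) = 2 * Re (h (cis t)) * Im (h (cis t))" by (simp add: f_def power2_eq_square)
      then have "\<bar>Re (f (cis t))\<bar> powr p = (2 * \<bar>Re (h (cis t))\<bar> * \<bar>Im (h (cis t))\<bar>) powr p" by (simp add: abs_mult)
      also have "\<dots> \<le> (2 * \<bar>Re (h (cis t))\<bar> * norm (h (cis t))) powr p"
        using p by (intro powr_mono2 mult_left_mono abs_Im_le_cmod) auto
      also have "\<dots> = 2 powr p * (x * y)" by (simp add: x_def y_def powr_mult)
      finally have "(A + 1) * \<bar>Re (f (cis t))\<bar> powr p \<le> (A + 1) * (2 powr p * (x * y))" using A by (intro mult_left_mono) auto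
      also have "\<dots> = (K * x) * y" by (simp add: K_def)
      also have "\<dots> \<le> ((K * x)\<^sup>2 + y\<^sup>2) / 2" using sum_squares_bound[of "K * x" y] by simp
      also have "\<dots> = K\<^sup>2 / 2 * \<bar>Re (h (cis t))\<bar> powr (2 * p) + 1 / 2 * norm (h (cis t)) powr (2 * p)"
        unfolding pw x_def y_def by (simp add: power_mult_distrib add_divide_distrib)
      finally show "(A + 1) * \<bar>Re (f (cis t))\<bar> powr p \<le> K\<^sup>2 / 2 * \<bar>Re (h (cis t))\<bar> powr (2 * p) + 1 / 2 * norm (h (cis t)) powr (2 * p)" .
    next
      show "integrable circ_measure (\<lambda>t. (A + 1) * \<bar>Re (f (cis t))\<bar> powr p)" using i3 by auto
      show "integrable circ_measure (\<lambda>t. K\<^sup>2 / 2 * \<bar>Re (h (cis t))\<bar> powr (2 * p) + 1 / 2 * norm (h (cis t)) powr (2 * p))"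
        using iu ih by auto
    qed
    also have "\<dots> = K\<^sup>2 / 2 * (LINT t|circ_measure. \<bar>Re (h (cis t))\<bar> powr (2 * p)) + 1 / 2 * (LINT t|circ_measure. norm (h (cis t)) powr (2 * p))"
      using iu ih by simp
    finally show ?thesis unfolding nf by simp
  qed
  then show ?thesis unfolding riesz_bound_def by (intro exI[of _ "K\<^sup>2"]) auto
qed

text \<open>Finitely many halvings bring an exponent above 2 into the range from 1 to 2;
  \<open>n\<close> bounds their number.\<close>

lemma riesz_bound_exists:
  assumes p: "1 < p"
  shows "\<exists>A\<ge>0. riesz_bound p A"
proof -
  have "\<exists>A\<ge>0. riesz_bound p A" if "1 < p" "p \<le> 2 ^ (n + 1)" for n p
    using that
  proof (induction n arbitrary: p)
    case 0
    then show ?case using riesz_bound_base by simp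
  next
    case (Suc n)
    show ?case
    proof (cases "p \<le> 2")
      case True
      then show ?thesis using riesz_bound_base Suc by blast
    next
      case False
      then have "1 < p / 2" "p / 2 \<le> 2 ^ (n + 1)" using Suc.prems by auto
      from Suc.IH[OF this] obtain A where "A \<ge> 0" "riesz_bound (p / 2) A" by blast
      then have "\<exists>A'\<ge>0. riesz_bound (2 * (p / 2)) A'" using False by (intro riesz_bound_double) auto
      then show ?thesis by simp
    qed
  qed
  moreover obtain n where "p \<le> 2 ^ n" using real_arch_pow[of 2 p] by (auto intro: less_imp_le)
  then have "p \<le> 2 ^ (n + 1)" by (simp add: order_trans)
  ultimately show ?thesis using p by blast
qed

text \<open>Real and imaginary parts of \<open>\<phi>\<close> are treated apart, because for a real
  density the real part of the transform is the Poisson integral. The zero mean gives the vanishing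
  at 0 that \<open>riesz_bound\<close> asks for, and dilation supplies continuity up to the
  circle.\<close>

lemma herglotz_Lp_bound:
  assumes p: "1 < p"
  shows "\<exists>A\<ge>0. \<forall>\<phi> r. integrable circ_measure \<phi> \<longrightarrow> integrable circ_measure (\<lambda>t. norm (\<phi> t) powr p) \<longrightarrow> (LINT t|circ_measure. \<phi> t) = 0 \<longrightarrow>
     0 \<le> r \<longrightarrow> r < 1 \<longrightarrow> (LINT t|circ_measure. norm (herglotz \<phi> (of_real r * cis t)) powr p) \<le> A * (LINT t|circ_measure. norm (\<phi> t) powr p)"
proof -
  obtain A where A: "A \<ge> 0" "riesz_bound p A" using riesz_bound_exists[OF p] by blast
  have "(LINT t|circ_measure. norm (herglotz \<phi> (of_real r * cis t)) powr p) \<le> (2 powr p * (2 * A)) * (LINT t|circ_measure. norm (\<phi> t) powr p)"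
    if phi: "integrable circ_measure \<phi>" and phip: "integrable circ_measure (\<lambda>t. norm (\<phi> t) powr p)"
      and mean: "(LINT t|circ_measure. \<phi> t) = 0" and r: "0 \<le> r" "r < 1" for \<phi> r
  proof -
    have z: "norm (of_real r * cis t) < 1" for t using r by (simp add: norm_mult)
    have real: "(LINT t|circ_measure. norm (herglotz (\<lambda>t. of_real (u t)) (of_real r * cis t)) powr p) \<le> A * (LINT t|circ_measure. norm (\<phi> t) powr p)"
      if u: "integrable circ_measure u" and le: "\<And>t. \<bar>u t\<bar> \<le> norm (\<phi> t)" and mean: "(LINT t|circ_measure. u t) = 0" for u :: "real \<Rightarrow> real"
    proof -
      define U where "U = herglotz (\<lambda>t. of_real (u t))"
      have iu: "integrable circ_measure (\<lambda>t. complex_of_real (u t))" using u by auto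
      have up: "integrable circ_measure (\<lambda>t. norm (complex_of_real (u t)) powr p)"
        by (rule Bochner_Integration.integrable_bound[OF phip]) (use borel_measurable_integrable[OF u] le p in \<open>auto intro!: AE_I2 powr_mono2\<close>)
      have hol: "U holomorphic_on ball 0 1" unfolding U_def by (rule holomorphic_herglotz[OF iu])
      have U0: "U 0 = 0" by (simp add: U_def herglotz_def hker_def mean)
      have "(LINT t|circ_measure. norm (U (of_real r * cis t)) powr p) \<le> A * (LINT t|circ_measure. \<bar>Re (U (of_real r * cis t))\<bar> powr p)"
        using A(2)[unfolded riesz_bound_def, rule_format, OF holomorphic_dilate[OF hol r]] U0 by simp
      also have "(LINT t|circ_measure. \<bar>Re (U (of_real r * cis t))\<bar> powr p) = (LINT t|circ_measure. norm (poisson (\<lambda>t. of_real (u t)) (of_real r * cis t)) powr p)"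
      proof -
        have "poisson (\<lambda>t. of_real (u t)) (of_real r * cis t) = of_real (Re (U (of_real r * cis t)))" for t
          unfolding poisson_herglotz[OF iu z] U_def by (simp add: complex_add_cnj)
        then show ?thesis by simp
      qed
      also have "\<dots> \<le> (LINT t|circ_measure. norm (complex_of_real (u t)) powr p)"
        by (rule poisson_Lp_bound[OF iu up _ r]) (use p in simp)
      also have "\<dots> \<le> (LINT t|circ_measure. norm (\<phi> t) powr p)"
        by (rule integral_mono[OF up phip]) (use le p in \<open>auto intro!: powr_mono2\<close>)
      finally show ?thesis unfolding U_def using A by (simp add: mult_left_mono)
    qed
    define U where "U = herglotz (\<lambda>t. of_real (Re (\<phi> t)))"
    define V where "V = herglotz (\<lambda>t. of_real (Im (\<phi> t)))"
    have i: "integrable circ_measure (\<lambda>t. Re (\<phi> t))" "integrable circ_measure (\<lambda>t. Im (\<phi> t))" using phi by auto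
    have ic: "integrable circ_measure (\<lambda>t. complex_of_real (Re (\<phi> t)))" "integrable circ_measure (\<lambda>t. complex_of_real (Im (\<phi> t)))" using i by auto
    have mU: "(LINT t|circ_measure. norm (U (of_real r * cis t)) powr p) \<le> A * (LINT t|circ_measure. norm (\<phi> t) powr p)"
      unfolding U_def by (rule real[OF i(1)]) (use mean integral_Re[OF phi] abs_Re_le_cmod in auto)
    have mV: "(LINT t|circ_measure. norm (V (of_real r * cis t)) powr p) \<le> A * (LINT t|circ_measure. norm (\<phi> t) powr p)"
      unfolding V_def by (rule real[OF i(2)]) (use mean integral_Im[OF phi] abs_Im_le_cmod in auto)
    have cU: "continuous_on X (\<lambda>t. U (of_real r * cis t))" "continuous_on X (\<lambda>t. V (of_real r * cis t))" for X
      unfolding U_def V_def by (intro continuous_on_circ_herglotz ic r)+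
    have iU: "integrable circ_measure (\<lambda>t. norm (U (of_real r * cis t)) powr p)" "integrable circ_measure (\<lambda>t. norm (V (of_real r * cis t)) powr p)"
      by (intro integrable_circ_continuous continuous_on_powr' continuous_intros cU; use p in force)+
    have eq: "herglotz \<phi> w = U w + \<i> * V w" if w: "norm w < 1" for w
    proof -
      have "\<phi> = (\<lambda>t. of_real (Re (\<phi> t)) + \<i> * of_real (Im (\<phi> t)))" by (simp add: fun_eq_iff complex_eq_iff)
      then have "herglotz \<phi> w = herglotz (\<lambda>t. of_real (Re (\<phi> t)) + \<i> * of_real (Im (\<phi> t))) w" by simp
      also have "\<dots> = U w + \<i> * V w" unfolding U_def V_def
        by (subst herglotz_add) (use ic w in \<open>auto simp: herglotz_cmult\<close>)
      finally show ?thesis .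
    qed
    have "(LINT t|circ_measure. norm (herglotz \<phi> (of_real r * cis t)) powr p) \<le> (LINT t|circ_measure. 2 powr p * (norm (U (of_real r * cis t)) powr p + norm (V (of_real r * cis t)) powr p))"
    proof (rule integral_mono)
      show "integrable circ_measure (\<lambda>t. norm (herglotz \<phi> (of_real r * cis t)) powr p)"
        by (intro integrable_circ_continuous continuous_on_powr' continuous_intros continuous_on_circ_herglotz phi r) (use p in auto)
      show "integrable circ_measure (\<lambda>t. 2 powr p * (norm (U (of_real r * cis t)) powr p + norm (V (of_real r * cis t)) powr p))" using iU by auto
      fix t
      have "norm (herglotz \<phi> (of_real r * cis t)) \<le> norm (U (of_real r * cis t)) + norm (V (of_real r * cis t))"
        unfolding eq[OF z] using norm_triangle_ineq[of "U (of_real r * cis t)" "\<i> * V (of_real r * cis t)"] by (simp add: norm_mult)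
      then have "norm (herglotz \<phi> (of_real r * cis t)) powr p \<le> (norm (U (of_real r * cis t)) + norm (V (of_real r * cis t))) powr p"
        using p by (intro powr_mono2) auto
      also have "\<dots> \<le> 2 powr p * (norm (U (of_real r * cis t)) powr p + norm (V (of_real r * cis t)) powr p)"
        using p by (intro powr_add_le) auto
      finally show "norm (herglotz \<phi> (of_real r * cis t)) powr p \<le> \<dots>" .
    qed
    also have "\<dots> = 2 powr p * ((LINT t|circ_measure. norm (U (of_real r * cis t)) powr p) + (LINT t|circ_measure. norm (V (of_real r * cis t)) powr p))"
      using iU by simp
    also have "\<dots> \<le> 2 powr p * (A * (LINT t|circ_measure. norm (\<phi> t) powr p) + A * (LINT t|circ_measure. norm (\<phi> t) powr p))"
      using mU mV by (intro mult_left_mono add_mono) auto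
    finally show ?thesis by (simp add: algebra_simps)
  qed
  then show ?thesis using A(1) by (intro exI[of _ "2 powr p * (2 * A)"]) auto
qed



section \<open>Poisson representation and Hardy spaces\<close>

text \<open>Dilates are reproduced by the Poisson kernel exactly; boundedness allows dominated
  convergence as the radius tends to 1.\<close>

lemma bounded_holomorphic_poisson:
  assumes f: "f holomorphic_on ball 0 1" and M: "\<And>w. norm w < 1 \<Longrightarrow> norm (f w) \<le> M"
    and lim: "AE t in circ_measure. (\<lambda>n. f (of_real (rad n) * cis t)) \<longlonglongrightarrow> \<beta> t" and z: "norm z < 1"
  shows "f z = poisson \<beta> z"
proof -
  have rn: "0 \<le> rad n" "rad n < 1" for n using rad_bounds[of n] by auto
  have m: "(\<lambda>t. f (of_real (rad n) * cis t)) \<in> borel_measurable circ_measure" for n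
    by (intro measurable_circ_continuous continuous_on_circ_dilate[OF f] rn)
  have mb: "\<beta> \<in> borel_measurable circ_measure" by (rule measurable_circ_AE_limit[OF m lim])
  have mk: "(\<lambda>t. complex_of_real (Re (hker z t))) \<in> borel_measurable circ_measure"
    by (intro measurable_circ_continuous continuous_intros continuous_on_herglotz_kernel[OF z])
  have "(\<lambda>n. LINT t|circ_measure. of_real (Re (hker z t)) * f (of_real (rad n) * cis t)) \<longlonglongrightarrow> (LINT t|circ_measure. of_real (Re (hker z t)) * \<beta> t)"
  proof (rule integral_dominated_convergence[where w = "\<lambda>t. Re (hker z t) * M"])
    show "integrable circ_measure (\<lambda>t. Re (hker z t) * M)"
      by (intro integrable_circ_continuous continuous_intros continuous_on_herglotz_kernel[OF z])
    show "AE t in circ_measure. norm (of_real (Re (hker z t)) * f (of_real (rad n) * cis t)) \<le> Re (hker z t) * M" for n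
      using poisson_kernel_pos[OF z] rn[of n] M by (auto intro!: AE_I2 mult_left_mono simp: norm_mult less_imp_le)
    show "AE t in circ_measure. (\<lambda>n. of_real (Re (hker z t)) * f (of_real (rad n) * cis t)) \<longlonglongrightarrow> of_real (Re (hker z t)) * \<beta> t"
      using lim by eventually_elim (rule tendsto_mult[OF tendsto_const])
    show "(\<lambda>t. of_real (Re (hker z t)) * \<beta> t) \<in> borel_measurable circ_measure" by (rule borel_measurable_times[OF mk mb])
    show "(\<lambda>t. of_real (Re (hker z t)) * f (of_real (rad n) * cis t)) \<in> borel_measurable circ_measure" for n
      by (rule borel_measurable_times[OF mk m])
  qed
  then have "(\<lambda>n. poisson (\<lambda>t. f (of_real (rad n) * cis t)) z) \<longlonglongrightarrow> poisson \<beta> z"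
    unfolding poisson_eq[OF z] by (rule tendsto_mult[OF tendsto_const])
  moreover have "poisson (\<lambda>t. f (of_real (rad n) * cis t)) z = f (of_real (rad n) * z)" for n
    by (rule poisson_of_holomorphic[OF holomorphic_dilate(2,1)[OF f rn] z])
  ultimately have "(\<lambda>n. f (of_real (rad n) * z)) \<longlonglongrightarrow> poisson \<beta> z" by simp
  moreover have "(\<lambda>n. f (of_real (rad n) * z)) \<longlonglongrightarrow> f z"
  proof -
    have "rad \<longlonglongrightarrow> 1" using rad_at_left by (simp add: filterlim_at)
    then have "(\<lambda>n. of_real (rad n) * z) \<longlonglongrightarrow> of_real 1 * z" by (intro tendsto_intros)
    moreover have "isCont f z"
      using holomorphic_on_imp_continuous_on[OF f] z by (simp add: continuous_on_eq_continuous_at)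
    ultimately show ?thesis using isCont_tendsto_compose[of z f] by simp
  qed
  ultimately show ?thesis by (metis LIMSEQ_unique)
qed

lemma herglotz_sum:
  fixes f :: "nat \<Rightarrow> real \<Rightarrow> complex"
  assumes "\<And>j. integrable circ_measure (f j)" and z: "norm z < 1"
  shows "herglotz (\<lambda>t. \<Sum>j<n. f j t) z = (\<Sum>j<n. herglotz (f j) z)"
proof (induction n)
  case 0
  then show ?case by (simp add: herglotz_def)
next
  case (Suc n)
  then show ?case using assms by (simp add: herglotz_add)
qed

text \<open>The product \<open>w / (1 + e * w)\<close> equals
  \<open>(1 - 1 / (1 + e * w)) / e\<close>, so damping makes it bounded however large
  \<open>w\<close> is in the right half plane.\<close>

lemma damping_estimates:
  assumes w: "0 \<le> Re w" and e: "0 < e"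
  shows "1 + of_real e * w \<noteq> 0" "norm (1 / (1 + of_real e * w)) \<le> 1" "norm (w * (1 / (1 + of_real e * w))) \<le> 2 / e"
proof -
  have "1 \<le> Re (1 + of_real e * w)" using w e by simp
  then have n: "1 \<le> norm (1 + of_real e * w)" using complex_Re_le_cmod order_trans by blast
  then show nz: "1 + of_real e * w \<noteq> 0" by auto
  have "1 / norm (1 + of_real e * w) \<le> 1 / 1" using n by (intro frac_le) auto
  then show 1: "norm (1 / (1 + of_real e * w)) \<le> 1" by (simp add: norm_divide)
  have "w * (1 / (1 + of_real e * w)) = (1 - 1 / (1 + of_real e * w)) / of_real e"
  proof -
    have "1 - 1 / (1 + of_real e * w) = (of_real e * w) / (1 + of_real e * w)"
      using nz by (simp add: diff_divide_eq_iff)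
    then show ?thesis using e by simp
  qed
  then have "norm (w * (1 / (1 + of_real e * w))) = norm (1 - 1 / (1 + of_real e * w)) / e"
    using e by (simp add: norm_divide)
  also have "\<dots> \<le> 2 / e"
    using norm_triangle_ineq4[of 1 "1 / (1 + of_real e * w)"] 1 e by (intro divide_right_mono) auto
  finally show "norm (w * (1 / (1 + of_real e * w))) \<le> 2 / e" .
qed

text \<open>Multiplying by the damping factors \<open>1 / (1 + \<epsilon> G)\<close>, where \<open>G\<close> runs through the Herglotz transforms of
  the four positive parts of \<open>\<phi>\<close>, makes the transform bounded; \<open>\<epsilon> \<rightarrow> 0\<close> then gives the representation.\<close>

lemma (in periodic_ac) herglotz_eq_poisson_hilbert:
  assumes psi: "integrable circ_measure (\<lambda>t. \<phi> t + \<i> * hilbert \<phi> t)" and z: "norm z < 1"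
  shows "herglotz \<phi> z = poisson (\<lambda>t. \<phi> t + \<i> * hilbert \<phi> t) z"
proof -
  define \<psi> where "\<psi> = (\<lambda>t. \<phi> t + \<i> * hilbert \<phi> t)"
  \<comment> \<open>The directions 1, -1, i, -i; \<open>u j\<close> is the positive part of
    \<open>\<phi>\<close> in direction \<open>c j\<close>, and \<open>\<phi>\<close> is the sum of
    the \<open>c j * u j\<close>.\<close>
  define c where "c = (\<lambda>j::nat. if j = 0 then 1 else if j = 1 then - 1 else if j = 2 then \<i> else - \<i>)"
  define u where "u = (\<lambda>j t. max 0 (Re (cnj (c j) * \<phi> t)))"
  define G where "G = (\<lambda>j. herglotz (\<lambda>t. of_real (u j t)))"
  have iu: "integrable circ_measure (u j)" for j
    unfolding u_def by (intro integrable_max integrable_Re integrable_mult_right phi_int) auto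
  then have iuc: "integrable circ_measure (\<lambda>t. complex_of_real (u j t))" for j by auto
  have u0: "0 \<le> u j t" for j t by (simp add: u_def)
  have cn: "norm (c j) = 1" for j by (simp add: c_def)
  have hG: "G j holomorphic_on ball 0 1" for j unfolding G_def by (rule holomorphic_herglotz[OF iuc])
  have ReG: "0 \<le> Re (G j w)" if "norm w < 1" for j w unfolding G_def by (rule herglotz_Re_nonneg(2)[OF iu u0 that])
  have S: "herglotz \<phi> w = (\<Sum>j<4. c j * G j w)" if w: "norm w < 1" for w
  proof -
    have "\<phi> t = (\<Sum>j<4. c j * of_real (u j t))" for t
      by (simp add: eval_nat_numeral c_def u_def complex_eq_iff max_def)
    then have "herglotz \<phi> w = herglotz (\<lambda>t. \<Sum>j<4. c j * of_real (u j t)) w" by presburger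
    also have "\<dots> = (\<Sum>j<4. herglotz (\<lambda>t. c j * of_real (u j t)) w)"
      by (rule herglotz_sum[OF _ w]) (intro integrable_mult_right iuc)
    finally show ?thesis by (simp add: herglotz_cmult G_def)
  qed
  have "\<exists>\<gamma>. AE t in circ_measure. ((\<lambda>r. G j (of_real r * cis t)) \<longlongrightarrow> \<gamma> t) (at_left 1)" for j
    unfolding G_def by (rule herglotz_radial_limits_nonneg[OF iu u0])
  then obtain \<gamma> where \<gamma>: "\<And>j. AE t in circ_measure. ((\<lambda>r. G j (of_real r * cis t)) \<longlongrightarrow> \<gamma> j t) (at_left 1)"
    by metis
  have \<gamma>n: "AE t in circ_measure. (\<lambda>n. G j (of_real (rad n) * cis t)) \<longlonglongrightarrow> \<gamma> j t" for j
    using \<gamma>[of j] by eventually_elim (rule filterlim_compose[OF _ rad_at_left])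
  have all: "AE t in circ_measure. \<forall>j. (\<lambda>n. G j (of_real (rad n) * cis t)) \<longlonglongrightarrow> \<gamma> j t"
    unfolding AE_all_countable using \<gamma>n by blast
  have zn: "norm (of_real (rad n) * cis t) < 1" for n t using rad_bounds[of n] by (simp add: norm_mult)
  have Re\<gamma>: "AE t in circ_measure. \<forall>j. 0 \<le> Re (\<gamma> j t)"
    using all
  proof eventually_elim
    case (elim t)
    have "0 \<le> Re (\<gamma> j t)" for j
      by (rule tendsto_lowerbound[OF tendsto_Re[OF elim[THEN spec, of j]]]) (use ReG[OF zn] in auto)
    then show ?case by blast
  qed
  have m\<gamma>: "\<gamma> j \<in> borel_measurable circ_measure" for j
    by (rule measurable_circ_AE_limit[OF _ \<gamma>n])
       (intro measurable_circ_continuous continuous_on_circ_dilate[OF hG] less_imp_le[OF rad_bounds(1)] rad_bounds(2))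
  have m\<psi>: "\<psi> \<in> borel_measurable circ_measure" unfolding \<psi>_def by (rule borel_measurable_integrable[OF psi])
  define e where "e = (\<lambda>k::nat. 1 / (real k + 1))"
  have e0: "e k > 0" for k by (simp add: e_def)
  have e_lim: "e \<longlonglongrightarrow> 0" unfolding e_def by real_asymp
  \<comment> \<open>One factor for each direction: the \<open>j\<close>-th term of
    \<open>herglotz \<phi>\<close> is made bounded by its own factor, while the other three have
    modulus at most 1.\<close>
  define D where "D = (\<lambda>k w. \<Prod>j<(4::nat). 1 / (1 + of_real (e k) * (w j :: complex)))"
  have D1: "norm (D k w) \<le> 1" if "\<And>j. 0 \<le> Re (w j)" for k w
    unfolding D_def prod_norm[symmetric] by (rule prod_le_1) (use damping_estimates(2)[OF that e0] in auto)
  have Dlim: "(\<lambda>k. D k w) \<longlonglongrightarrow> 1" if "\<And>j. 0 \<le> Re (w j)" for w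
  proof -
    have "(\<lambda>k. \<Prod>j<(4::nat). 1 / (1 + of_real (e k) * (w j :: complex))) \<longlonglongrightarrow> (\<Prod>j<(4::nat). 1 / (1 + of_real 0 * w j))"
      by (intro tendsto_intros e_lim) auto
    then show ?thesis by (simp add: D_def)
  qed
  have rep: "herglotz \<phi> z * D k (\<lambda>j. G j z) = poisson (\<lambda>t. \<psi> t * D k (\<lambda>j. \<gamma> j t)) z" for k
  proof (rule bounded_holomorphic_poisson[OF _ _ _ z])
    show "(\<lambda>z. herglotz \<phi> z * D k (\<lambda>j. G j z)) holomorphic_on ball 0 1"
      unfolding D_def by (intro holomorphic_intros holomorphic_herglotz phi_int hG) (use damping_estimates(1)[OF ReG e0] in auto)
    show "norm (herglotz \<phi> w * D k (\<lambda>j. G j w)) \<le> (\<Sum>j<(4::nat). 2 / e k)" if w: "norm w < 1" for w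
    proof -
      have "norm (herglotz \<phi> w * D k (\<lambda>j. G j w)) = norm (\<Sum>j<4. c j * G j w * D k (\<lambda>j. G j w))"
        unfolding S[OF w] sum_distrib_right ..
      also have "\<dots> \<le> (\<Sum>j<(4::nat). 2 / e k)"
      proof (rule sum_norm_le)
        fix j :: nat assume j: "j \<in> {..<4}"
        have "D k (\<lambda>j. G j w) = 1 / (1 + of_real (e k) * G j w) * (\<Prod>i\<in>{..<4} - {j}. 1 / (1 + of_real (e k) * G i w))"
          unfolding D_def by (rule prod.remove) (use j in auto)
        then have "norm (c j * G j w * D k (\<lambda>j. G j w)) = norm (G j w * (1 / (1 + of_real (e k) * G j w))) * norm (\<Prod>i\<in>{..<4} - {j}. 1 / (1 + of_real (e k) * G i w))"
          by (simp add: norm_mult norm_divide cn)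
        also have "\<dots> \<le> 2 / e k * 1"
        proof (intro mult_mono)
          show "norm (G j w * (1 / (1 + of_real (e k) * G j w))) \<le> 2 / e k" by (rule damping_estimates(3)[OF ReG[OF w] e0])
          show "norm (\<Prod>i\<in>{..<4} - {j}. 1 / (1 + of_real (e k) * G i w)) \<le> 1"
            unfolding prod_norm[symmetric] by (rule prod_le_1) (use damping_estimates(2)[OF ReG[OF w] e0] in auto)
        qed (use e0[of k] in auto)
        finally show "norm (c j * G j w * D k (\<lambda>j. G j w)) \<le> 2 / e k" by simp
      qed
      finally show ?thesis .
    qed
    show "AE t in circ_measure. (\<lambda>n. herglotz \<phi> (of_real (rad n) * cis t) * D k (\<lambda>j. G j (of_real (rad n) * cis t))) \<longlonglongrightarrow> \<psi> t * D k (\<lambda>j. \<gamma> j t)"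
      using herglotz_radial_limit_hilbert all Re\<gamma>
    proof eventually_elim
      case (elim t)
      have "(\<lambda>n. herglotz \<phi> (of_real (rad n) * cis t)) \<longlonglongrightarrow> \<psi> t"
        unfolding \<psi>_def by (rule filterlim_compose[OF elim(1) rad_at_left])
      moreover have "(\<lambda>n. D k (\<lambda>j. G j (of_real (rad n) * cis t))) \<longlonglongrightarrow> D k (\<lambda>j. \<gamma> j t)"
        unfolding D_def by (intro tendsto_intros elim(2)[THEN spec]) (use damping_estimates(1)[OF _ e0] elim(3) in auto)
      ultimately show ?case by (rule tendsto_mult)
    qed
  qed
  \<comment> \<open>Here integrability of \<open>\<psi>\<close> enters: it dominates the damped
    densities uniformly in \<open>k\<close>.\<close>
  have "(\<lambda>k. poisson (\<lambda>t. \<psi> t * D k (\<lambda>j. \<gamma> j t)) z) \<longlonglongrightarrow> poisson \<psi> z"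
    unfolding poisson_eq[OF z]
  proof (intro tendsto_mult tendsto_const, rule integral_dominated_convergence[where w = "\<lambda>t. Re (hker z t) * norm (\<psi> t)"])
    have mk: "(\<lambda>t. complex_of_real (Re (hker z t))) \<in> borel_measurable circ_measure"
      by (intro measurable_circ_continuous continuous_intros continuous_on_herglotz_kernel[OF z])
    show "(\<lambda>t. of_real (Re (hker z t)) * \<psi> t) \<in> borel_measurable circ_measure" by (rule borel_measurable_times[OF mk m\<psi>])
    show "(\<lambda>t. of_real (Re (hker z t)) * (\<psi> t * D k (\<lambda>j. \<gamma> j t))) \<in> borel_measurable circ_measure" for k
      unfolding D_def by (intro borel_measurable_times mk m\<psi> borel_measurable_prod borel_measurable_divide borel_measurable_const borel_measurable_add m\<gamma>)
    show "integrable circ_measure (\<lambda>t. Re (hker z t) * norm (\<psi> t))"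
      by (rule integrable_poisson_real[OF _ z]) (use psi in \<open>auto simp: \<psi>_def\<close>)
    show "AE t in circ_measure. norm (of_real (Re (hker z t)) * (\<psi> t * D k (\<lambda>j. \<gamma> j t))) \<le> Re (hker z t) * norm (\<psi> t)" for k
      using Re\<gamma>
    proof eventually_elim
      case (elim t)
      have "norm (\<psi> t) * norm (D k (\<lambda>j. \<gamma> j t)) \<le> norm (\<psi> t)" using D1[of "\<lambda>j. \<gamma> j t" k] elim by (intro mult_left_le) auto
      then show ?case using poisson_kernel_pos[OF z, of t] by (simp add: norm_mult less_imp_le mult_left_mono)
    qed
    show "AE t in circ_measure. (\<lambda>k. of_real (Re (hker z t)) * (\<psi> t * D k (\<lambda>j. \<gamma> j t))) \<longlonglongrightarrow> of_real (Re (hker z t)) * \<psi> t"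
      using Re\<gamma>
    proof eventually_elim
      case (elim t)
      have "(\<lambda>k. of_real (Re (hker z t)) * (\<psi> t * D k (\<lambda>j. \<gamma> j t))) \<longlonglongrightarrow> of_real (Re (hker z t)) * (\<psi> t * 1)"
        by (intro tendsto_intros Dlim) (use elim in auto)
      then show ?case by simp
    qed
  qed
  moreover have "(\<lambda>k. herglotz \<phi> z * D k (\<lambda>j. G j z)) \<longlonglongrightarrow> herglotz \<phi> z * 1"
    by (intro tendsto_intros Dlim ReG z)
  ultimately show ?thesis unfolding rep \<psi>_def by (simp add: LIMSEQ_unique)
qed

section \<open>Hardy space bounds for the Wirtinger derivatives\<close>

lemma hardyI:
  assumes h: "h holomorphic_on ball 0 1" and p: "1 \<le> p"
    and D: "\<And>r. 0 < r \<Longrightarrow> r < 1 \<Longrightarrow> (LINT t|circ_measure. norm (h (of_real r * cis t)) powr p) \<le> D"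
  shows "in_Hardy (ereal p) h" and "hardy_norm (ereal p) h \<le> (1 / (2*pi) * D) powr (1 / p)"
proof -
  have m: "hardy_mean (ereal p) h r \<le> (1 / (2*pi) * D) powr (1 / p)" if "r \<in> {0<..<1}" for r
    unfolding hardy_mean_def using that p D[of r]
    by (auto intro!: powr_mono2 mult_nonneg_nonneg integral_nonneg_AE divide_right_mono)
  have "bdd_above (hardy_mean (ereal p) h ` {0<..<1})" by (rule bdd_aboveI2[OF m])
  then show "in_Hardy (ereal p) h" using h by (simp add: in_Hardy_def)
  show "hardy_norm (ereal p) h \<le> (1 / (2*pi) * D) powr (1 / p)"
  proof -
    have "(SUP r\<in>{0<..<1}. hardy_mean (ereal p) h r) \<le> (1 / (2*pi) * D) powr (1 / p)"
      by (rule cSUP_least[OF _ m]) auto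
    then show ?thesis by (simp add: hardy_norm_def)
  qed
qed

lemma hardyE:
  assumes h: "in_Hardy 1 h"
  obtains B where "\<And>r. 0 < r \<Longrightarrow> r < 1 \<Longrightarrow> (LINT t|circ_measure. norm (h (of_real r * cis t))) \<le> B"
proof -
  obtain B where B: "\<And>r. r \<in> {0<..<1} \<Longrightarrow> hardy_mean 1 h r \<le> B"
  proof -
    obtain B where "\<forall>x\<in>hardy_mean 1 h ` {0<..<1}. x \<le> B"
      using h by (auto simp: in_Hardy_def bdd_above_def)
    then show ?thesis by (intro that[of B]) simp
  qed
  have "(LINT t|circ_measure. norm (h (of_real r * cis t))) \<le> 2 * pi * B" if "0 < r" "r < 1" for r
  proof -
    have "0 \<le> (LINT t|circ_measure. norm (h (of_real r * cis t)))" by (rule integral_nonneg_AE) auto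
    then have "hardy_mean 1 h r = 1 / (2*pi) * (LINT t|circ_measure. norm (h (of_real r * cis t)))"
      by (simp add: hardy_mean_def)
    then have "(LINT t|circ_measure. norm (h (of_real r * cis t))) = 2 * pi * hardy_mean 1 h r" by simp
    also have "\<dots> \<le> 2 * pi * B" using B[of r] that by (intro mult_left_mono) auto
    finally show ?thesis .
  qed
  then show ?thesis by (rule that)
qed

context periodic_ac
begin

lemma norm_herglotz_cnj_le:
  assumes z: "norm z < 1"
  shows "norm (herglotz (\<lambda>t. cnj (\<phi> t)) z) \<le> 2 * norm (poisson \<phi> z) + norm (herglotz \<phi> z)"
proof -
  have "cnj (herglotz (\<lambda>t. cnj (\<phi> t)) z) = 2 * poisson \<phi> z - herglotz \<phi> z"
    unfolding poisson_herglotz[OF phi_int z] by (simp add: add_divide_distrib)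
  then have "norm (herglotz (\<lambda>t. cnj (\<phi> t)) z) = norm (2 * poisson \<phi> z - herglotz \<phi> z)" by (metis complex_mod_cnj)
  then show ?thesis using norm_triangle_ineq4[of "2 * poisson \<phi> z" "herglotz \<phi> z"] by (simp add: norm_mult)
qed

lemma norm_cauchy_transform_le:
  assumes z: "norm z < 1" "1/2 \<le> norm z"
  shows "norm (cauchy_transform \<phi> z) \<le> norm (herglotz \<phi> z)"
proof -
  have "1 * norm (cauchy_transform \<phi> z) \<le> (2 * norm z) * norm (cauchy_transform \<phi> z)"
    using z by (intro mult_right_mono) auto
  then show ?thesis unfolding herglotz_eq_cauchy_transform[OF z(1)] by (simp add: norm_mult)
qed

text \<open>From radius 1/2 on, the Cauchy transform is pointwise at most the Herglotz transform.
  For smaller radii the uniform bound applies, and Jensen's inequality at the centre converts the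
  mean of \<open>norm (\<phi> t)\<close> in it into the integral of the power. The sum of both
  bounds serves all radii.\<close>

lemma cauchy_transform_mean_bound:
  assumes p: "1 \<le> p" and phip: "integrable circ_measure (\<lambda>t. norm (\<phi> t) powr p)" and r: "0 < r" "r < 1"
    and D: "(LINT t|circ_measure. norm (herglotz \<phi> (of_real r * cis t)) powr p) \<le> D"
  shows "(LINT t|circ_measure. norm (- \<i> * cauchy_transform \<phi> (of_real r * cis t)) powr p) \<le> D + 2 powr p * (LINT t|circ_measure. norm (\<phi> t) powr p)"
proof -
  define I where "I = (LINT t|circ_measure. norm (\<phi> t) powr p)"
  have I0: "I \<ge> 0" unfolding I_def by (rule integral_nonneg_AE) auto
  have z: "norm (of_real r * cis t) < 1" "norm (of_real r * cis t) = r" for t using r by (auto simp: norm_mult)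
  have cont: "continuous_on X (\<lambda>t. - \<i> * cauchy_transform \<phi> (of_real r * cis t))" for X
    by (rule continuous_on_circ_dilate[OF holomorphic_cauchy_transform]) (use r in auto)
  have int: "integrable circ_measure (\<lambda>t. norm (- \<i> * cauchy_transform \<phi> (of_real r * cis t)) powr p)"
    by (intro integrable_circ_continuous continuous_on_powr' continuous_on_norm cont continuous_on_const) (use p in auto)
  show ?thesis
  proof (cases "1/2 \<le> r")
    case True
    have "(LINT t|circ_measure. norm (- \<i> * cauchy_transform \<phi> (of_real r * cis t)) powr p) \<le> (LINT t|circ_measure. norm (herglotz \<phi> (of_real r * cis t)) powr p)"
    proof (rule integral_mono[OF int])
      show "integrable circ_measure (\<lambda>t. norm (herglotz \<phi> (of_real r * cis t)) powr p)"
        by (intro integrable_circ_continuous continuous_on_powr' continuous_intros continuous_on_circ_herglotz phi_int) (use p r in auto)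
      show "norm (- \<i> * cauchy_transform \<phi> (of_real r * cis t)) powr p \<le> norm (herglotz \<phi> (of_real r * cis t)) powr p" for t
        using norm_cauchy_transform_le[OF z(1)] True z(2) p by (intro powr_mono2) (auto simp: norm_mult)
    qed
    also have "\<dots> \<le> D" by (rule D)
    finally show ?thesis using I0 unfolding I_def[symmetric] by (simp add: add_increasing2)
  next
    case False
    define a where "a = 1 / (2*pi) * (LINT t|circ_measure. norm (\<phi> t))"
    have a0: "0 \<le> a" unfolding a_def by (intro mult_nonneg_nonneg integral_nonneg_AE) auto
    have n: "integrable circ_measure (\<lambda>t. norm (\<phi> t))" using phi_int by auto
    have ap: "a powr p \<le> 1 / (2*pi) * I"
      using poisson_Jensen[OF n _ phip p, of 0] unfolding a_def I_def
      by (simp add: herglotz_def hker_def)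
    have "norm (- \<i> * cauchy_transform \<phi> (of_real r * cis t)) \<le> 2 * a" for t
      using cauchy_transform_bound[of "of_real r * cis t"] False z(2) by (simp add: a_def norm_mult)
    then have "norm (- \<i> * cauchy_transform \<phi> (of_real r * cis t)) powr p \<le> 2 powr p * (1 / (2*pi) * I)" for t
    proof -
      have "norm (- \<i> * cauchy_transform \<phi> (of_real r * cis t)) powr p \<le> (2 * a) powr p"
        using \<open>\<And>t. norm (- \<i> * cauchy_transform \<phi> (of_real r * cis t)) \<le> 2 * a\<close> p by (intro powr_mono2) auto
      also have "\<dots> = 2 powr p * a powr p" using a0 by (simp add: powr_mult)
      also have "\<dots> \<le> 2 powr p * (1 / (2*pi) * I)" by (intro mult_left_mono ap) auto
      finally show ?thesis .
    qed
    then have "(LINT t|circ_measure. norm (- \<i> * cauchy_transform \<phi> (of_real r * cis t)) powr p) \<le> (LINT t|circ_measure. 2 powr p * (1 / (2*pi) * I))"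
      by (intro integral_mono[OF int]) auto
    also have "\<dots> = 2 powr p * I" unfolding integral_circ_const by simp
    finally have "(LINT t|circ_measure. norm (- \<i> * cauchy_transform \<phi> (of_real r * cis t)) powr p) \<le> 2 powr p * I" .
    moreover have "0 \<le> D" by (rule order_trans[OF _ D]) (auto intro!: integral_nonneg_AE)
    ultimately show ?thesis unfolding I_def by linarith
  qed
qed

lemma in_Hardy_wirt:
  assumes p: "1 \<le> p" and phip: "integrable circ_measure (\<lambda>t. norm (\<phi> t) powr p)"
    and D: "\<And>r. 0 < r \<Longrightarrow> r < 1 \<Longrightarrow> (LINT t|circ_measure. norm (herglotz \<phi> (of_real r * cis t)) powr p) \<le> D"
  shows "in_Hardy (ereal p) (wirt_z (poisson g))"
    and "hardy_norm (ereal p) (wirt_z (poisson g)) \<le> (1 / (2*pi) * (D + 2 powr p * (LINT t|circ_measure. norm (\<phi> t) powr p))) powr (1 / p)"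
proof -
  have b: "(LINT t|circ_measure. norm (wirt_z (poisson g) (of_real r * cis t)) powr p) \<le> D + 2 powr p * (LINT t|circ_measure. norm (\<phi> t) powr p)"
    if r: "0 < r" "r < 1" for r
  proof -
    have "wirt_z (poisson g) (of_real r * cis t) = - \<i> * cauchy_transform \<phi> (of_real r * cis t)" for t
      by (rule wirt_z_poisson) (use r in \<open>simp add: norm_mult\<close>)
    then show ?thesis using cauchy_transform_mean_bound[OF p phip r D[OF r]] by simp
  qed
  show "in_Hardy (ereal p) (wirt_z (poisson g))" by (rule hardyI(1)[OF holomorphic_wirt_z p b])
  show "hardy_norm (ereal p) (wirt_z (poisson g)) \<le> (1 / (2*pi) * (D + 2 powr p * (LINT t|circ_measure. norm (\<phi> t) powr p))) powr (1 / p)"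
    by (rule hardyI(2)[OF holomorphic_wirt_z p b])
qed

lemma wirt_zbar_eq_wirt_z_cnj:
  "norm z < 1 \<Longrightarrow> cnj (wirt_zbar (poisson g) z) = wirt_z (poisson (\<lambda>t. cnj (g t))) z"
  using wirt_zbar_poisson periodic_ac.wirt_z_poisson[OF periodic_ac_cnj] by simp

text \<open>The two functions are identified only inside the disc, so the equality is carried
  through each ingredient of the Hardy definitions instead of rewriting the function itself.\<close>

lemma hardy_wirt_zbar_eq:
  "in_Hardy p (\<lambda>z. cnj (wirt_zbar (poisson g) z)) \<longleftrightarrow> in_Hardy p (wirt_z (poisson (\<lambda>t. cnj (g t))))"
  "hardy_norm p (\<lambda>z. cnj (wirt_zbar (poisson g) z)) = hardy_norm p (wirt_z (poisson (\<lambda>t. cnj (g t))))"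
proof -
  have m: "hardy_mean p (\<lambda>z. cnj (wirt_zbar (poisson g) z)) r = hardy_mean p (wirt_z (poisson (\<lambda>t. cnj (g t)))) r" if "r \<in> {0<..<1}" for r
    unfolding hardy_mean_def using that by (subst wirt_zbar_eq_wirt_z_cnj) (auto simp: norm_mult)
  have i: "(\<lambda>z. cnj (wirt_zbar (poisson g) z)) ` ball 0 1 = wirt_z (poisson (\<lambda>t. cnj (g t))) ` ball 0 1"
    by (rule image_cong) (auto simp: wirt_zbar_eq_wirt_z_cnj)
  have i2: "hardy_mean p (\<lambda>z. cnj (wirt_zbar (poisson g) z)) ` {0<..<1} = hardy_mean p (wirt_z (poisson (\<lambda>t. cnj (g t)))) ` {0<..<1}"
    by (rule image_cong) (auto simp: m)
  have h: "(\<lambda>z. cnj (wirt_zbar (poisson g) z)) holomorphic_on ball 0 1 \<longleftrightarrow> wirt_z (poisson (\<lambda>t. cnj (g t))) holomorphic_on ball 0 1"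
    by (rule holomorphic_cong) (auto simp: wirt_zbar_eq_wirt_z_cnj)
  show "in_Hardy p (\<lambda>z. cnj (wirt_zbar (poisson g) z)) \<longleftrightarrow> in_Hardy p (wirt_z (poisson (\<lambda>t. cnj (g t))))"
    unfolding in_Hardy_def h i i2 ..
  have n: "(\<lambda>z. norm (cnj (wirt_zbar (poisson g) z))) ` ball 0 1 = (\<lambda>z. norm (wirt_z (poisson (\<lambda>t. cnj (g t))) z)) ` ball 0 1"
    by (rule image_cong) (auto simp: wirt_zbar_eq_wirt_z_cnj)
  show "hardy_norm p (\<lambda>z. cnj (wirt_zbar (poisson g) z)) = hardy_norm p (wirt_z (poisson (\<lambda>t. cnj (g t))))"
    unfolding hardy_norm_def n i2 ..
qed

text \<open>Fatou's lemma along \<open>rad\<close> for \<open>norm (herglotz \<phi> z)\<close>,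
  which is at most twice \<open>norm (wirt_z (poisson g) z)\<close>. The pointwise limit is the
  modulus of \<open>\<psi>\<close>, and subtracting \<open>\<phi>\<close> leaves the Hilbert
  transform.\<close>

lemma hilbert_memL1_if_hardy:
  assumes H: "in_Hardy 1 (wirt_z (poisson g))"
  shows "memLp 1 (hilbert \<phi>)"
proof -
  obtain B where B: "\<And>r. 0 < r \<Longrightarrow> r < 1 \<Longrightarrow> (LINT t|circ_measure. norm (wirt_z (poisson g) (of_real r * cis t))) \<le> B"
    using hardyE[OF H] by blast
  define \<psi> where "\<psi> = (\<lambda>t. \<phi> t + \<i> * hilbert \<phi> t)"
  have m\<psi>: "\<psi> \<in> borel_measurable circ_measure"
    unfolding \<psi>_def using borel_measurable_integrable[OF phi_int] measurable_hilbert by measurable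
  define h where "h = (\<lambda>n t. herglotz \<phi> (of_real (rad n) * cis t))"
  have ch: "continuous_on X (h n)" for n X
    unfolding h_def by (intro continuous_on_circ_herglotz phi_int) (use rad_bounds[of n] in auto)
  have mh: "h n \<in> borel_measurable circ_measure" for n by (rule measurable_circ_continuous[OF ch])
  have hb: "(\<integral>\<^sup>+t. ennreal (norm (h n t)) \<partial>circ_measure) \<le> ennreal (2 * B)" for n
  proof -
    have i: "integrable circ_measure (\<lambda>t. norm (h n t))" by (intro integrable_circ_continuous continuous_on_norm ch)
    have "continuous_on {0..2*pi} (\<lambda>t. wirt_z (poisson g) (of_real (rad n) * cis t))"
      by (rule continuous_on_circ_dilate[OF holomorphic_wirt_z]) (use rad_bounds[of n] in auto)
    then have iw: "integrable circ_measure (\<lambda>t. norm (wirt_z (poisson g) (of_real (rad n) * cis t)))"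
      by (intro integrable_circ_continuous continuous_on_norm)
    have "(\<integral>\<^sup>+t. ennreal (norm (h n t)) \<partial>circ_measure) = ennreal (LINT t|circ_measure. norm (h n t))"
      by (rule nn_integral_eq_integral[OF i]) simp
    also have "(LINT t|circ_measure. norm (h n t)) \<le> (LINT t|circ_measure. 2 * norm (wirt_z (poisson g) (of_real (rad n) * cis t)))"
    proof (rule integral_mono[OF i])
      show "norm (h n t) \<le> 2 * norm (wirt_z (poisson g) (of_real (rad n) * cis t))" for t
      proof -
        have z: "norm (of_real (rad n) * cis t) < 1" using rad_bounds[of n] by (simp add: norm_mult)
        have "norm (h n t) = (2 * rad n) * norm (wirt_z (poisson g) (of_real (rad n) * cis t))"
          unfolding h_def wirt_z_herglotz[OF z, symmetric] using rad_bounds[of n] by (simp add: norm_mult)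
        also have "\<dots> \<le> 2 * norm (wirt_z (poisson g) (of_real (rad n) * cis t))"
          using rad_bounds[of n] by (intro mult_right_mono) auto
        finally show ?thesis .
      qed
    qed (use iw in auto)
    also have "\<dots> = 2 * (LINT t|circ_measure. norm (wirt_z (poisson g) (of_real (rad n) * cis t)))" by simp
    also have "\<dots> \<le> 2 * B" using B[OF rad_bounds] by simp
    finally show ?thesis by (simp add: ennreal_leI)
  qed
  have "(\<integral>\<^sup>+t. ennreal (norm (\<psi> t)) \<partial>circ_measure) = (\<integral>\<^sup>+t. liminf (\<lambda>n. ennreal (norm (h n t))) \<partial>circ_measure)"
  proof (rule nn_integral_cong_AE)
    show "AE t in circ_measure. ennreal (norm (\<psi> t)) = liminf (\<lambda>n. ennreal (norm (h n t)))"
      using herglotz_radial_limit_hilbert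
    proof eventually_elim
      case (elim t)
      have "(\<lambda>n. h n t) \<longlonglongrightarrow> \<psi> t" unfolding h_def \<psi>_def by (rule filterlim_compose[OF elim rad_at_left])
      then have "(\<lambda>n. ennreal (norm (h n t))) \<longlonglongrightarrow> ennreal (norm (\<psi> t))"
        by (intro tendsto_ennrealI tendsto_norm)
      from lim_imp_Liminf[OF _ this] show ?case by simp
    qed
  qed
  also have "\<dots> \<le> liminf (\<lambda>n. \<integral>\<^sup>+t. ennreal (norm (h n t)) \<partial>circ_measure)"
    by (rule nn_integral_liminf) (use mh in measurable)
  also have "\<dots> \<le> ennreal (2 * B)" by (rule Liminf_le) (use hb in auto)
  finally have "integrable circ_measure \<psi>"
    using m\<psi> by (intro integrableI_bounded) (auto simp: le_less_trans)
  then have "integrable circ_measure (\<lambda>t. -\<i> * (\<psi> t - \<phi> t))" using phi_int by auto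
  then have "integrable circ_measure (hilbert \<phi>)" by (simp add: \<psi>_def)
  then have "integrable circ_measure (\<lambda>t. norm (hilbert \<phi> t))" by auto
  then show ?thesis using measurable_hilbert by (simp add: memLp_def)
qed

lemma hilbert_memLinf_if_hardy:
  assumes phi: "memLp \<infinity> \<phi>" and H: "in_Hardy \<infinity> (wirt_z (poisson g))"
  shows "memLp \<infinity> (hilbert \<phi>)"
proof -
  obtain B where B: "\<And>z. norm z < 1 \<Longrightarrow> norm (wirt_z (poisson g) z) \<le> B"
  proof -
    obtain B where "\<forall>x\<in>wirt_z (poisson g) ` ball 0 1. norm x \<le> B"
      using H by (auto simp: in_Hardy_def bounded_iff)
    then show ?thesis by (intro that[of B]) simp
  qed
  obtain M where M: "AE t in circ_measure. norm (\<phi> t) \<le> M" using phi by (auto simp: memLp_def)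
  have "AE t in circ_measure. norm (hilbert \<phi> t) \<le> 2 * B + M"
    using M herglotz_radial_limit_hilbert
  proof eventually_elim
    case (elim t)
    have "norm (\<phi> t + \<i> * hilbert \<phi> t) \<le> 2 * B"
    proof (rule tendsto_upperbound[OF tendsto_norm[OF filterlim_compose[OF elim(2) rad_at_left]]])
      show "\<forall>\<^sub>F n in sequentially. norm (herglotz \<phi> (of_real (rad n) * cis t)) \<le> 2 * B"
      proof (rule always_eventually, rule allI)
        fix n
        have z: "norm (of_real (rad n) * cis t) < 1" using rad_bounds[of n] by (simp add: norm_mult)
        have "norm (herglotz \<phi> (of_real (rad n) * cis t)) = (2 * rad n) * norm (wirt_z (poisson g) (of_real (rad n) * cis t))"
          unfolding wirt_z_herglotz[OF z, symmetric] using rad_bounds[of n] by (simp add: norm_mult)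
        also have "\<dots> \<le> 2 * B" using rad_bounds[of n] B[OF z] by (intro mult_mono) auto
        finally show "norm (herglotz \<phi> (of_real (rad n) * cis t)) \<le> 2 * B" .
      qed
    qed simp
    moreover have "norm (\<i> * hilbert \<phi> t) \<le> norm (\<phi> t + \<i> * hilbert \<phi> t) + norm (\<phi> t)"
      using norm_triangle_ineq4[of "\<phi> t + \<i> * hilbert \<phi> t" "\<phi> t"] by simp
    ultimately show ?case using elim(1) by (simp add: norm_mult)
  qed
  then show ?thesis using measurable_hilbert by (auto simp: memLp_def)
qed

text \<open>The Poisson representation bounds the means of \<open>herglotz \<phi>\<close> by the
  integral of \<open>norm (\<psi> t)\<close>. The transform of \<open>cnj \<phi>\<close> is then
  controlled through \<open>norm_herglotz_cnj_le\<close> and the Poisson bound for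
  \<open>\<phi>\<close>.\<close>

lemma hardy_if_hilbert_memL1:
  assumes H: "memLp 1 (hilbert \<phi>)"
  shows "in_Hardy 1 (wirt_z (poisson g))" "in_Hardy 1 (\<lambda>z. cnj (wirt_zbar (poisson g) z))"
proof -
  interpret c: periodic_ac "\<lambda>t. cnj (g t)" "\<lambda>t. cnj (\<phi> t)" N by (rule periodic_ac_cnj)
  define \<psi> where "\<psi> = (\<lambda>t. \<phi> t + \<i> * hilbert \<phi> t)"
  have "integrable circ_measure (hilbert \<phi>)"
    by (rule integrable_powr_imp_integrable[where p = 1]) (use H in \<open>auto simp: memLp_def\<close>)
  then have psi: "integrable circ_measure \<psi>" unfolding \<psi>_def using phi_int by auto
  have n1: "integrable circ_measure (\<lambda>t. norm (\<phi> t) powr 1)" "integrable circ_measure (\<lambda>t. norm (\<psi> t) powr 1)"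
    "integrable circ_measure (\<lambda>t. norm (cnj (\<phi> t)) powr 1)"
    using phi_int psi by auto
  define D where "D = (LINT t|circ_measure. norm (\<psi> t) powr 1)"
  define I where "I = (LINT t|circ_measure. norm (\<phi> t) powr 1)"
  have D: "(LINT t|circ_measure. norm (herglotz \<phi> (of_real r * cis t)) powr 1) \<le> D" if r: "0 < r" "r < 1" for r
  proof -
    have "herglotz \<phi> (of_real r * cis t) = poisson \<psi> (of_real r * cis t)" for t
      unfolding \<psi>_def by (rule herglotz_eq_poisson_hilbert) (use psi r in \<open>auto simp: \<psi>_def norm_mult\<close>)
    then show ?thesis using poisson_Lp_bound[OF psi n1(2), of r] r by (simp add: D_def)
  qed
  show "in_Hardy 1 (wirt_z (poisson g))"
    using in_Hardy_wirt(1)[OF order_refl n1(1) D] by (simp add: one_ereal_def)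
  have D2: "(LINT t|circ_measure. norm (herglotz (\<lambda>t. cnj (\<phi> t)) (of_real r * cis t)) powr 1) \<le> 2 * I + D" if r: "0 < r" "r < 1" for r
  proof -
    have r': "0 \<le> r" "r < 1" using r by auto
    have i1: "integrable circ_measure (\<lambda>t. norm (poisson \<phi> (of_real r * cis t)))"
      by (intro integrable_circ_continuous continuous_on_norm continuous_on_circ_poisson phi_int r')
    have i2: "integrable circ_measure (\<lambda>t. norm (herglotz \<phi> (of_real r * cis t)))"
      by (intro integrable_circ_continuous continuous_on_norm continuous_on_circ_herglotz phi_int r')
    have i3: "integrable circ_measure (\<lambda>t. norm (herglotz (\<lambda>t. cnj (\<phi> t)) (of_real r * cis t)))"
      by (intro integrable_circ_continuous continuous_on_norm continuous_on_circ_herglotz c.phi_int r')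
    have "(LINT t|circ_measure. norm (herglotz (\<lambda>t. cnj (\<phi> t)) (of_real r * cis t))) \<le>
       (LINT t|circ_measure. 2 * norm (poisson \<phi> (of_real r * cis t)) + norm (herglotz \<phi> (of_real r * cis t)))"
      by (rule integral_mono[OF i3]) (use i1 i2 r norm_herglotz_cnj_le in \<open>auto simp: norm_mult\<close>)
    also have "\<dots> = 2 * (LINT t|circ_measure. norm (poisson \<phi> (of_real r * cis t))) + (LINT t|circ_measure. norm (herglotz \<phi> (of_real r * cis t)))"
      using i1 i2 by simp
    also have "\<dots> \<le> 2 * I + D"
      using poisson_Lp_bound[OF phi_int n1(1) order_refl r'] D[OF r] by (simp add: I_def)
    finally show ?thesis by simp
  qed
  show "in_Hardy 1 (\<lambda>z. cnj (wirt_zbar (poisson g) z))"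
    unfolding hardy_wirt_zbar_eq(1) using c.in_Hardy_wirt(1)[OF order_refl n1(3) D2] by (simp add: one_ereal_def)
qed

lemma in_Hardy_inf_wirt:
  assumes D: "\<And>z. norm z < 1 \<Longrightarrow> norm (herglotz \<phi> z) \<le> D"
  shows "in_Hardy \<infinity> (wirt_z (poisson g))"
proof -
  have "norm (wirt_z (poisson g) z) \<le> max D (1 / pi * (LINT t|circ_measure. norm (\<phi> t)))" if z: "norm z < 1" for z
  proof (cases "norm z \<le> 1/2")
    case True
    then show ?thesis unfolding wirt_z_poisson[OF z] using cauchy_transform_bound[OF True] by (simp add: norm_mult max.coboundedI2)
  next
    case False
    then have "norm (cauchy_transform \<phi> z) \<le> D" using norm_cauchy_transform_le[OF z] D[OF z] by simp
    then show ?thesis unfolding wirt_z_poisson[OF z] by (simp add: norm_mult max.coboundedI1)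
  qed
  then have "bounded (wirt_z (poisson g) ` ball 0 1)"
    unfolding bounded_iff by (intro exI[of _ "max D (1 / pi * (LINT t|circ_measure. norm (\<phi> t)))"]) auto
  then show ?thesis using holomorphic_wirt_z by (simp add: in_Hardy_def)
qed

end

lemma poisson_bounded:
  fixes \<phi> :: "real \<Rightarrow> complex"
  assumes phi: "integrable circ_measure \<phi>" and M: "AE t in circ_measure. norm (\<phi> t) \<le> M" and z: "norm z < 1"
  shows "norm (poisson \<phi> z) \<le> M"
proof -
  have n: "integrable circ_measure (\<lambda>t. norm (\<phi> t))" using phi by auto
  have "norm (poisson \<phi> z) \<le> 1 / (2*pi) * (LINT t|circ_measure. Re (hker z t) * norm (\<phi> t))"
    using poisson_norm_le[OF phi z] herglotz_Re_nonneg(1)[OF n _ z] by simp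
  also have "(LINT t|circ_measure. Re (hker z t) * norm (\<phi> t)) \<le> (LINT t|circ_measure. Re (hker z t) * M)"
  proof (rule integral_mono_AE)
    show "integrable circ_measure (\<lambda>t. Re (hker z t) * norm (\<phi> t))" by (rule integrable_poisson_real[OF n z])
    show "integrable circ_measure (\<lambda>t. Re (hker z t) * M)" by (intro integrable_poisson_real[OF _ z]) simp
    show "AE t in circ_measure. Re (hker z t) * norm (\<phi> t) \<le> Re (hker z t) * M"
      using M by eventually_elim (use poisson_kernel_pos[OF z] in \<open>auto intro: mult_left_mono simp: less_imp_le\<close>)
  qed
  also have "(LINT t|circ_measure. Re (hker z t) * M) = 2 * pi * M" using integral_poisson_kernel[OF z] by simp
  finally show ?thesis by (simp add: divide_right_mono)
qed

lemma integrable_memLp_inf: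
  assumes H: "memLp \<infinity> \<phi>"
  shows "integrable circ_measure \<phi>"
proof -
  from H obtain M where M: "AE t in circ_measure. norm (\<phi> t) \<le> M" by (auto simp: memLp_def)
  show ?thesis
  proof (rule Bochner_Integration.integrable_bound[where f = "\<lambda>_. M"])
    show "AE t in circ_measure. norm (\<phi> t) \<le> norm M" using M by eventually_elim simp
  qed (use H in \<open>simp_all add: memLp_def\<close>)
qed

lemma (in periodic_ac) hardy_if_hilbert_memLinf:
  assumes phi: "memLp \<infinity> \<phi>" and H: "memLp \<infinity> (hilbert \<phi>)"
  shows "in_Hardy \<infinity> (wirt_z (poisson g))" "in_Hardy \<infinity> (\<lambda>z. cnj (wirt_zbar (poisson g) z))"
proof -
  interpret c: periodic_ac "\<lambda>t. cnj (g t)" "\<lambda>t. cnj (\<phi> t)" N by (rule periodic_ac_cnj)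
  define \<psi> where "\<psi> = (\<lambda>t. \<phi> t + \<i> * hilbert \<phi> t)"
  have psi: "integrable circ_measure \<psi>" unfolding \<psi>_def using phi_int integrable_memLp_inf[OF H] by auto
  obtain M1 where M1: "AE t in circ_measure. norm (\<phi> t) \<le> M1" using phi by (auto simp: memLp_def)
  obtain M2 where M2: "AE t in circ_measure. norm (hilbert \<phi> t) \<le> M2" using H by (auto simp: memLp_def)
  have M: "AE t in circ_measure. norm (\<psi> t) \<le> M1 + M2"
    using M1 M2
  proof eventually_elim
    case (elim t)
    then show ?case using norm_triangle_ineq[of "\<phi> t" "\<i> * hilbert \<phi> t"] by (simp add: \<psi>_def norm_mult)
  qed
  have D: "norm (herglotz \<phi> z) \<le> M1 + M2" if z: "norm z < 1" for z
  proof -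
    have "herglotz \<phi> z = poisson \<psi> z" unfolding \<psi>_def by (rule herglotz_eq_poisson_hilbert[OF _ z]) (use psi in \<open>simp add: \<psi>_def\<close>)
    then show ?thesis using poisson_bounded[OF psi M z] by simp
  qed
  show "in_Hardy \<infinity> (wirt_z (poisson g))" by (rule in_Hardy_inf_wirt[OF D])
  have "norm (herglotz (\<lambda>t. cnj (\<phi> t)) z) \<le> 2 * M1 + (M1 + M2)" if z: "norm z < 1" for z
    using norm_herglotz_cnj_le[OF z] D[OF z] poisson_bounded[OF phi_int M1 z] by linarith
  then show "in_Hardy \<infinity> (\<lambda>z. cnj (wirt_zbar (poisson g) z))"
    unfolding hardy_wirt_zbar_eq(1) by (rule c.in_Hardy_inf_wirt)
qed

section \<open>The two parts of the theorem\<close>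

lemma integrable_memLp:
  assumes "memLp (ereal p) \<phi>" "1 \<le> p"
  shows "integrable circ_measure \<phi>" "integrable circ_measure (\<lambda>t. norm (\<phi> t) powr p)"
proof -
  show "integrable circ_measure (\<lambda>t. norm (\<phi> t) powr p)" using assms(1) by (simp add: memLp_def)
  then show "integrable circ_measure \<phi>"
    by (rule integrable_powr_imp_integrable[rotated]) (use assms in \<open>auto simp: memLp_def\<close>)
qed

lemma periodic_ac_circle:
  assumes F: "circle_abs_cont F" and int: "integrable circ_measure (dotF F)"
  shows "periodic_ac (\<lambda>t. F (cis t)) (dotF F) {t. \<not> (\<lambda>t. F (cis t)) differentiable (at t)}"
proof -
  have d: "dotF F = (\<lambda>t. vector_derivative (\<lambda>s. F (cis s)) (at t))" by (simp add: dotF_def fun_eq_iff)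
  have per: "F (cis (t + 2*pi)) = F (cis t)" for t by (simp add: cis_mult[symmetric])
  show ?thesis
    unfolding d by (rule periodic_acI[where g = "\<lambda>t. F (cis t)", OF per]) (use F int in \<open>auto simp: circle_abs_cont_def d\<close>)
qed

lemma max_hardy_norm_le:
  assumes p: "1 < p"
  shows "\<exists>A. \<forall>F. circle_abs_cont F \<and> memLp (ereal p) (dotF F) \<longrightarrow>
     in_Hardy (ereal p) (wirt_z (poisson (\<lambda>\<theta>. F (cis \<theta>)))) \<and>
     in_Hardy (ereal p) (\<lambda>z. cnj (wirt_zbar (poisson (\<lambda>\<theta>. F (cis \<theta>))) z)) \<and>
     max (hardy_norm (ereal p) (wirt_z (poisson (\<lambda>\<theta>. F (cis \<theta>)))))
         (hardy_norm (ereal p) (\<lambda>z. cnj (wirt_zbar (poisson (\<lambda>\<theta>. F (cis \<theta>))) z)))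
       \<le> A * Lp_norm (ereal p) (dotF F)"
proof -
  obtain A where A: "A \<ge> 0" and R: "\<And>\<phi> r. integrable circ_measure \<phi> \<Longrightarrow> integrable circ_measure (\<lambda>t. norm (\<phi> t) powr p) \<Longrightarrow>
      (LINT t|circ_measure. \<phi> t) = 0 \<Longrightarrow> 0 \<le> r \<Longrightarrow> r < 1 \<Longrightarrow>
      (LINT t|circ_measure. norm (herglotz \<phi> (of_real r * cis t)) powr p) \<le> A * (LINT t|circ_measure. norm (\<phi> t) powr p)"
    using herglotz_Lp_bound[OF p] by blast
  \<comment> \<open>\<open>in_Hardy_wirt\<close> with \<open>D = A * I\<close> yields
    \<open>(A + 2 powr p) * I\<close> under the root; the factor 1/(2 pi) goes with \<open>I\<close>
    into \<open>Lp_norm\<close>.\<close>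
  define C where "C = (A + 2 powr p) powr (1 / p)"
  show ?thesis
  proof (intro exI[of _ C] allI impI)
    fix F assume F: "circle_abs_cont F \<and> memLp (ereal p) (dotF F)"
    have p1: "1 \<le> p" using p by simp
    note int = integrable_memLp[OF conjunct2[OF F] p1]
    interpret periodic_ac "\<lambda>t. F (cis t)" "dotF F" "{t. \<not> (\<lambda>t. F (cis t)) differentiable (at t)}"
      by (rule periodic_ac_circle[OF conjunct1[OF F] int(1)])
    interpret c: periodic_ac "\<lambda>t. cnj (F (cis t))" "\<lambda>t. cnj (dotF F t)" "{t. \<not> (\<lambda>t. F (cis t)) differentiable (at t)}"
      by (rule periodic_ac_cnj)
    define I where "I = (LINT t|circ_measure. norm (dotF F t) powr p)"
    have I0: "0 \<le> I" unfolding I_def by (rule integral_nonneg_AE) auto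
    have Ic: "integrable circ_measure (\<lambda>t. norm (cnj (dotF F t)) powr p)" "(LINT t|circ_measure. norm (cnj (dotF F t)) powr p) = I"
      using int(2) by (simp_all add: I_def)
    have R1: "(LINT t|circ_measure. norm (herglotz (dotF F) (of_real r * cis t)) powr p) \<le> A * I" if "0 < r" "r < 1" for r
      unfolding I_def by (rule R[OF int integral_phi]) (use that in auto)
    have R2: "(LINT t|circ_measure. norm (herglotz (\<lambda>t. cnj (dotF F t)) (of_real r * cis t)) powr p) \<le> A * I" if "0 < r" "r < 1" for r
      using R[OF c.phi_int Ic(1) c.integral_phi, of r] that unfolding Ic(2) by simp
    have eq: "(1 / (2*pi) * (A * I + 2 powr p * I)) powr (1 / p) = C * Lp_norm (ereal p) (dotF F)"
    proof -
      have "1 / (2*pi) * (A * I + 2 powr p * I) = (A + 2 powr p) * (1 / (2*pi) * I)" by (simp add: algebra_simps add_divide_distrib)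
      also have "\<dots> powr (1/p) = C * (1 / (2*pi) * I) powr (1/p)"
        unfolding C_def by (rule powr_mult)
      finally show ?thesis by (simp add: Lp_norm_def I_def)
    qed
    show "in_Hardy (ereal p) (wirt_z (poisson (\<lambda>\<theta>. F (cis \<theta>)))) \<and>
       in_Hardy (ereal p) (\<lambda>z. cnj (wirt_zbar (poisson (\<lambda>\<theta>. F (cis \<theta>))) z)) \<and>
       max (hardy_norm (ereal p) (wirt_z (poisson (\<lambda>\<theta>. F (cis \<theta>)))))
           (hardy_norm (ereal p) (\<lambda>z. cnj (wirt_zbar (poisson (\<lambda>\<theta>. F (cis \<theta>))) z)))
         \<le> C * Lp_norm (ereal p) (dotF F)"
      using in_Hardy_wirt[OF p1 int(2) R1] c.in_Hardy_wirt[OF p1 Ic(1) R2]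
      unfolding hardy_wirt_zbar_eq Ic(2) I_def[symmetric] eq by simp
  qed
qed

lemma hardy_iff_hilbert:
  assumes p: "p \<in> {1, \<infinity>}" and F: "circle_abs_cont F" "memLp p (dotF F)"
  shows "in_Hardy p (wirt_z (poisson (\<lambda>\<theta>. F (cis \<theta>)))) \<and> in_Hardy p (\<lambda>z. cnj (wirt_zbar (poisson (\<lambda>\<theta>. F (cis \<theta>))) z))
      \<longleftrightarrow> memLp p (hilbert (dotF F))"
    and "memLp p (hilbert (dotF F)) \<Longrightarrow> norm z < 1 \<Longrightarrow>
      2 * \<i> * z * wirt_z (poisson (\<lambda>\<theta>. F (cis \<theta>))) z = poisson (\<lambda>\<theta>. dotF F \<theta> + \<i> * hilbert (dotF F) \<theta>) z"
proof -
  have int: "integrable circ_measure \<phi>" if "memLp p \<phi>" for \<phi>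
    using p that integrable_memLp(1)[of 1 \<phi>] integrable_memLp_inf by (auto simp: one_ereal_def)
  interpret periodic_ac "\<lambda>t. F (cis t)" "dotF F" "{t. \<not> (\<lambda>t. F (cis t)) differentiable (at t)}"
    by (rule periodic_ac_circle[OF F(1) int[OF F(2)]])
  show "in_Hardy p (wirt_z (poisson (\<lambda>\<theta>. F (cis \<theta>)))) \<and> in_Hardy p (\<lambda>z. cnj (wirt_zbar (poisson (\<lambda>\<theta>. F (cis \<theta>))) z))
      \<longleftrightarrow> memLp p (hilbert (dotF F))"
    using p F(2) hilbert_memL1_if_hardy hilbert_memLinf_if_hardy hardy_if_hilbert_memL1 hardy_if_hilbert_memLinf by blast
  show "2 * \<i> * z * wirt_z (poisson (\<lambda>\<theta>. F (cis \<theta>))) z = poisson (\<lambda>\<theta>. dotF F \<theta> + \<i> * hilbert (dotF F) \<theta>) z"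
    if H: "memLp p (hilbert (dotF F))" and z: "norm z < 1"
  proof -
    have "integrable circ_measure (\<lambda>t. dotF F t + \<i> * hilbert (dotF F) t)" using phi_int int[OF H] by auto
    then show ?thesis unfolding wirt_z_herglotz[OF z] by (rule herglotz_eq_poisson_hilbert[OF _ z])
  qed
qed

theorem mainTheorem1:
  shows
  "(\<forall>p::real. 1 < p \<longrightarrow>
      (\<exists>A::real. \<forall>F::complex \<Rightarrow> complex.
         circle_abs_cont F \<and> memLp (ereal p) (dotF F) \<longrightarrow>
           (let f = poisson (\<lambda>\<theta>. F (cis \<theta>)) in
              in_Hardy (ereal p) (wirt_z f) \<and>
              in_Hardy (ereal p) (\<lambda>z. cnj (wirt_zbar f z)) \<and>
              max (hardy_norm (ereal p) (wirt_z f))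
                  (hardy_norm (ereal p) (\<lambda>z. cnj (wirt_zbar f z)))
                \<le> A * Lp_norm (ereal p) (dotF F))))
   \<and>
   (\<forall>p\<in>{1::ereal, \<infinity>}. \<forall>F::complex \<Rightarrow> complex.
      circle_abs_cont F \<and> memLp p (dotF F) \<longrightarrow>
        (let f = poisson (\<lambda>\<theta>. F (cis \<theta>)) in
           ((in_Hardy p (wirt_z f) \<and> in_Hardy p (\<lambda>z. cnj (wirt_zbar f z)))
              \<longleftrightarrow> memLp p (hilbert (dotF F))) \<and>
           (memLp p (hilbert (dotF F)) \<longrightarrow>
              (\<forall>z\<in>ball 0 1. 2 * \<i> * z * wirt_z f z
                 = poisson (\<lambda>\<theta>. dotF F \<theta> + \<i> * hilbert (dotF F) \<theta>) z))))"
  unfolding Let_def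
proof (intro conjI allI impI ballI)
  show "\<exists>A. \<forall>F. circle_abs_cont F \<and> memLp (ereal p) (dotF F) \<longrightarrow>
      in_Hardy (ereal p) (wirt_z (poisson (\<lambda>\<theta>. F (cis \<theta>)))) \<and>
      in_Hardy (ereal p) (\<lambda>z. cnj (wirt_zbar (poisson (\<lambda>\<theta>. F (cis \<theta>))) z)) \<and>
      max (hardy_norm (ereal p) (wirt_z (poisson (\<lambda>\<theta>. F (cis \<theta>)))))
          (hardy_norm (ereal p) (\<lambda>z. cnj (wirt_zbar (poisson (\<lambda>\<theta>. F (cis \<theta>))) z)))
        \<le> A * Lp_norm (ereal p) (dotF F)" if "1 < p" for p
    using that by (rule max_hardy_norm_le)
next
  fix p :: ereal and F
  assume p: "p \<in> {1, \<infinity>}" and F: "circle_abs_cont F \<and> memLp p (dotF F)"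
  note * = hardy_iff_hilbert[OF p conjunct1[OF F] conjunct2[OF F]]
  show "(in_Hardy p (wirt_z (poisson (\<lambda>\<theta>. F (cis \<theta>)))) \<and> in_Hardy p (\<lambda>z. cnj (wirt_zbar (poisson (\<lambda>\<theta>. F (cis \<theta>))) z)))
      = memLp p (hilbert (dotF F))" by (rule *(1))
  show "2 * \<i> * z * wirt_z (poisson (\<lambda>\<theta>. F (cis \<theta>))) z = poisson (\<lambda>\<theta>. dotF F \<theta> + \<i> * hilbert (dotF F) \<theta>) z"
    if "memLp p (hilbert (dotF F))" "z \<in> ball 0 1" for z
    using *(2) that by simp
qed

end
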